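(* Let $n\ge 2$ and let $\alpha_n$ be the supremum of $\omega(A)/\omega(\mathbb S^{n-1})$ over all measurable sets $A\subseteq\mathbb S^{n-1}$ avoiding orthogonality ($\omega$ the surface measure). Let $X=\{x_1,-x_1,\dots,x_N,-x_N\}\subset\mathbb S^{n-1}$ be a finite symmetric set, with $x_i\neq \pm x_j$ for $i\neq j$, let $v_i=\{x_i,-x_i\}$, and let $G_X$ be the orthogonality graph of $X$. Suppose real parameters are given: $q_1$; $s_{Y,Z}$ for each ordered pair $(Y,Z)$ of geometrically congruent sets of vertices of $G_X$; $w_0$; and $w_{i,j}$ for all $1\le i\le j\le N$. Assume that $$w_0P_k(0)+\sum_{1\le i\le j\le N}w_{i,j}P_k(\langle x_i,x_j\rangle)\ge 1\quad\text{for all even } k\ge 0,$$ and $$q_1-\sum_{i\le j:\ v_i,v_j\in I}w_{i,j}+\sum_{(Y,Z):\,Y\subseteq I}s_{Y,Z}-\sum_{(Y,Z):\,Z\subseteq I}s_{Y,Z}\ge 0$$ for every independent set $I$ of vertices of $G_X$ (the sums over $(Y,Z)$ running over the pairs of congruent vertex sets for which parameters $s_{Y,Z}$ are given). Then $\alpha_n\le q_1$.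
   Context: A measurable set $A\subseteq\mathbb S^{n-1}$ avoids orthogonality if $\langle a,a'\rangle\ne0$ for all $a,a'\in A$. For a finite symmetric set $X=\bigcup_{i=1}^N\{x_i,-x_i\}\subset\mathbb S^{n-1}$, the orthogonality graph $G_X$ has vertex set $\{v_1,\dots,v_N\}$, $v_i=\{x_i,-x_i\}$, with $v_i,v_j$ adjacent iff $\langle x_i,x_j\rangle=0$; an independent set is a set of vertices with no edges among them (the empty set included). For an orthogonal transformation $T\in O(n)$, write $T(v_i)=v_j$ if $T(x_i)=x_j$ or $T(x_i)=-x_j$. Two sets of vertices $Y,Z$ of $G_X$ are geometrically congruent if there is $T\in O(n)$ with $T(Y)=Z$ in this sense. $P_k$ denotes the Gegenbauer polynomial of degree $k$ and index $(n-2)/2$ (i.e. the degree-$k$ orthogonal polynomial on $[-1,1]$ for the weight $(1-t^2)^{(n-3)/2}$; the Legendre polynomials when $n=3$), normalized so that $P_k(1)=1$. For even $k$, $P_k$ is even, so $P_k(\langle x_i,x_j\rangle)$ depends only on $v_i,v_j$. *)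

theory Defs
  imports "HOL-Analysis.Analysis" "HOL-Computational_Algebra.Polynomial"
begin

section \<open>Surface measure on the unit sphere\<close>

text \<open>
  The surface measure \<open>\<omega>\<close> is obtained from polar coordinates:
  \<open>\<omega>(A) = n \<cdot> vol {r a | 0 < r \<le> 1, a \<in> A}\<close>, see \<open>emeasure_sphere_measure\<close>.
  Because of the completion, its measurable sets are all Lebesgue measurable subsets of the sphere,
  not just the Borel ones.
\<close>

definition sphere_measure :: "(real ^ 'n) measure" where
  "sphere_measure =
     completion (scale_measure (of_nat CARD('n))
       (distr (restrict_space lborel (cball 0 1 - {0})) (restrict_space borel (sphere 0 1))
         (\<lambda>y. y /\<^sub>R norm y)))"

lemma measurable_sphere_projection:
  "(\<lambda>y::real^'n. y /\<^sub>R norm y)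
     \<in> restrict_space lborel (cball 0 1 - {0}) \<rightarrow>\<^sub>M restrict_space borel (sphere 0 1)"
proof (rule measurable_restrict_space2)
  show "(\<lambda>y::real^'n. y /\<^sub>R norm y) \<in> restrict_space lborel (cball 0 1 - {0}) \<rightarrow>\<^sub>M borel"
    by (rule measurable_restrict_space1) measurable
qed (auto simp: space_restrict_space)

lemma space_sphere_measure [simp]: "space (sphere_measure :: (real^'n) measure) = sphere 0 1"
  by (simp add: sphere_measure_def space_scale_measure space_restrict_space)

lemma sets_sphere_measure_borel:
  fixes A :: "(real^'n) set"
  assumes "A \<in> sets borel" "A \<subseteq> sphere 0 1"
  shows "A \<in> sets sphere_measure"
  using assms
  by (auto simp: sphere_measure_def sets_restrict_space_iff intro!: sets_completionI_sets)

lemma emeasure_sphere_measure: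
  fixes A :: "(real^'n) set"
  assumes "A \<in> sets borel" "A \<subseteq> sphere 0 1"
  shows "emeasure sphere_measure A
           = of_nat CARD('n) * emeasure lborel {r *\<^sub>R a | r a. 0 < r \<and> r \<le> 1 \<and> a \<in> A}"
proof -
  let ?f = "\<lambda>y::real^'n. y /\<^sub>R norm y"
  let ?R = "restrict_space lborel (cball 0 1 - {0::real^'n})"
  have A: "A \<in> sets (restrict_space borel (sphere 0 1))"
    using assms by (auto simp: sets_restrict_space_iff)
  have eq: "?f -` A \<inter> space ?R = {r *\<^sub>R a | r a. 0 < r \<and> r \<le> 1 \<and> a \<in> A}" (is "?l = ?r")
  proof (intro equalityI subsetI)
    fix y assume y: "y \<in> ?l"
    then have "y = norm y *\<^sub>R ?f y" "0 < norm y" "norm y \<le> 1" "?f y \<in> A"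
      by (auto simp: space_restrict_space)
    then show "y \<in> ?r" by blast
  next
    fix y assume "y \<in> ?r"
    then obtain r a where ra: "y = r *\<^sub>R a" "0 < r" "r \<le> 1" "a \<in> A" by blast
    then have "norm a = 1" using assms by auto
    then show "y \<in> ?l" using ra by (auto simp: space_restrict_space)
  qed
  have "emeasure sphere_measure A = of_nat CARD('n) * emeasure ?R (?f -` A \<inter> space ?R)"
    using A measurable_sphere_projection[where 'n='n]
    by (simp add: sphere_measure_def emeasure_completion emeasure_distr)
  also have "emeasure ?R (?f -` A \<inter> space ?R) = emeasure lborel (?f -` A \<inter> space ?R)"
    by (rule emeasure_restrict_space) (auto simp: space_restrict_space)
  finally show ?thesis unfolding eq .
qed

lemma emeasure_sphere_measure_sphere:
  "emeasure sphere_measure (sphere 0 1 :: (real^'n) set)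
     = of_nat CARD('n) * emeasure lborel (ball 0 1 :: (real^'n) set)"
proof -
  have "{r *\<^sub>R a | r (a::real^'n). 0 < r \<and> r \<le> 1 \<and> a \<in> sphere 0 1} = cball 0 1 - {0}" (is "?l = ?r")
  proof (intro equalityI subsetI)
    fix y :: "real^'n" assume "y \<in> ?r"
    then have "y = norm y *\<^sub>R (y /\<^sub>R norm y)" "0 < norm y" "norm y \<le> 1" "y /\<^sub>R norm y \<in> sphere 0 1"
      by auto
    then show "y \<in> ?l" by blast
  qed auto
  moreover have "emeasure lborel (cball 0 1 - {0::real^'n}) = emeasure lborel (cball 0 1 :: (real^'n) set)"
    by (rule emeasure_Diff_null_set) auto
  moreover have "emeasure lborel (cball 0 1 :: (real^'n) set) = emeasure lborel (ball 0 1 :: (real^'n) set)"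
    by (simp add: emeasure_cball emeasure_ball)
  ultimately show ?thesis
    by (simp add: emeasure_sphere_measure)
qed

lemma finite_measure_sphere_measure: "finite_measure (sphere_measure :: (real^'n) measure)"
proof
  show "emeasure sphere_measure (space (sphere_measure :: (real^'n) measure)) \<noteq> \<infinity>"
    using emeasure_lborel_ball_finite[of "0::real^'n" 1]
    by (auto simp: emeasure_sphere_measure_sphere ennreal_mult_eq_top_iff)
qed

lemma measure_sphere_measure_pos: "measure sphere_measure (sphere 0 1 :: (real^'n) set) > 0"
proof -
  have "measure sphere_measure (sphere 0 1 :: (real^'n) set)
          = real CARD('n) * measure lborel (ball 0 1 :: (real^'n) set)"
    by (simp add: measure_def emeasure_sphere_measure_sphere enn2real_mult)
  then show ?thesis
    using content_ball_pos[of 1 "0::real^'n"] by simp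
qed

definition avoids_orthogonality :: "(real ^ 'n) set \<Rightarrow> bool" where
  "avoids_orthogonality A \<longleftrightarrow> (\<forall>a\<in>A. \<forall>a'\<in>A. a \<bullet> a' \<noteq> 0)"

definition alpha :: "'n::finite itself \<Rightarrow> real" where
  "alpha _ = (SUP A\<in>{A :: (real ^ 'n) set. A \<in> sets sphere_measure \<and> avoids_orthogonality A}.
     measure sphere_measure A / measure sphere_measure (sphere 0 1 :: (real ^ 'n) set))"

lemma alpha_upper:
  fixes A :: "(real ^ 'n) set"
  assumes "A \<in> sets sphere_measure" "avoids_orthogonality A"
  shows "measure sphere_measure A / measure sphere_measure (sphere 0 1 :: (real ^ 'n) set)
           \<le> alpha TYPE('n)"
  unfolding alpha_def
proof (rule cSUP_upper)
  interpret finite_measure "sphere_measure :: (real ^ 'n) measure"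
    by (rule finite_measure_sphere_measure)
  show "bdd_above ((\<lambda>A. measure sphere_measure A
          / measure sphere_measure (sphere 0 1 :: (real ^ 'n) set)) `
          {A :: (real ^ 'n) set. A \<in> sets sphere_measure \<and> avoids_orthogonality A})"
    using bounded_measure measure_sphere_measure_pos[where 'n='n]
    by (intro bdd_aboveI2[where M = 1]) simp
qed (use assms in simp)


section \<open>Gegenbauer polynomials of index \<open>(n - 2) / 2\<close>\<close>

definition gegenbauer_weight :: "nat \<Rightarrow> real \<Rightarrow> real" where
  "gegenbauer_weight n t = (1 - t\<^sup>2) powr ((real n - 3) / 2)"

definition is_gegenbauer :: "nat \<Rightarrow> nat \<Rightarrow> real poly \<Rightarrow> bool" where
  "is_gegenbauer n k p \<longleftrightarrow>
     degree p = k \<and> poly p 1 = 1 \<and>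
     (\<forall>q. degree q < k \<longrightarrow> (LBINT t:{-1..1}. poly p t * poly q t * gegenbauer_weight n t) = 0)"

definition gegenbauer :: "nat \<Rightarrow> nat \<Rightarrow> real poly" where
  "gegenbauer n k = (THE p. is_gegenbauer n k p)"

lemma borel_measurable_poly [measurable]: "poly p \<in> borel_measurable (borel :: real measure)"
  by (intro borel_measurable_continuous_onI continuous_intros)

lemma borel_measurable_gegenbauer_weight [measurable]:
  "gegenbauer_weight n \<in> borel_measurable borel"
  unfolding gegenbauer_weight_def by measurable

lemma integrable_poly_weight:
  assumes "n \<ge> 2"
  shows "set_integrable lborel {-1..1} (\<lambda>t. poly p t * gegenbauer_weight n t)"
proof -
  have F: "set_integrable lborel (einterval (-1) 1) (\<lambda>x. inverse (sqrt (1 - x\<^sup>2)))"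
  proof (rule interval_integral_FTC_nonneg(1)[where F = arcsin])
    fix x :: real assume "-1 < ereal x" "ereal x < 1"
    then have x: "-1 < x" "x < 1" by (simp_all add: one_ereal_def)
    then show "DERIV arcsin x :> inverse (sqrt (1 - x\<^sup>2))" by (rule DERIV_arcsin)
    have "1 - x\<^sup>2 > 0" using x by (simp add: abs_square_less_1 abs_less_iff)
    then show "isCont (\<lambda>x. inverse (sqrt (1 - x\<^sup>2))) x" by (intro continuous_intros) auto
  next
    have "x\<^sup>2 \<le> 1" if "-1 < ereal x" "ereal x < 1" for x :: real
      using that by (simp add: abs_square_le_1 one_ereal_def abs_le_iff)
    then show "AE x in lborel. -1 < ereal x \<longrightarrow> ereal x < 1 \<longrightarrow> 0 \<le> inverse (sqrt (1 - x\<^sup>2))"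
      by auto
  next
    have c: "continuous_on {-1..1} arcsin" by (rule continuous_on_arcsin')
    have "(arcsin \<longlongrightarrow> arcsin (-1)) (at_right (-1))"
      using c by (rule continuous_on_Icc_at_rightD) simp
    then have "((arcsin \<circ> real_of_ereal) \<longlongrightarrow> arcsin (-1)) (at_right (ereal (-1)))"
      by (simp only: ereal_tendsto_simps1)
    then show "((arcsin \<circ> real_of_ereal) \<longlongrightarrow> arcsin (-1)) (at_right (-1))"
      by (simp add: one_ereal_def)
    have "(arcsin \<longlongrightarrow> arcsin 1) (at_left 1)"
      using c by (rule continuous_on_Icc_at_leftD) simp
    then have "((arcsin \<circ> real_of_ereal) \<longlongrightarrow> arcsin 1) (at_left (ereal 1))"
      by (simp only: ereal_tendsto_simps1)
    then show "((arcsin \<circ> real_of_ereal) \<longlongrightarrow> arcsin 1) (at_left 1)"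
      by (simp add: one_ereal_def)
  qed (simp add: one_ereal_def)
  have "compact (poly p ` {-1..1})" by (intro compact_continuous_image continuous_intros) auto
  then obtain B where B: "\<And>t. t \<in> {-1..1} \<Longrightarrow> \<bar>poly p t\<bar> \<le> B"
    by (meson bounded_real compact_imp_bounded imageI)
  have G: "set_integrable lborel (einterval (-1) 1) (\<lambda>x. B * inverse (sqrt (1 - x\<^sup>2)))"
    using F by (rule set_integrable_mult_right)
  have ei: "einterval (-1) 1 = {-1<..<1::real}"
    by (auto simp: einterval_def one_ereal_def)
  have "set_integrable lborel {-1<..<1} (\<lambda>t. poly p t * gegenbauer_weight n t)"
    unfolding set_integrable_def
  proof (rule Bochner_Integration.integrable_bound[OF G[unfolded set_integrable_def ei]])
    show "(\<lambda>x. indicator {-1<..<1} x *\<^sub>R (poly p x * gegenbauer_weight n x)) \<in> borel_measurable lborel"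
      by measurable
    show "AE x in lborel. norm (indicator {-1<..<1} x *\<^sub>R (poly p x * gegenbauer_weight n x))
            \<le> norm (indicator {-1<..<1} x *\<^sub>R (B * inverse (sqrt (1 - x\<^sup>2))))"
    proof (rule AE_I2)
      fix x :: real
      show "norm (indicator {-1<..<1} x *\<^sub>R (poly p x * gegenbauer_weight n x))
            \<le> norm (indicator {-1<..<1} x *\<^sub>R (B * inverse (sqrt (1 - x\<^sup>2))))"
      proof (cases "x \<in> {-1<..<1}")
        case True
        then have x: "0 < 1 - x\<^sup>2" "1 - x\<^sup>2 \<le> 1" by (auto simp: abs_square_less_1 abs_less_iff)
        have "gegenbauer_weight n x \<le> (1 - x\<^sup>2) powr (-(1/2))"
          unfolding gegenbauer_weight_def using x assms by (intro powr_mono') auto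
        also have "\<dots> = inverse (sqrt (1 - x\<^sup>2))"
          using x by (simp add: powr_minus powr_half_sqrt)
        finally have "\<bar>poly p x\<bar> * gegenbauer_weight n x \<le> B * inverse (sqrt (1 - x\<^sup>2))"
          using B[of x] True by (intro mult_mono) (auto simp: gegenbauer_weight_def)
        moreover have "gegenbauer_weight n x \<ge> 0" by (simp add: gegenbauer_weight_def)
        moreover have "B \<ge> 0" using B[of x] True by force
        ultimately show ?thesis using True x by (simp add: abs_mult)
      qed simp
    qed
  qed
  moreover have "AE t::real in lborel. indicator {-1<..<1} t = (indicator {-1..1} t :: real)"
    using AE_lborel_singleton[of "-1::real"] AE_lborel_singleton[of "1::real"]
    by eventually_elim (auto simp: indicator_def)
  then have "integrable lborel (\<lambda>t. indicator {-1..1} t *\<^sub>R (poly p t * gegenbauer_weight n t))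
      \<longleftrightarrow> integrable lborel (\<lambda>t. indicator {-1<..<1} t *\<^sub>R (poly p t * gegenbauer_weight n t))"
    by (intro integrable_cong_AE) auto
  ultimately show ?thesis
    unfolding set_integrable_def by blast
qed

context
  fixes n :: nat
  assumes n: "n \<ge> 2"
begin

private definition L :: "real poly \<Rightarrow> real" where
  "L p = (LBINT t:{-1..1}. poly p t * gegenbauer_weight n t)"

private lemma L_add: "L (p + q) = L p + L q"
  unfolding L_def using integrable_poly_weight[OF n]
  by (simp add: distrib_right set_integral_add)

private lemma L_smult: "L (smult c p) = c * L p"
  unfolding L_def by (simp add: mult.assoc)

private lemma L_diff: "L (p - q) = L p - L q"
  using L_add[of p "smult (-1) q"] L_smult[of "-1" q] by simp

private lemma L_0: "L 0 = 0"
  by (simp add: L_def)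

private lemma L_sum: "L (\<Sum>i\<in>S. f i) = (\<Sum>i\<in>S. L (f i))"
  by (induction S rule: infinite_finite_induct) (auto simp: L_0 L_add)

private lemma L_pos:
  assumes "\<And>t. t \<in> {-1..1} \<Longrightarrow> poly p t \<ge> 0" "p \<noteq> 0"
  shows "L p > 0"
proof -
  let ?f = "\<lambda>t. indicator {-1..1} t *\<^sub>R (poly p t * gegenbauer_weight n t)"
  have int: "integrable lborel ?f"
    using integrable_poly_weight[OF n] by (simp add: set_integrable_def)
  have nn: "?f t \<ge> 0" for t
    using assms(1) by (auto simp: indicator_def gegenbauer_weight_def)
  have L: "L p = integral\<^sup>L lborel ?f" by (simp add: L_def set_lebesgue_integral_def)
  have "L p \<noteq> 0"
  proof
    assume "L p = 0"
    then have "AE t in lborel. ?f t = 0"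
      using integral_nonneg_eq_0_iff_AE[OF int] nn L by simp
    moreover have "AE t in lborel. t \<notin> {t. poly p t = 0}"
      using poly_roots_finite[OF assms(2)]
      by (intro AE_not_in finite_imp_null_set_lborel)
    ultimately have "AE t in lborel. t \<notin> {-1<..<1::real}"
    proof eventually_elim
      case (elim t)
      have "gegenbauer_weight n t > 0" if "t \<in> {-1<..<1}"
        using that abs_square_eq_1[of t] by (auto simp: gegenbauer_weight_def)
      then show ?case using elim by (auto simp: indicator_def split: if_splits)
    qed
    then have "{-1<..<1::real} \<in> null_sets lborel"
      by (subst (asm) AE_iff_null_sets[symmetric]) auto
    then show False by (simp add: null_sets_def)
  qed
  moreover have "L p \<ge> 0" unfolding L by (rule Bochner_Integration.integral_nonneg) (rule nn)
  ultimately show ?thesis by simp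
qed

private lemma L_sq_pos: "p \<noteq> 0 \<Longrightarrow> L (p * p) > 0"
  by (rule L_pos) auto

private lemma orth_root_1:
  assumes deg: "degree p \<le> k" and orth: "\<And>q. degree q < k \<Longrightarrow> L (p * q) = 0" and "poly p 1 = 0"
  shows "p = 0"
proof (rule ccontr)
  assume "p \<noteq> 0"
  obtain q where q: "p = [:-1, 1:] * q"
    using \<open>poly p 1 = 0\<close> by (auto simp: poly_eq_0_iff_dvd)
  with \<open>p \<noteq> 0\<close> have q0: "q \<noteq> 0" by auto
  then have "degree p = degree q + 1" unfolding q by (subst degree_mult_eq) auto
  then have "L (p * q) = 0" using deg by (intro orth) auto
  moreover have "L (smult (-1) (p * q)) > 0"
  proof (rule L_pos)
    fix t :: real assume "t \<in> {-1..1}"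
    then have "0 \<le> (1 - t) * (poly q t * poly q t)" by (simp add: zero_le_mult_iff)
    then show "0 \<le> poly (smult (-1) (p * q)) t" by (simp add: q algebra_simps)
  qed (use \<open>p \<noteq> 0\<close> q0 in auto)
  ultimately show False using L_smult[of "-1" "p * q"] by linarith
qed

private lemma orth_span:
  assumes P: "\<And>j. j < k \<Longrightarrow> degree (P j) = j \<and> P j \<noteq> 0"
    and p: "\<And>j. j < k \<Longrightarrow> L (p * P j) = 0"
  shows "degree q < k \<Longrightarrow> L (p * q) = 0"
proof (induction "degree q" arbitrary: q rule: less_induct)
  case less
  let ?d = "degree q"
  let ?c = "lead_coeff q / lead_coeff (P ?d)"
  let ?r = "q - smult ?c (P ?d)"
  have Pd: "degree (P ?d) = ?d" "P ?d \<noteq> 0" using P[OF less.prems] by auto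
  have "L (p * ?r) = 0"
  proof (cases "?r = 0")
    case False
    have "lead_coeff (P ?d) \<noteq> 0" using Pd(2) by (simp only: leading_coeff_0_iff not_False_eq_True)
    then have "coeff ?r ?d = 0" using Pd(1) by simp
    moreover have "degree ?r \<le> ?d" using Pd by (intro degree_diff_le) (auto intro: order.trans[OF degree_smult_le])
    ultimately have "degree ?r < ?d"
      using False by (metis le_neq_implies_less leading_coeff_0_iff)
    then show ?thesis using less by auto
  qed (simp add: L_0)
  moreover have "p * q = p * ?r + smult ?c (p * P ?d)" by (simp add: algebra_simps)
  ultimately show ?case using p[OF less.prems] by (simp only: L_add L_smult mult_zero_right add_0_right)
qed

private lemma orth_exists: "\<exists>p. degree p = k \<and> p \<noteq> 0 \<and> (\<forall>q. degree q < k \<longrightarrow> L (p * q) = 0)"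
proof (induction k rule: less_induct)
  case (less k)
  then obtain P where P: "\<And>j. j < k \<Longrightarrow> degree (P j) = j \<and> P j \<noteq> 0 \<and>
      (\<forall>q. degree q < j \<longrightarrow> L (P j * q) = 0)"
    by metis
  define m :: "real poly" where "m = monom 1 k"
  define c where "c j = L (m * P j) / L (P j * P j)" for j
  define p where "p = m - (\<Sum>j<k. smult (c j) (P j))"
  have m: "coeff m k = 1" by (simp add: m_def)
  have "coeff (P j) k = 0" if "j < k" for j
    using P[OF that] that by (intro coeff_eq_0) auto
  then have ck: "coeff p k = 1" by (simp add: p_def coeff_sum m)
  have "degree (\<Sum>j<k. smult (c j) (P j)) \<le> k"
    using P by (intro degree_sum_le) (auto intro!: order.trans[OF degree_smult_le])
  then have "degree p \<le> k"
    unfolding p_def by (intro degree_diff_le) (auto simp: m_def degree_monom_le)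
  with ck have deg: "degree p = k" by (metis le_antisym le_degree zero_neq_one)
  have PP: "L (P i * P j) = 0" if "i < k" "j < k" "i \<noteq> j" for i j
  proof (cases i j rule: linorder_cases)
    case less
    then have "L (P j * P i) = 0" using P[of i] P[of j] that by simp
    then show ?thesis by (simp add: mult.commute)
  next
    case greater
    then show ?thesis using P[of i] P[of j] that by simp
  qed (use that in simp)
  have "L (p * P j) = 0" if j: "j < k" for j
  proof -
    have "L (p * P j) = L (m * P j) - (\<Sum>i<k. c i * L (P i * P j))"
      by (simp add: p_def left_diff_distrib sum_distrib_right L_diff L_sum L_smult)
    also have "(\<Sum>i<k. c i * L (P i * P j)) = (\<Sum>i<k. if i = j then c j * L (P j * P j) else 0)"
      using j PP by (intro sum.cong) auto
    also have "\<dots> = L (m * P j)"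
      using j L_sq_pos[of "P j"] P[OF j] by (simp add: c_def)
    finally show ?thesis by simp
  qed
  then have "\<forall>q. degree q < k \<longrightarrow> L (p * q) = 0" using orth_span[of k P p] P by blast
  moreover have "p \<noteq> 0" using ck by auto
  ultimately show ?case using deg by blast
qed

private lemma is_gegenbauer_iff:
  "is_gegenbauer n k p \<longleftrightarrow>
     degree p = k \<and> poly p 1 = 1 \<and> (\<forall>q. degree q < k \<longrightarrow> L (p * q) = 0)"
  by (simp add: is_gegenbauer_def L_def)

lemma is_gegenbauer_ex1: "\<exists>!p. is_gegenbauer n k p"
proof -
  obtain p where p: "degree p = k" "p \<noteq> 0" "\<And>q. degree q < k \<Longrightarrow> L (p * q) = 0"
    using orth_exists by blast
  have "poly p 1 \<noteq> 0" using orth_root_1[of p k] p by auto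
  then have "is_gegenbauer n k (smult (inverse (poly p 1)) p)"
    using p by (simp add: is_gegenbauer_iff L_smult)
  moreover have "p = p'" if "is_gegenbauer n k p" "is_gegenbauer n k p'" for p p'
  proof -
    have "degree (p - p') \<le> k"
      using that by (intro degree_diff_le) (auto simp: is_gegenbauer_iff)
    then have "p - p' = 0"
      using that by (intro orth_root_1[of _ k]) (auto simp: is_gegenbauer_iff left_diff_distrib L_diff)
    then show ?thesis by simp
  qed
  ultimately show ?thesis by blast
qed

lemma is_gegenbauer_gegenbauer: "is_gegenbauer n k (gegenbauer n k)"
  unfolding gegenbauer_def by (rule theI') (rule is_gegenbauer_ex1)

end


section \<open>The orthogonality graph\<close>

definition antipodal_pair :: "real ^ 'n \<Rightarrow> (real ^ 'n) set" where
  "antipodal_pair y = {y, - y}"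

text \<open>
  The graph \<open>G\<^sub>X\<close> of \<open>X = {x\<^sub>1, -x\<^sub>1, \<dots>, x\<^sub>N, -x\<^sub>N}\<close>, where the points
  are given by \<open>x\<close> on \<open>{1..N}\<close>.
\<close>

definition orth_graph_verts :: "nat \<Rightarrow> (nat \<Rightarrow> real ^ 'n) \<Rightarrow> (real ^ 'n) set set" where
  "orth_graph_verts N x = (\<lambda>i. antipodal_pair (x i)) ` {1..N}"

definition orth_graph_edges :: "nat \<Rightarrow> (nat \<Rightarrow> real ^ 'n) \<Rightarrow> (real ^ 'n) set set set" where
  "orth_graph_edges N x =
     {{antipodal_pair (x i), antipodal_pair (x j)} | i j. i \<in> {1..N} \<and> j \<in> {1..N} \<and> x i \<bullet> x j = 0}"

definition orth_graph_independent :: "nat \<Rightarrow> (nat \<Rightarrow> real ^ 'n) \<Rightarrow> (real ^ 'n) set set \<Rightarrow> bool" where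
  "orth_graph_independent N x I \<longleftrightarrow>
     I \<subseteq> orth_graph_verts N x \<and> (\<forall>u\<in>I. \<forall>v\<in>I. {u, v} \<notin> orth_graph_edges N x)"

text \<open>
  For a vertex \<open>v\<^sub>i = {x\<^sub>i, -x\<^sub>i}\<close> and a linear map \<open>T\<close>, the image \<open>T ` v\<^sub>i\<close> equals
  \<open>v\<^sub>j\<close> iff \<open>T x\<^sub>i = x\<^sub>j\<close> or \<open>T x\<^sub>i = -x\<^sub>j\<close>.
\<close>

definition geom_congruent :: "(real ^ 'n) set set \<Rightarrow> (real ^ 'n) set set \<Rightarrow> bool" where
  "geom_congruent Y Z \<longleftrightarrow> (\<exists>T. orthogonal_transformation T \<and> (\<lambda>v. T ` v) ` Y = Z)"

lemma image_antipodal_pair_eq_iff: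
  fixes y z :: "real ^ 'n"
  assumes "orthogonal_transformation T"
  shows "T ` antipodal_pair y = antipodal_pair z \<longleftrightarrow> T y = z \<or> T y = - z"
  using linear_neg[of T y] assms
  by (auto simp: antipodal_pair_def orthogonal_transformation_def doubleton_eq_iff)

definition congruent_pairs ::
    "nat \<Rightarrow> (nat \<Rightarrow> real ^ 'n) \<Rightarrow> ((real ^ 'n) set set \<times> (real ^ 'n) set set) set" where
  "congruent_pairs N x =
     {(Y, Z). Y \<subseteq> orth_graph_verts N x \<and> Z \<subseteq> orth_graph_verts N x \<and> geom_congruent Y Z}"

lemma finite_congruent_pairs: "finite (congruent_pairs N x)"
proof (rule finite_subset)
  show "congruent_pairs N x \<subseteq> Pow (orth_graph_verts N x) \<times> Pow (orth_graph_verts N x)"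
    by (auto simp: congruent_pairs_def)
qed (simp add: orth_graph_verts_def)

end

theory Submission
  imports Defs "HOL-Probability.Probability_Measure"
begin

text \<open>
  Rotate the configuration by a random orthogonal matrix \<open>T\<close> with invariant distribution. If \<open>A\<close>
  avoids orthogonality and (without loss of generality) \<open>A = -A\<close>, the vertices \<open>v\<^sub>i\<close> with
  \<open>T x\<^sub>i \<in> A\<close> form an independent set. Taking expectations of the second hypothesis at this set, the
  \<open>s\<close>-terms cancel by right invariance, and \<open>q\<^sub>1 \<ge> \<Sum> w\<^sub>i\<^sub>j F(x\<^sub>i, x\<^sub>j)\<close> remains, where
  \<open>F(x, y)\<close> is the probability that \<open>T x\<close> and \<open>T y\<close> both lie in \<open>A\<close>. If the indicator of \<open>A\<close> is
  replaced by an even polynomial, \<open>F\<close> becomes a polynomial in the inner product \<open>x \<bullet> y\<close>, and it is a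
  nonnegative combination of Gegenbauer polynomials of even degree; so the first hypothesis bounds
  \<open>F(e, e)\<close> by \<open>w\<^sub>0 F(e, f) + \<Sum> w\<^sub>i\<^sub>j F(x\<^sub>i, x\<^sub>j)\<close> for orthogonal unit vectors \<open>e\<close> and
  \<open>f\<close>. Polynomials are dense in \<open>L\<^sup>1\<close>, hence the same holds for \<open>A\<close>, where \<open>F(e, f) = 0\<close> and
  \<open>F(e, e)\<close> is the density of \<open>A\<close>.

  Positivity of the coefficients rests on \<open>P\<^sub>k(x \<bullet> y)\<close> being a positive definite kernel: the
  convolution \<open>\<integral> P\<^sub>k(x \<bullet> u) P\<^sub>k(y \<bullet> u) d\<sigma>(u)\<close> is a polynomial in \<open>x \<bullet> y\<close> of degree at most \<open>k\<close>
  which is orthogonal to all polynomials of lower degree, hence a positive multiple of \<open>P\<^sub>k(x \<bullet> y)\<close>.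
\<close>

section \<open>Invariant measures\<close>

text \<open>Two devices stand in for spherical harmonics and their addition theorem. First, a
  rotation-invariant function of two unit vectors is a polynomial in their inner product as soon as,
  on every great circle, its mean over mirror points is a polynomial of bounded degree in the
  height. This property survives rotation and integration, and for a zonal function the bound is its
  own degree; that is why convolving with a polynomial of lower degree yields a polynomial of lower
  degree again. Second, the sphere and the Gegenbauer weight are matched through their moments,
  which obey the same recursion. Of the Gegenbauer polynomials only existence and uniqueness are
  used: nonvanishing and proportionality are proved by exhibiting a second polynomial with the
  defining property. Polynomials are preferred to continuous functions because their correlations
  are finite Gegenbauer sums, without any question of convergence. The price is an approximation of
  the indicator of \<open>A\<close> that is small only in mean; a bound on the sphere independent of
  the precision keeps products under control.\<close>

text \<open>The uniqueness argument for Haar measure: the image measure is again translation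
  invariant, hence proportional to \<open>lborel\<close>, and the unit ball, being its own preimage,
  shows that the factor is 1.\<close>

lemma distr_lborel_orthogonal_transformation:
  fixes f :: "'a::euclidean_space \<Rightarrow> 'a"
  assumes f: "orthogonal_transformation f"
  shows "distr lborel borel f = lborel"
proof -
  have lin: "linear f" using f by (rule orthogonal_transformation_linear)
  then have [measurable]: "f \<in> borel_measurable borel"
    by (intro borel_measurable_continuous_onI linear_continuous_on) (simp add: linear_conv_bounded_linear)
  have surj: "surj f"
    using f by (rule orthogonal_transformation_surj)
  define \<nu> where "\<nu> = distr lborel borel f"
  have sets_nu[measurable_cong]: "sets \<nu> = sets borel" by (simp add: \<nu>_def)
  have \<nu>: "emeasure \<nu> A = emeasure lborel (f -` A)" if "A \<in> sets borel" for A
    using that by (simp add: \<nu>_def emeasure_distr)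
  have ball: "f -` ball 0 r = ball 0 r" for r
    using f by (auto simp: orthogonal_transformation_norm)
  have tr: "distr \<nu> borel (\<lambda>x. x + f a) = \<nu>" for a
  proof -
    have "distr \<nu> borel (\<lambda>x. x + f a) = distr (distr lborel borel (\<lambda>x. a + x)) borel f"
      by (simp add: \<nu>_def distr_distr comp_def linear_add[OF lin] add.commute)
    also have "distr lborel borel (\<lambda>x. a + x) = lborel" by (rule lborel_distr_plus)
    finally show ?thesis by (simp add: \<nu>_def)
  qed
  then have tr: "distr \<nu> borel (\<lambda>x. x + b) = \<nu>" for b
    using surj by (metis surjD)
  interpret \<nu>: sigma_finite_measure \<nu>
  proof
    show "\<exists>A. countable A \<and> A \<subseteq> sets \<nu> \<and> \<Union>A = space \<nu> \<and> (\<forall>a\<in>A. emeasure \<nu> a \<noteq> \<infinity>)"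
    proof (intro exI[of _ "range (\<lambda>n::nat. ball 0 (real n))"] conjI)
      show "\<Union> (range (\<lambda>n::nat. ball 0 (real n))) = space \<nu>"
        using reals_Archimedean2 by (auto simp: \<nu>_def)
      show "\<forall>a\<in>range (\<lambda>n::nat. ball (0::'a) (real n)). emeasure \<nu> a \<noteq> \<infinity>"
        using emeasure_lborel_ball_finite[where 'a='a] by (auto simp: \<nu> ball less_top[symmetric] less_imp_neq)
    qed (auto simp: \<nu>_def)
  qed
  interpret pair_sigma_finite \<nu> lborel ..
  \<comment> \<open>Both sides are double integrals over \<open>\<nu>\<close> and
    \<open>lborel\<close>. The substitutions of x + y for y, x - y for x and x - y for y, with
    Fubini in between, carry one into the other; the middle one uses the invariance of
    \<open>\<nu>\<close>, the others that of \<open>lborel\<close>.\<close>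
  have comm: "emeasure \<nu> A * emeasure lborel B = emeasure \<nu> B * emeasure lborel A"
    if [measurable]: "A \<in> sets borel" "B \<in> sets borel" for A B
  proof -
    have "emeasure \<nu> A * emeasure lborel B
        = (\<integral>\<^sup>+x. \<integral>\<^sup>+y. indicator A x * indicator B y \<partial>lborel \<partial>\<nu>)"
      by (simp add: nn_integral_cmult nn_integral_multc)
    also have "\<dots> = (\<integral>\<^sup>+x. \<integral>\<^sup>+y. indicator A x * indicator B (x + y) \<partial>lborel \<partial>\<nu>)"
    proof (rule nn_integral_cong)
      fix x
      have "(\<integral>\<^sup>+y. indicator A x * indicator B y \<partial>distr lborel borel ((+) x))
          = (\<integral>\<^sup>+y. indicator A x * indicator B (x + y) \<partial>lborel)"
        by (subst nn_integral_distr) auto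
      then show "(\<integral>\<^sup>+y. indicator A x * indicator B y \<partial>lborel)
          = (\<integral>\<^sup>+y. indicator A x * indicator B (x + y) \<partial>lborel)"
        by (simp add: lborel_distr_plus)
    qed
    also have "\<dots> = (\<integral>\<^sup>+y. \<integral>\<^sup>+x. indicator A x * indicator B (x + y) \<partial>\<nu> \<partial>lborel)"
      by (rule Fubini'[symmetric]) measurable
    also have "\<dots> = (\<integral>\<^sup>+y. \<integral>\<^sup>+x. indicator A (x - y) * indicator B x \<partial>\<nu> \<partial>lborel)"
    proof (rule nn_integral_cong)
      fix y
      have "(\<integral>\<^sup>+x. indicator A (x - y) * indicator B x \<partial>distr \<nu> borel (\<lambda>x. x + y))
          = (\<integral>\<^sup>+x. indicator A x * indicator B (x + y) \<partial>\<nu>)"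
        by (subst nn_integral_distr) auto
      then show "(\<integral>\<^sup>+x. indicator A x * indicator B (x + y) \<partial>\<nu>)
          = (\<integral>\<^sup>+x. indicator A (x - y) * indicator B x \<partial>\<nu>)"
        by (simp add: tr)
    qed
    also have "\<dots> = (\<integral>\<^sup>+x. \<integral>\<^sup>+y. indicator A (x - y) * indicator B x \<partial>lborel \<partial>\<nu>)"
      by (rule Fubini') measurable
    also have "\<dots> = (\<integral>\<^sup>+x. \<integral>\<^sup>+y. indicator A y * indicator B x \<partial>lborel \<partial>\<nu>)"
    proof (rule nn_integral_cong)
      fix x :: 'a
      have d: "distr lborel borel (\<lambda>y. x - y) = lborel"
        by (subst (2) lborel_affine[of "-1" x]) (simp_all add: density_1)
      have "(\<integral>\<^sup>+y. indicator A y * indicator B x \<partial>distr lborel borel (\<lambda>y. x - y))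
          = (\<integral>\<^sup>+y. indicator A (x - y) * indicator B x \<partial>lborel)"
        by (subst nn_integral_distr) auto
      then show "(\<integral>\<^sup>+y. indicator A (x - y) * indicator B x \<partial>lborel)
          = (\<integral>\<^sup>+y. indicator A y * indicator B x \<partial>lborel)"
        by (simp add: d)
    qed
    also have "\<dots> = emeasure \<nu> B * emeasure lborel A"
      by (simp add: nn_integral_cmult nn_integral_multc mult.commute)
    finally show ?thesis .
  qed
  have "\<nu> = lborel"
  proof (rule measure_eqI)
    fix A assume "A \<in> sets \<nu>"
    then have A: "A \<in> sets borel" by (simp add: \<nu>_def)
    have pos: "emeasure lborel (ball (0::'a) 1) \<noteq> 0" "emeasure lborel (ball (0::'a) 1) \<noteq> \<infinity>"
      using open_not_negligible[of "ball (0::'a) 1"] emeasure_lborel_ball_finite[of "0::'a" 1]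
      by (auto simp: negligible_iff_null_sets null_sets_def)
    have "emeasure \<nu> A * emeasure lborel (ball (0::'a) 1) = emeasure lborel A * emeasure lborel (ball (0::'a) 1)"
      using comm[OF A, of "ball 0 1"] by (simp add: \<nu> ball mult.commute)
    then have "emeasure lborel (ball (0::'a) 1) * emeasure \<nu> A = emeasure lborel (ball (0::'a) 1) * emeasure lborel A"
      by (simp add: mult.commute)
    then show "emeasure \<nu> A = emeasure lborel A"
      using pos unfolding ennreal_mult_cancel_left by auto
  qed (simp add: \<nu>_def)
  then show ?thesis by (simp add: \<nu>_def)
qed

lemma distr_uniform_measure_orthogonal_transformation:
  fixes f :: "'a::euclidean_space \<Rightarrow> 'a"
  assumes f: "orthogonal_transformation f" and B: "B \<in> sets borel" "f -` B = B"
  shows "distr (uniform_measure lborel B) borel f = uniform_measure lborel B"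
proof (rule measure_eqI)
  have [measurable]: "f \<in> borel_measurable borel"
    using f by (intro borel_measurable_continuous_onI linear_continuous_on)
      (simp add: linear_conv_bounded_linear[symmetric] orthogonal_transformation_linear)
  fix A assume "A \<in> sets (distr (uniform_measure lborel B) borel f)"
  then have A[measurable]: "A \<in> sets borel" by simp
  have "emeasure (distr (uniform_measure lborel B) borel f) A = emeasure (uniform_measure lborel B) (f -` A)"
    by (simp add: emeasure_distr)
  also have "\<dots> = emeasure lborel (B \<inter> f -` A) / emeasure lborel B"
    using B measurable_sets[of f borel borel A] by (intro emeasure_uniform_measure) auto
  also have "emeasure lborel (B \<inter> f -` A) = emeasure (distr lborel borel f) (B \<inter> A)"
    using B by (simp add: emeasure_distr)
  also have "\<dots> = emeasure lborel (B \<inter> A)"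
    by (simp add: distr_lborel_orthogonal_transformation[OF f])
  finally show "emeasure (distr (uniform_measure lborel B) borel f) A = emeasure (uniform_measure lborel B) A"
    using B by simp
qed simp

section \<open>The uniform probability measure on the sphere\<close>

text \<open>The normalised surface measure, kept as a Borel measure on the whole space so that
  orthogonal transformations act on it directly; lying on the sphere becomes an almost-everywhere
  statement. The origin is removed because \<open>sgn 0 = 0\<close> is not a unit vector.\<close>

definition uniform_sphere :: "'a::euclidean_space measure" where
  "uniform_sphere = distr (uniform_measure lborel (cball 0 1 - {0})) borel sgn"

lemma borel_measurable_sgn_vec [measurable]:
  "(sgn :: 'a::euclidean_space \<Rightarrow> 'a) \<in> borel_measurable borel"
  unfolding sgn_div_norm[abs_def] by measurable

lemma emeasure_punctured_cball:
  "emeasure lborel (cball 0 1 - {0::'a::euclidean_space}) \<noteq> 0"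
  "emeasure lborel (cball 0 1 - {0::'a::euclidean_space}) \<noteq> \<infinity>"
proof -
  have "emeasure lborel (cball 0 1 - {0::'a}) = emeasure lborel (cball 0 1 :: 'a set)"
    by (rule emeasure_Diff_null_set) auto
  moreover have "emeasure lborel (cball 0 1 :: 'a set) \<noteq> 0"
    using open_not_negligible[of "ball (0::'a) 1"] negligible_subset[of "cball (0::'a) 1" "ball 0 1"]
    by (auto simp: negligible_iff_null_sets null_sets_def emeasure_completion)
  ultimately show "emeasure lborel (cball 0 1 - {0::'a}) \<noteq> 0" 
     "emeasure lborel (cball 0 1 - {0::'a}) \<noteq> \<infinity>"
    using emeasure_lborel_cball_finite[of "0::'a" 1] by auto
qed

lemma prob_space_uniform_sphere: "prob_space (uniform_sphere :: 'a::euclidean_space measure)"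
  unfolding uniform_sphere_def
  by (intro prob_space.prob_space_distr prob_space_uniform_measure)
    (use emeasure_punctured_cball in auto)

lemma sets_uniform_sphere [simp, measurable_cong]: "sets uniform_sphere = sets borel"
  and space_uniform_sphere [simp]: "space uniform_sphere = UNIV"
  by (simp_all add: uniform_sphere_def)

lemma AE_uniform_sphere: "AE x in (uniform_sphere :: 'a::euclidean_space measure). norm x = 1"
proof -
  have "AE y in uniform_measure lborel (cball 0 1 - {0::'a}). y \<in> cball 0 1 - {0}"
    by (rule AE_uniform_measureI) auto
  then have "AE y in uniform_measure lborel (cball 0 1 - {0::'a}). norm (sgn y) = 1"
    by eventually_elim (auto simp: norm_sgn)
  then show ?thesis
    unfolding uniform_sphere_def by (subst AE_distr_iff) auto
qed

lemma distr_uniform_sphere: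
  fixes f :: "'a::euclidean_space \<Rightarrow> 'a"
  assumes f: "orthogonal_transformation f"
  shows "distr uniform_sphere borel f = uniform_sphere"
proof -
  let ?B = "cball 0 1 - {0::'a}"
  have [measurable]: "f \<in> borel_measurable borel"
    using f by (intro borel_measurable_continuous_onI linear_continuous_on)
      (simp add: linear_conv_bounded_linear[symmetric] orthogonal_transformation_linear)
  have fsgn: "f \<circ> sgn = sgn \<circ> f"
    using f by (auto simp: sgn_div_norm orthogonal_transformation_norm linear_cmul orthogonal_transformation_linear)
  have "distr uniform_sphere borel f = distr (uniform_measure lborel ?B) borel (f \<circ> sgn)"
    unfolding uniform_sphere_def by (intro distr_distr) auto
  also have "\<dots> = distr (distr (uniform_measure lborel ?B) borel f) borel sgn"
    unfolding fsgn by (intro distr_distr[symmetric]) auto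
  also have "distr (uniform_measure lborel ?B) borel f = uniform_measure lborel ?B"
  proof (rule distr_uniform_measure_orthogonal_transformation[OF f])
    have n: "norm (f y) = norm y" for y
      using f by (rule orthogonal_transformation_norm)
    have "f y = 0 \<longleftrightarrow> y = 0" for y
      using n[of y] by (metis norm_eq_zero)
    then show "f -` ?B = ?B"
      by (simp add: set_eq_iff n)
  qed auto
  finally show ?thesis by (simp add: uniform_sphere_def)
qed

text \<open>The dimension factor in \<open>sphere_measure\<close> cancels in the quotient; what
  remains is the share of the unit ball taken by the cone over \<open>A\<close>.\<close>

lemma measure_sphere_measure_eq:
  fixes A :: "(real^'n) set"
  assumes A: "A \<in> sets borel" "A \<subseteq> sphere 0 1"
  shows "measure sphere_measure A / measure sphere_measure (sphere 0 1 :: (real^'n) set)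
    = measure uniform_sphere A"
proof -
  let ?B = "cball 0 1 - {0::real^'n}"
  have *: "emeasure sphere_measure C = of_nat CARD('n) * emeasure lborel (?B \<inter> sgn -` C)"
    if C: "C \<in> sets borel" "C \<subseteq> sphere 0 1" for C
  proof -
    have "{r *\<^sub>R a | r a. 0 < r \<and> r \<le> 1 \<and> a \<in> C} = ?B \<inter> sgn -` C"
    proof safe
      fix r :: real and a assume "0 < r" "r \<le> 1" "a \<in> C"
      moreover have "norm a = 1" using \<open>a \<in> C\<close> C by auto
      ultimately show "r *\<^sub>R a \<in> cball 0 1" "r *\<^sub>R a \<in> sgn -` C" "r *\<^sub>R a = 0 \<Longrightarrow> False"
        by (auto simp: sgn_div_norm)
    next
      fix y assume "y \<in> cball 0 1" "y \<noteq> 0" "sgn y \<in> C"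
      then show "\<exists>r a. y = r *\<^sub>R a \<and> 0 < r \<and> r \<le> 1 \<and> a \<in> C"
        by (intro exI[of _ "norm y"] exI[of _ "sgn y"]) (auto simp: sgn_div_norm)
    qed
    then show ?thesis using emeasure_sphere_measure[OF C] by simp
  qed
  have s: "?B \<inter> sgn -` sphere 0 1 = ?B" by (auto simp: norm_sgn)
  have m: "measure sphere_measure C = real CARD('n) * measure lborel (?B \<inter> sgn -` C)"
    if C: "C \<in> sets borel" "C \<subseteq> sphere 0 1" for C
    by (simp add: measure_def *[OF C] enn2real_mult)
  have [measurable]: "A \<in> sets borel" by fact
  have "measure uniform_sphere A = measure (uniform_measure lborel ?B) (sgn -` A)"
    unfolding uniform_sphere_def by (subst measure_distr) auto
  also have "\<dots> = measure lborel (?B \<inter> sgn -` A) / measure lborel ?B"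
    using emeasure_punctured_cball[where 'a="real^'n"] measurable_sets[OF borel_measurable_sgn_vec, of A]
    by (intro measure_uniform_measure) auto
  finally show ?thesis by (simp add: m[OF A] m s)
qed

section \<open>Gram-Schmidt and an invariant random orthogonal matrix\<close>

text \<open>\<open>sgn\<close> sends a vanishing remainder to 0, so equivariance and measurability
  hold for every input sequence; only orthonormality asks for independence.\<close>

fun gram_schmidt :: "(nat \<Rightarrow> 'a::euclidean_space) \<Rightarrow> nat \<Rightarrow> 'a" where
  "gram_schmidt f k = sgn (f k - (\<Sum>j<k. (f k \<bullet> gram_schmidt f j) *\<^sub>R gram_schmidt f j))"

declare gram_schmidt.simps [simp del]

text \<open>The construction consists of inner products, linear combinations and norms, and
  \<open>h\<close> is compatible with all three.\<close>

lemma gram_schmidt_orthogonal_transformation: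
  assumes h: "orthogonal_transformation h"
  shows "gram_schmidt (\<lambda>k. h (f k)) k = h (gram_schmidt f k)"
proof (induction k rule: less_induct)
  case (less k)
  have lin: "linear h" using h by (rule orthogonal_transformation_linear)
  have "(\<Sum>j<k. (h (f k) \<bullet> gram_schmidt (\<lambda>k. h (f k)) j) *\<^sub>R gram_schmidt (\<lambda>k. h (f k)) j)
      = (\<Sum>j<k. h ((f k \<bullet> gram_schmidt f j) *\<^sub>R gram_schmidt f j))"
    using h by (intro sum.cong) (auto simp: less orthogonal_transformation_def linear_cmul)
  also have "\<dots> = h (\<Sum>j<k. (f k \<bullet> gram_schmidt f j) *\<^sub>R gram_schmidt f j)"
    by (simp add: linear_sum[OF lin])
  finally show ?case
    using orthogonal_transformation_norm[OF h]
    by (subst (1 2) gram_schmidt.simps)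
      (simp add: sgn_div_norm linear_cmul[OF lin] linear_diff[OF lin, symmetric])
qed

text \<open>The span clause drives the induction: it keeps the subtracted projection inside the span
  of the earlier vectors, so the remainder cannot vanish.\<close>

lemma gram_schmidt_orthonormal:
  assumes indep: "\<And>k. k < n \<Longrightarrow> f k \<notin> span (f ` {..<k})"
  shows "k < n \<Longrightarrow> norm (gram_schmidt f k) = 1 \<and> gram_schmidt f k \<in> span (f ` {..k})
    \<and> (\<forall>j<k. gram_schmidt f j \<bullet> gram_schmidt f k = 0)"
proof (induction k rule: less_induct)
  case (less k)
  let ?g = "gram_schmidt f"
  define v where "v = (\<Sum>j<k. (f k \<bullet> ?g j) *\<^sub>R ?g j)"
  have IH: "norm (?g j) = 1" "?g j \<in> span (f ` {..j})" "i < j \<Longrightarrow> ?g i \<bullet> ?g j = 0" if "j < k" for i j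
    using less.IH[OF that] that less.prems by auto
  have gk: "?g k = sgn (f k - v)" by (subst gram_schmidt.simps) (simp add: v_def)
  have v: "v \<in> span (f ` {..<k})"
    unfolding v_def
  proof (intro span_sum span_scale)
    fix j assume "j \<in> {..<k}"
    then have "j < k" "f ` {..j} \<subseteq> f ` {..<k}" by auto
    then show "?g j \<in> span (f ` {..<k})"
      using IH(2)[of j] span_mono by blast
  qed
  then have ne: "f k - v \<noteq> 0" using indep[OF less.prems] by auto
  have "f ` {..<k} \<subseteq> f ` {..k}" by auto
  then have "v \<in> span (f ` {..k})"
    using v span_mono by blast
  then have "f k - v \<in> span (f ` {..k})" by (intro span_diff) (auto intro: span_base)
  then have "?g k \<in> span (f ` {..k})" unfolding gk sgn_div_norm by (rule span_scale)
  moreover have "?g j \<bullet> ?g k = 0" if "j < k" for j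
  proof -
    have "(\<Sum>i<k. (f k \<bullet> ?g i) * (?g j \<bullet> ?g i)) = (\<Sum>i<k. if i = j then f k \<bullet> ?g j else 0)"
    proof (intro sum.cong refl)
      fix i assume "i \<in> {..<k}"
      then show "(f k \<bullet> ?g i) * (?g j \<bullet> ?g i) = (if i = j then f k \<bullet> ?g j else 0)"
        using IH(1)[OF that] IH(3)[of i j] IH(3)[of j i] that
        by (cases i j rule: linorder_cases) (auto simp: inner_commute norm_eq_1)
    qed
    then have "?g j \<bullet> (f k - v) = 0"
      using that by (simp add: v_def inner_diff_right inner_sum_right inner_commute)
    then show ?thesis by (simp add: gk sgn_div_norm)
  qed
  ultimately show ?case using ne by (simp add: gk norm_sgn)
qed

lemma borel_measurable_gram_schmidt:
  assumes "\<And>k. (\<lambda>x. f x k) \<in> borel_measurable M"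
  shows "(\<lambda>x. gram_schmidt (f x) k) \<in> borel_measurable M"
proof (induction k rule: less_induct)
  case (less k)
  note assms [measurable]
  have [measurable]: "\<And>j. j \<in> {..<k} \<Longrightarrow> (\<lambda>x. gram_schmidt (f x) j) \<in> borel_measurable M"
    using less by auto
  have "(\<lambda>x. f x k - (\<Sum>j<k. (f x k \<bullet> gram_schmidt (f x) j) *\<^sub>R gram_schmidt (f x) j)) \<in> borel_measurable M"
    by measurable
  then show ?case
    by (subst gram_schmidt.simps) (rule measurable_compose[OF _ borel_measurable_sgn_vec])
qed

text \<open>Adding to row \<open>i\<close> an element of the span of the other rows keeps the
  determinant; if \<open>row i A\<close> were in that span, subtracting it from itself would produce
  a zero row.\<close>

lemma row_notin_span_if_det_nonzero:
  fixes A :: "real^'n^'n"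
  assumes "det A \<noteq> 0" "i \<notin> J"
  shows "row i A \<notin> span ((\<lambda>j. row j A) ` J)"
proof
  assume "row i A \<in> span ((\<lambda>j. row j A) ` J)"
  then have "- row i A \<in> span {row j A |j. j \<noteq> i}"
    using assms(2) span_mono[of "(\<lambda>j. row j A) ` J" "{row j A |j. j \<noteq> i}"] by (auto intro!: span_neg)
  then have "det (\<chi> k. if k = i then row i A + - row i A else row k A) = det A"
    by (intro det_row_span) (simp add: span_vec_eq)
  moreover have "det (\<chi> k. if k = i then row i A + - row i A else row k A) = 0"
    by (rule det_zero_row(2)[of i]) (simp add: row_def vec_eq_iff)
  ultimately show False using assms(1) by simp
qed

lemma row_eq_nth: "row i A = A $ i"
  by (simp add: row_def vec_eq_iff)

text \<open>The inner product of matrices is the sum of the inner products of their rows, and right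
  multiplication by \<open>S\<close> acts on each row by \<open>transpose S\<close>. This makes
  Lebesgue measure on the space of matrices right invariant.\<close>

lemma orthogonal_transformation_matrix_mult_right:
  fixes S :: "real^'n^'n"
  assumes S: "orthogonal_matrix S"
  shows "orthogonal_transformation (\<lambda>G::real^'n^'n. G ** S)"
proof -
  have row: "(G ** S) $ i = transpose S *v (G $ i)" for G :: "real^'n^'n" and i
    by (simp add: matrix_matrix_mult_def matrix_vector_mult_def transpose_def vec_eq_iff mult.commute)
  have "orthogonal_transformation ((*v) (transpose S))"
    using S by (simp add: orthogonal_transformation_matrix orthogonal_matrix_transpose)
  then have "(transpose S *v g) \<bullet> (transpose S *v h) = g \<bullet> h" for g h
    by (simp add: orthogonal_transformation_def)
  then have "(G ** S) \<bullet> (H ** S) = G \<bullet> H" for G H :: "real^'n^'n"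
    by (simp only: inner_vec_def[of "_ ** S"] inner_vec_def[of G] row)
  moreover have "linear (\<lambda>G::real^'n^'n. G ** S)"
    by (rule linearI) (simp_all add: vec_eq_iff matrix_matrix_mult_def algebra_simps sum.distrib sum_distrib_left)
  ultimately show ?thesis by (simp add: orthogonal_transformation_def)
qed

lemma continuous_on_det: "continuous_on UNIV (det :: real^'n^'n \<Rightarrow> real)"
  unfolding det_def by (intro continuous_intros)

lemma borel_measurable_vec_lambda:
  fixes f :: "'i::finite \<Rightarrow> 'a \<Rightarrow> 'b::euclidean_space"
  assumes "\<And>i. f i \<in> borel_measurable M"
  shows "(\<lambda>x. \<chi> i. f i x) \<in> borel_measurable M"
proof (subst borel_measurable_euclidean_space, rule ballI)
  fix b :: "'b^'i" assume "b \<in> Basis"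
  then obtain i u where "b = axis i u" by (auto simp: Basis_vec_def)
  then show "(\<lambda>x. (\<chi> i. f i x) \<bullet> b) \<in> borel_measurable M"
    using assms by (simp add: inner_axis)
qed

text \<open>Gram--Schmidt on the rows is equivariant under right multiplication by orthogonal matrices,
  so it turns a right-invariant random invertible matrix into a right-invariant orthogonal one.\<close>

lemma ex_invariant_measure_orthogonal_matrix:
  "\<exists>M :: (real^'n^'n) measure. prob_space M \<and> sets M = sets borel \<and> (AE T in M. orthogonal_matrix T)
    \<and> (\<forall>S. orthogonal_matrix S \<longrightarrow> distr M borel (\<lambda>T. T ** S) = M)"
proof -
  \<comment> \<open>Gram-Schmidt needs the rows in some order: \<open>e'\<close> numbers them, and
    \<open>e\<close> recovers the row from its number.\<close>
  obtain e' :: "'n \<Rightarrow> nat" where "bij_betw e' UNIV {0..<CARD('n)}"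
    using ex_bij_betw_finite_nat[of "UNIV::'n set"] by auto
  define e where "e = inv_into UNIV e'"
  have inj: "inj e'" and ran: "\<And>i. e' i < CARD('n)" and surj: "\<And>k. k < CARD('n) \<Longrightarrow> e' (e k) = k"
    using \<open>bij_betw e' UNIV {0..<CARD('n)}\<close> by (auto simp: bij_betw_def e_def intro!: f_inv_into_f)
  define \<Phi> :: "real^'n^'n \<Rightarrow> real^'n^'n" where "\<Phi> G = (\<chi> i. gram_schmidt (\<lambda>k. G $ e k) (e' i))" for G
  \<comment> \<open>Nonempty and open, so of positive measure; bounded, so of finite measure; and
    right invariant, since multiplication by an orthogonal matrix preserves the norm and the
    nonvanishing of \<open>det\<close>.\<close>
  define V where "V = ball 0 1 \<inter> {G::real^'n^'n. det G \<noteq> 0}"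
  define U where "U = uniform_measure lborel V"
  have [measurable]: "\<Phi> \<in> borel_measurable borel"
    unfolding \<Phi>_def
    by (rule borel_measurable_vec_lambda) 
      (intro borel_measurable_gram_schmidt borel_measurable_continuous_onI continuous_intros)
  have "open {G::real^'n^'n. det G \<noteq> 0}"
    using continuous_on_det by (intro open_Collect_neq) (auto intro: continuous_intros)
  then have "open V" by (auto simp: V_def)
  then have [measurable]: "V \<in> sets borel" by simp
  have "V \<noteq> {}"
  proof -
    \<comment> \<open>Scales the identity matrix into the open unit ball.\<close>
    define c where "c = inverse (2 * (1 + norm (mat 1 :: real^'n^'n)))"
    have "c > 0" by (simp add: c_def add_pos_nonneg)
    then have "norm (c *\<^sub>R (mat 1 :: real^'n^'n)) < 1"
      by (simp add: c_def field_simps add_pos_nonneg)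
    moreover have "det (c *\<^sub>R (mat 1 :: real^'n^'n)) \<noteq> 0"
      using \<open>c > 0\<close> by (subst det_diagonal) (auto simp: mat_def)
    ultimately have "c *\<^sub>R mat 1 \<in> V" by (simp add: V_def)
    then show ?thesis by blast
  qed
  then have "emeasure lborel V \<noteq> 0"
    using open_not_negligible[OF \<open>open V\<close>] by (auto simp: negligible_iff_null_sets null_sets_def)
  moreover have "emeasure lborel V \<le> emeasure lborel (ball (0::real^'n^'n) 1)"
    by (intro emeasure_mono) (auto simp: V_def)
  then have "emeasure lborel V \<noteq> \<infinity>"
    using emeasure_lborel_ball_finite[of "0::real^'n^'n" 1] by (auto simp: top_unique)
  ultimately interpret U: prob_space U
    unfolding U_def by (rule prob_space_uniform_measure)
  have [measurable_cong]: "sets U = sets borel" by (simp add: U_def)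
  define M where "M = distr U borel \<Phi>"
  have "prob_space M" unfolding M_def by (rule U.prob_space_distr) simp
  moreover have "sets M = sets borel" by (simp add: M_def)
  moreover have "AE T in M. orthogonal_matrix T"
  proof -
    have "orthogonal_matrix (\<Phi> G)" if "G \<in> V" for G
    proof -
      have indep: "G $ e k \<notin> span ((\<lambda>k. G $ e k) ` {..<k})" if "k < CARD('n)" for k
      proof -
        have "e k \<notin> e ` {..<k}" using that surj by (auto simp: image_iff) (metis less_trans nat_neq_iff)
        then show ?thesis
          using row_notin_span_if_det_nonzero[of G "e k" "e ` {..<k}"] \<open>G \<in> V\<close>
          by (simp add: V_def row_eq_nth image_image)
      qed
      have gs: "norm (gram_schmidt (\<lambda>k. G $ e k) k) = 1"
        "\<forall>j<k. gram_schmidt (\<lambda>k. G $ e k) j \<bullet> gram_schmidt (\<lambda>k. G $ e k) k = 0"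
        if "k < CARD('n)" for k
        using gram_schmidt_orthonormal[of "CARD('n)" "\<lambda>k. G $ e k" k] indep that by blast+
      have "orthogonal (\<Phi> G $ i) (\<Phi> G $ j)" if "i \<noteq> j" for i j
      proof -
        have "e' i \<noteq> e' j" using that inj by (auto dest: injD)
        then show ?thesis
          using gs(2)[OF ran[of i]] gs(2)[OF ran[of j]]
          by (cases "e' i" "e' j" rule: linorder_cases) (auto simp: \<Phi>_def orthogonal_def inner_commute)
      qed
      moreover have "norm (\<Phi> G $ i) = 1" for i using gs(1)[OF ran[of i]] by (simp add: \<Phi>_def)
      ultimately show ?thesis by (simp add: orthogonal_matrix_orthonormal_rows row_eq_nth)
    qed
    then have "AE G in U. orthogonal_matrix (\<Phi> G)"
      unfolding U_def by (intro AE_uniform_measureI) auto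
    moreover have "{T::real^'n^'n. orthogonal_matrix T} \<in> sets borel"
      unfolding orthogonal_matrix_def matrix_matrix_mult_def transpose_def
      by (intro borel_closed closed_Collect_conj closed_Collect_eq continuous_intros)
    ultimately show ?thesis
      unfolding M_def by (subst AE_distr_iff) auto
  qed
  moreover have "distr M borel (\<lambda>T. T ** S) = M" if S: "orthogonal_matrix S" for S
  proof -
    let ?r = "\<lambda>G::real^'n^'n. G ** S"
    have ot: "orthogonal_transformation ?r" by (rule orthogonal_transformation_matrix_mult_right[OF S])
    then have [measurable]: "?r \<in> borel_measurable borel"
      by (intro borel_measurable_continuous_onI linear_continuous_on)
        (simp add: linear_conv_bounded_linear[symmetric] orthogonal_transformation_linear)
    have row: "(G ** S) $ i = transpose S *v (G $ i)" for G :: "real^'n^'n" and i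
      by (simp add: matrix_matrix_mult_def matrix_vector_mult_def transpose_def vec_eq_iff mult.commute)
    have ot': "orthogonal_transformation ((*v) (transpose S))"
      using S by (simp add: orthogonal_transformation_matrix orthogonal_matrix_transpose)
    have equi: "\<Phi> (G ** S) = \<Phi> G ** S" for G
    proof -
      have "\<Phi> (G ** S) $ i = (\<Phi> G ** S) $ i" for i
      proof -
        have "\<Phi> (G ** S) $ i = gram_schmidt (\<lambda>k. transpose S *v (G $ e k)) (e' i)"
          by (simp add: \<Phi>_def row)
        also have "\<dots> = transpose S *v (\<Phi> G $ i)"
          by (simp only: gram_schmidt_orthogonal_transformation[OF ot'] \<Phi>_def vec_lambda_beta)
        finally show ?thesis by (simp add: row)
      qed
      then show ?thesis by (simp add: vec_eq_iff)
    qed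
    have "distr M borel ?r = distr U borel (?r \<circ> \<Phi>)"
      unfolding M_def by (intro distr_distr) auto
    also have "?r \<circ> \<Phi> = \<Phi> \<circ> ?r" by (auto simp: equi)
    also have "distr U borel (\<Phi> \<circ> ?r) = distr (distr U borel ?r) borel \<Phi>"
      by (intro distr_distr[symmetric]) auto
    also have "distr U borel ?r = U"
      unfolding U_def
    proof (rule distr_uniform_measure_orthogonal_transformation[OF ot])
      have "det S \<noteq> 0" using det_orthogonal_matrix[OF S] by auto
      then show "?r -` V = V"
        using orthogonal_transformation_norm[OF ot] by (auto simp: V_def det_mul)
    qed auto
    finally show ?thesis by (simp add: M_def)
  qed
  ultimately show ?thesis by blast
qed

section \<open>Images of unit vectors under a random orthogonal matrix\<close>

lemma borel_measurable_matrix_vector_mult [measurable (raw)]: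
  fixes f :: "'a \<Rightarrow> real^'n^'m"
  assumes "f \<in> borel_measurable M" "g \<in> borel_measurable M"
  shows "(\<lambda>x. f x *v g x) \<in> borel_measurable M"
  using assms
  by (rule borel_measurable_continuous_Pair) (unfold matrix_vector_mult_def, intro continuous_intros)

lemma orthogonal_transformation_obtain_matrix:
  fixes f :: "real^'n \<Rightarrow> real^'n"
  assumes "orthogonal_transformation f"
  obtains S :: "real^'n^'n" where "orthogonal_matrix S" "f = (\<lambda>x. S *v x)"
proof
  show "orthogonal_matrix (matrix f)" "f = (\<lambda>x. matrix f *v x)"
    using assms by (auto simp: orthogonal_transformation_matrix)
qed

text \<open>\<open>M\<close> plays the role of Haar measure on the orthogonal group. It lives on all
  matrices, hence orthogonality holds only almost everywhere; right invariance is what moves a whole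
  configuration by \<open>S\<close> inside an expectation.\<close>

locale random_orthogonal_matrix = prob_space M for M :: "(real^'n^'n) measure" +
  assumes sets_eq_borel [measurable_cong, simp]: "sets M = sets borel"
    and AE_orthogonal: "AE T in M. orthogonal_matrix T"
    and distr_mult_right: "orthogonal_matrix S \<Longrightarrow> distr M borel (\<lambda>T. T ** S) = M"
begin

lemma space_eq_UNIV [simp]: "space M = UNIV"
  using sets_eq_imp_space_eq[OF sets_eq_borel] by simp

lemma borel_measurable_matrix_mult_right [measurable]: "(\<lambda>T. T ** S) \<in> M \<rightarrow>\<^sub>M borel"
proof -
  have "continuous_on UNIV (\<lambda>T::real^'n^'n. T ** S)"
    unfolding matrix_matrix_mult_def by (intro continuous_intros)
  then show ?thesis
    by (simp add: borel_measurable_continuous_onI measurable_cong_sets[OF sets_eq_borel refl])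
qed

lemma integral_mult_right:
  fixes h :: "real^'n^'n \<Rightarrow> real"
  assumes "orthogonal_matrix S" and [measurable]: "h \<in> borel_measurable borel"
  shows "(\<integral>T. h (T ** S) \<partial>M) = (\<integral>T. h T \<partial>M)"
proof -
  have "(\<integral>T. h T \<partial>M) = (\<integral>T. h T \<partial>distr M borel (\<lambda>T. T ** S))"
    by (simp add: distr_mult_right[OF assms(1)])
  also have "\<dots> = (\<integral>T. h (T ** S) \<partial>M)"
    by (rule integral_distr) measurable
  finally show ?thesis ..
qed

text \<open>By right invariance and transitivity on the sphere, the law of \<open>T *v y\<close> is
  the same for all unit vectors \<open>y\<close>. Average it over a uniform \<open>y\<close> and
  exchange the integrals: each orthogonal \<open>T\<close> preserves \<open>uniform_sphere\<close>,
  so the common law is uniform.\<close>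

lemma distr_mult_vector:
  fixes x :: "real^'n"
  assumes x: "norm x = 1"
  shows "distr M borel (\<lambda>T. T *v x) = uniform_sphere"
proof (rule measure_eqI)
  interpret \<sigma>: prob_space "uniform_sphere :: (real^'n) measure" by (rule prob_space_uniform_sphere)
  interpret pair_sigma_finite M "uniform_sphere :: (real^'n) measure" ..
  fix B :: "(real^'n) set" assume "B \<in> sets (distr M borel (\<lambda>T. T *v x))"
  then have [measurable]: "B \<in> sets borel" by simp
  define \<nu> where "\<nu> y = emeasure (distr M borel (\<lambda>T. T *v y)) B" for y
  have \<nu>: "\<nu> y = (\<integral>\<^sup>+T. indicator B (T *v y) \<partial>M)" for y
  proof -
    have "\<nu> y = (\<integral>\<^sup>+z. indicator B z \<partial>distr M borel (\<lambda>T. T *v y))" by (simp add: \<nu>_def)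
    also have "\<dots> = (\<integral>\<^sup>+T. indicator B (T *v y) \<partial>M)" by (rule nn_integral_distr) measurable
    finally show ?thesis .
  qed
  have const: "\<nu> y = \<nu> x" if y: "norm y = 1" for y
  proof -
    obtain f where f: "orthogonal_transformation f" "f x = y"
      using x y by (rule orthogonal_transformation_exists_1)
    obtain S where S: "orthogonal_matrix S" "f = (\<lambda>x. S *v x)"
      using f(1) by (rule orthogonal_transformation_obtain_matrix)
    have "\<nu> x = (\<integral>\<^sup>+T. indicator B (T *v x) \<partial>distr M borel (\<lambda>T. T ** S))"
      by (simp add: distr_mult_right[OF S(1)] \<nu>)
    also have "\<dots> = (\<integral>\<^sup>+T. indicator B ((T ** S) *v x) \<partial>M)"
      by (rule nn_integral_distr) measurable
    also have "\<dots> = \<nu> y" using f S by (simp add: \<nu> matrix_vector_mul_assoc[symmetric])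
    finally show ?thesis ..
  qed
  have "\<nu> x = (\<integral>\<^sup>+y. \<nu> x \<partial>(uniform_sphere :: (real^'n) measure))"
    by (simp add: \<sigma>.emeasure_space_1[simplified])
  also have "\<dots> = (\<integral>\<^sup>+y. \<nu> y \<partial>uniform_sphere)"
    by (rule nn_integral_cong_AE) (use AE_uniform_sphere in eventually_elim, simp add: const)
  also have "\<dots> = (\<integral>\<^sup>+T. \<integral>\<^sup>+y. indicator B (T *v y) \<partial>uniform_sphere \<partial>M)"
    unfolding \<nu> by (rule Fubini') measurable
  also have "\<dots> = (\<integral>\<^sup>+T. emeasure uniform_sphere B \<partial>M)"
  proof (rule nn_integral_cong_AE, use AE_orthogonal in eventually_elim)
    fix T :: "real^'n^'n" assume "orthogonal_matrix T"
    then have d: "distr uniform_sphere borel ((*v) T) = uniform_sphere"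
      by (intro distr_uniform_sphere) (simp add: orthogonal_transformation_matrix)
    have "emeasure uniform_sphere B = (\<integral>\<^sup>+y. indicator B y \<partial>distr uniform_sphere borel ((*v) T))"
      by (simp add: d)
    also have "\<dots> = (\<integral>\<^sup>+y. indicator B (T *v y) \<partial>uniform_sphere)"
      by (rule nn_integral_distr) measurable
    finally show "(\<integral>\<^sup>+y. indicator B (T *v y) \<partial>uniform_sphere) = emeasure uniform_sphere B" ..
  qed
  also have "\<dots> = emeasure uniform_sphere B" by (simp add: emeasure_space_1[simplified])
  finally show "emeasure (distr M borel (\<lambda>T. T *v x)) B = emeasure uniform_sphere B"
    by (simp add: \<nu>_def)
qed simp

end

section \<open>Moments of the sphere and of the Gegenbauer weight\<close>

text \<open>The reflection in the hyperplane orthogonal to \<open>w\<close>. For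
  \<open>w = 0\<close> it is the identity, so the reflection along \<open>u - v\<close> still
  carries \<open>u\<close> to \<open>v\<close> when \<open>u = v\<close>.\<close>

definition reflection_along :: "'a::real_inner \<Rightarrow> 'a \<Rightarrow> 'a" where
  "reflection_along w x = x - (2 * (x \<bullet> w) / (w \<bullet> w)) *\<^sub>R w"

lemma orthogonal_transformation_reflection_along:
  "orthogonal_transformation (reflection_along (w::'a::euclidean_space))"
proof -
  have "linear (reflection_along w)"
    by (rule linearI) (simp_all add: reflection_along_def inner_add_left algebra_simps add_divide_distrib)
  moreover have "reflection_along w x \<bullet> reflection_along w y = x \<bullet> y" for x y
  proof (cases "w = 0")
    case False
    then have "w \<bullet> w \<noteq> 0" by simp
    then show ?thesis
      by (simp add: reflection_along_def inner_diff_left inner_diff_right inner_commute field_simps)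
  qed (simp add: reflection_along_def)
  ultimately show ?thesis by (simp add: orthogonal_transformation_def)
qed

lemma reflection_along_orthogonal: "x \<bullet> w = 0 \<Longrightarrow> reflection_along w x = x"
  by (simp add: reflection_along_def)

lemma reflection_along_diff:
  assumes "norm u = norm v"
  shows "reflection_along (u - v) u = v"
proof (cases "u = v")
  case False
  have "u \<bullet> u = v \<bullet> v" using assms by (simp add: dot_square_norm)
  then have "(u - v) \<bullet> (u - v) = 2 * (u \<bullet> (u - v))"
    by (simp add: inner_diff_left inner_diff_right inner_commute)
  moreover have "(u - v) \<bullet> (u - v) \<noteq> 0" using False by simp
  ultimately have "2 * (u \<bullet> (u - v)) / ((u - v) \<bullet> (u - v)) = 1"
    by (metis divide_self)
  then show ?thesis unfolding reflection_along_def by (simp only: scaleR_one) simp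
qed (simp add: reflection_along_def)

text \<open>Two reflections: the first takes \<open>e\<close> to \<open>e'\<close>; the second takes
  the image of \<open>f\<close> to \<open>f'\<close> and fixes \<open>e'\<close>, which is
  orthogonal to both.\<close>

lemma ex_orthogonal_transformation_pair:
  fixes e f e' f' :: "'a::euclidean_space"
  assumes "norm e = 1" "norm f = 1" "e \<bullet> f = 0" "norm e' = 1" "norm f' = 1" "e' \<bullet> f' = 0"
  shows "\<exists>S. orthogonal_transformation S \<and> S e = e' \<and> S f = f'"
proof -
  define S1 where "S1 = reflection_along (e - e')"
  have S1: "orthogonal_transformation S1" "S1 e = e'"
    using assms by (simp_all add: S1_def orthogonal_transformation_reflection_along reflection_along_diff)
  then have S1f: "e' \<bullet> S1 f = 0" "norm (S1 f) = 1"
    using assms by (metis orthogonal_transformation_def, metis orthogonal_transformation_norm)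
  define S2 where "S2 = reflection_along (S1 f - f')"
  have S2: "orthogonal_transformation S2" "S2 (S1 f) = f'"
    using assms S1f by (simp_all add: S2_def orthogonal_transformation_reflection_along reflection_along_diff)
  moreover have "S2 e' = e'"
    using assms S1f unfolding S2_def by (intro reflection_along_orthogonal) (simp add: inner_diff_right)
  ultimately show ?thesis
    using S1 by (intro exI[of _ "S2 \<circ> S1"]) (simp add: orthogonal_transformation_compose)
qed

lemma ex_orthogonal_unit_vector:
  fixes e :: "'a::euclidean_space"
  assumes e: "norm e = 1" and dim: "DIM('a) \<ge> 2"
  shows "\<exists>f. norm f = 1 \<and> e \<bullet> f = 0"
proof -
  obtain B where B: "e \<in> B" "pairwise orthogonal B" "\<And>x. x \<in> B \<Longrightarrow> norm x = 1"
    "card B = DIM('a)"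
    using vector_in_orthonormal_basis[OF e] by metis
  then have "B \<noteq> {e}" using dim by auto
  then obtain f where "f \<in> B" "f \<noteq> e" using B(1) by blast
  then show ?thesis using B by (intro exI[of _ f]) (auto simp: pairwise_def orthogonal_def)
qed

section \<open>Moments of the uniform measure\<close>

lemma borel_measurable_orthogonal_transformation:
  fixes f :: "'a::euclidean_space \<Rightarrow> 'a"
  shows "orthogonal_transformation f \<Longrightarrow> f \<in> borel_measurable borel"
  by (intro borel_measurable_continuous_onI linear_continuous_on)
    (simp add: linear_conv_bounded_linear[symmetric] orthogonal_transformation_linear)

lemma integral_uniform_sphere_orthogonal_transformation:
  fixes f :: "'a::euclidean_space \<Rightarrow> 'a" and h :: "'a \<Rightarrow> real"
  assumes "orthogonal_transformation f" "h \<in> borel_measurable borel"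
  shows "(\<integral>x. h (f x) \<partial>uniform_sphere) = (\<integral>x. h x \<partial>uniform_sphere)"
proof -
  have "(\<integral>x. h x \<partial>uniform_sphere) = (\<integral>x. h x \<partial>distr uniform_sphere borel f)"
    by (simp add: distr_uniform_sphere[OF assms(1)])
  also have "\<dots> = (\<integral>x. h (f x) \<partial>uniform_sphere)"
    using assms(2) borel_measurable_orthogonal_transformation[OF assms(1)] by (intro integral_distr) auto
  finally show ?thesis ..
qed

lemma integrable_uniform_sphere_continuous:
  fixes h :: "'a::euclidean_space \<Rightarrow> real"
  assumes "continuous_on UNIV h"
  shows "integrable uniform_sphere h"
proof -
  interpret prob_space "uniform_sphere :: 'a measure" by (rule prob_space_uniform_sphere)
  have "compact (h ` sphere 0 1)"
    using assms by (intro compact_continuous_image) (auto intro: continuous_on_subset)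
  then obtain B where B: "\<forall>x\<in>sphere 0 1. norm (h x) \<le> B"
    using compact_imp_bounded[of "h ` sphere 0 1"] by (auto simp: bounded_iff)
  have "AE x in uniform_sphere. norm (h x) \<le> B"
    using AE_uniform_sphere by eventually_elim (use B in auto)
  moreover have "h \<in> borel_measurable uniform_sphere"
    using borel_measurable_continuous_onI[OF assms] by simp
  ultimately show ?thesis by (intro integrable_const_bound)
qed

text \<open>The mean of (x \<bullet> e)^j (x \<bullet> f) does not change when the pair
  \<open>e\<close>, \<open>f\<close> is rotated in its plane by an angle \<theta>; its derivative at
  \<theta> = 0 is the difference of the two sides. At \<open>j = 0\<close> the factor
  \<open>j\<close> makes the truncated exponent \<open>j - 1\<close> harmless.\<close>

lemma sphere_moment_pair:
  fixes e f :: "'a::euclidean_space"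
  assumes ef: "norm e = 1" "norm f = 1" "e \<bullet> f = 0"
  shows "(\<integral>x. (x \<bullet> e) ^ Suc j \<partial>uniform_sphere) = j * (\<integral>x. (x \<bullet> e) ^ (j - 1) * (x \<bullet> f)\<^sup>2 \<partial>uniform_sphere)"
proof -
  let ?\<sigma> = "uniform_sphere :: 'a measure"
  interpret prob_space ?\<sigma> by (rule prob_space_uniform_sphere)
  have cont: "continuous_on UNIV h \<Longrightarrow> integrable ?\<sigma> h" for h :: "'a \<Rightarrow> real"
    by (rule integrable_uniform_sphere_continuous)
  define A where "A \<theta> x = cos \<theta> * (x \<bullet> e) - sin \<theta> * (x \<bullet> f)" for \<theta> x
  define B where "B \<theta> x = sin \<theta> * (x \<bullet> e) + cos \<theta> * (x \<bullet> f)" for \<theta> x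
  define \<phi> where "\<phi> x \<theta> = A \<theta> x ^ j * B \<theta> x" for x \<theta>
  define \<phi>' where "\<phi>' x \<theta> = A \<theta> x ^ Suc j - j * A \<theta> x ^ (j - 1) * (B \<theta> x)\<^sup>2" for x \<theta>
  have dA: "((\<lambda>\<theta>. A \<theta> x) has_real_derivative - B \<theta> x) (at \<theta>)" for x \<theta>
    unfolding A_def B_def by (auto intro!: derivative_eq_intros)
  have dB: "((\<lambda>\<theta>. B \<theta> x) has_real_derivative A \<theta> x) (at \<theta>)" for x \<theta>
    unfolding A_def B_def by (auto intro!: derivative_eq_intros)
  have der: "(\<phi> x has_real_derivative \<phi>' x \<theta>) (at \<theta>)" for x \<theta>
    unfolding \<phi>_def[abs_def] \<phi>'_def
    by (rule derivative_eq_intros dA dB refl)+ (simp add: power2_eq_square algebra_simps)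
  have const: "(\<integral>x. \<phi> x \<theta> \<partial>?\<sigma>) = (\<integral>x. \<phi> x 0 \<partial>?\<sigma>)" for \<theta>
  proof -
    define e' where "e' = cos \<theta> *\<^sub>R e - sin \<theta> *\<^sub>R f"
    define f' where "f' = sin \<theta> *\<^sub>R e + cos \<theta> *\<^sub>R f"
    have ip: "e \<bullet> e = 1" "f \<bullet> f = 1" "f \<bullet> e = 0" using ef by (simp_all add: norm_eq_1 inner_commute)
    have "e' \<bullet> e' = (cos \<theta>)\<^sup>2 + (sin \<theta>)\<^sup>2" "f' \<bullet> f' = (sin \<theta>)\<^sup>2 + (cos \<theta>)\<^sup>2"
      by (simp_all add: e'_def f'_def inner_diff_left inner_diff_right inner_add_left inner_add_right ip ef power2_eq_square)
    then have "norm e' = 1" "norm f' = 1" by (simp_all add: norm_eq_1)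
    moreover have "e' \<bullet> f' = 0"
      by (simp add: e'_def f'_def inner_diff_left inner_diff_right inner_add_left inner_add_right ip ef)
    ultimately obtain S where S: "orthogonal_transformation S" "S e = e'" "S f = f'"
      using ex_orthogonal_transformation_pair[OF ef] by blast
    have "(S x \<bullet> e') = x \<bullet> e" "(S x \<bullet> f') = x \<bullet> f" for x
      using S by (metis orthogonal_transformation_def)+
    then have "(\<integral>x. \<phi> x 0 \<partial>?\<sigma>) = (\<integral>x. (S x \<bullet> e') ^ j * (S x \<bullet> f') \<partial>?\<sigma>)"
      by (simp add: \<phi>_def A_def B_def)
    also have "\<dots> = (\<integral>x. (x \<bullet> e') ^ j * (x \<bullet> f') \<partial>?\<sigma>)"
      by (rule integral_uniform_sphere_orthogonal_transformation[OF S(1)]) measurable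
    also have "\<dots> = (\<integral>x. \<phi> x \<theta> \<partial>?\<sigma>)"
      by (simp add: \<phi>_def A_def B_def e'_def f'_def inner_diff_right inner_add_right)
    finally show ?thesis ..
  qed
  \<comment> \<open>Difference quotients at 0 with step 1/(k + 1). Their integrals vanish, and by
    the mean value theorem \<open>bnd\<close> supplies the constant for dominated
    convergence.\<close>
  define q where "q k x = (\<phi> x (inverse (real (Suc k))) - \<phi> x 0) / inverse (real (Suc k))" for k x
  have meas: "(\<lambda>x. \<phi> x \<theta>) \<in> borel_measurable borel" for \<theta>
    unfolding \<phi>_def A_def B_def by measurable
  have int\<phi>: "integrable ?\<sigma> (\<lambda>x. \<phi> x \<theta>)" for \<theta>
    unfolding \<phi>_def A_def B_def by (intro cont continuous_intros)
  \<comment> \<open>\<open>A\<close> and \<open>B\<close> are sums of two terms of absolute value at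
    most 1, whence the powers of 2.\<close>
  have bnd: "\<bar>\<phi>' x \<theta>\<bar> \<le> 2 ^ Suc j + real j * 2 ^ (j - 1) * 2\<^sup>2" if "norm x = 1" for x \<theta>
  proof -
    have le: "\<bar>x \<bullet> e\<bar> \<le> 1" "\<bar>x \<bullet> f\<bar> \<le> 1"
      using Cauchy_Schwarz_ineq2[of x e] Cauchy_Schwarz_ineq2[of x f] that ef by auto
    have m: "\<bar>u * v\<bar> \<le> 1" if "\<bar>u\<bar> \<le> 1" "\<bar>v\<bar> \<le> 1" for u v :: real
      using mult_mono[OF that] by (simp add: abs_mult)
    have "\<bar>A \<theta> x\<bar> \<le> 2" "\<bar>B \<theta> x\<bar> \<le> 2"
      using m[of "cos \<theta>" "x \<bullet> e"] m[of "sin \<theta>" "x \<bullet> f"] m[of "sin \<theta>" "x \<bullet> e"] m[of "cos \<theta>" "x \<bullet> f"] le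
      by (simp_all add: A_def B_def abs_le_iff)
    then have "\<bar>A \<theta> x ^ Suc j\<bar> \<le> 2 ^ Suc j" "\<bar>A \<theta> x ^ (j - 1)\<bar> \<le> 2 ^ (j - 1)" "(B \<theta> x)\<^sup>2 \<le> 2\<^sup>2"
      using abs_le_square_iff[of "B \<theta> x" 2] by (auto simp only: power_abs abs_numeral intro!: power_mono abs_ge_zero)
    then have "\<bar>j * A \<theta> x ^ (j - 1) * (B \<theta> x)\<^sup>2\<bar> \<le> real j * 2 ^ (j - 1) * 2\<^sup>2"
      unfolding abs_mult by (intro mult_mono) auto
    then show ?thesis
      unfolding \<phi>'_def using \<open>\<bar>A \<theta> x ^ Suc j\<bar> \<le> 2 ^ Suc j\<close> by linarith
  qed
  have "(\<lambda>k. \<integral>x. q k x \<partial>?\<sigma>) \<longlonglongrightarrow> (\<integral>x. \<phi>' x 0 \<partial>?\<sigma>)"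
  proof (rule integral_dominated_convergence)
    show "(\<lambda>x. \<phi>' x 0) \<in> borel_measurable ?\<sigma>" "\<And>k. q k \<in> borel_measurable ?\<sigma>"
      using meas unfolding q_def[abs_def] \<phi>'_def A_def B_def by measurable
    show "integrable ?\<sigma> (\<lambda>_. 2 ^ Suc j + real j * 2 ^ (j - 1) * 2\<^sup>2 :: real)" by simp
    show "AE x in ?\<sigma>. (\<lambda>k. q k x) \<longlonglongrightarrow> \<phi>' x 0"
    proof (rule AE_I2)
      fix x
      have "((\<lambda>\<theta>. (\<phi> x \<theta> - \<phi> x 0) / (\<theta> - 0)) \<longlongrightarrow> \<phi>' x 0) (at 0)"
        using der[of x 0] by (simp add: has_field_derivative_iff)
      moreover have "filterlim (\<lambda>k. inverse (real (Suc k))) (at 0) sequentially"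
        using LIMSEQ_inverse_real_of_nat by (intro filterlim_atI) auto
      ultimately have "(\<lambda>k. (\<phi> x (inverse (real (Suc k))) - \<phi> x 0) / (inverse (real (Suc k)) - 0)) \<longlonglongrightarrow> \<phi>' x 0"
        by (rule filterlim_compose)
      then show "(\<lambda>k. q k x) \<longlonglongrightarrow> \<phi>' x 0" by (simp add: q_def)
    qed
    show "AE x in ?\<sigma>. norm (q k x) \<le> 2 ^ Suc j + real j * 2 ^ (j - 1) * 2\<^sup>2" for k
      using AE_uniform_sphere
    proof eventually_elim
      fix x :: 'a assume x: "norm x = 1"
      have "norm (\<phi> x (inverse (real (Suc k))) - \<phi> x 0)
          \<le> (2 ^ Suc j + real j * 2 ^ (j - 1) * 2\<^sup>2) * norm (inverse (real (Suc k)) - 0)"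
        by (rule field_differentiable_bound[of UNIV]) (use der bnd[OF x] in auto)
      then show "norm (q k x) \<le> 2 ^ Suc j + real j * 2 ^ (j - 1) * 2\<^sup>2"
        unfolding q_def norm_divide by (subst pos_divide_le_eq) auto
    qed
  qed
  moreover have "(\<integral>x. q k x \<partial>?\<sigma>) = 0" for k
    unfolding q_def using const[of "inverse (real (Suc k))"] by (simp add: int\<phi>)
  ultimately have "(\<integral>x. \<phi>' x 0 \<partial>?\<sigma>) = 0" by (simp add: LIMSEQ_const_iff)
  moreover have "(\<integral>x. \<phi>' x 0 \<partial>?\<sigma>)
      = (\<integral>x. (x \<bullet> e) ^ Suc j \<partial>?\<sigma>) - (\<integral>x. j * ((x \<bullet> e) ^ (j - 1) * (x \<bullet> f)\<^sup>2) \<partial>?\<sigma>)"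
    unfolding \<phi>'_def A_def B_def
    by (subst Bochner_Integration.integral_diff[symmetric])
      (auto intro!: cont continuous_intros simp: mult.assoc)
  ultimately show ?thesis by simp
qed

text \<open>Sum \<open>sphere_moment_pair\<close> over the n - 1 vectors \<open>f\<close> that
  complete \<open>e\<close> to an orthonormal basis; on the sphere the squares (x \<bullet> f)^2 add
  up to 1 - (x \<bullet> e)^2.\<close>

lemma sphere_moment_recursion:
  fixes e :: "real^'n"
  assumes e: "norm e = 1"
  shows "(real CARD('n) - 1 + j) * (\<integral>x. (x \<bullet> e) ^ Suc j \<partial>uniform_sphere)
    = j * (\<integral>x. (x \<bullet> e) ^ (j - 1) \<partial>uniform_sphere)"
proof -
  let ?\<sigma> = "uniform_sphere :: (real^'n) measure"
  define m where "m j = (\<integral>x. (x \<bullet> e) ^ j \<partial>?\<sigma>)" for j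
  have cont: "continuous_on UNIV h \<Longrightarrow> integrable ?\<sigma> h" for h :: "real^'n \<Rightarrow> real"
    by (rule integrable_uniform_sphere_continuous)
  obtain B where B: "e \<in> B" "pairwise orthogonal B" "\<And>x. x \<in> B \<Longrightarrow> norm x = 1"
    "independent B" "card B = DIM(real^'n)" "span B = UNIV"
    using vector_in_orthonormal_basis[OF e] by metis
  have fin: "finite B" using B by (intro independent_imp_finite)
  have parseval: "(\<Sum>f\<in>B. (x \<bullet> f)\<^sup>2) = (norm x)\<^sup>2" for x
  proof -
    have "(norm x)\<^sup>2 = x \<bullet> (\<Sum>f\<in>B. (x \<bullet> f) *\<^sub>R f)"
      using orthonormal_basis_expand[of B x] B fin by (simp add: dot_square_norm)
    then show ?thesis by (simp add: inner_sum_right power2_eq_square)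
  qed
  have "(\<Sum>f\<in>B - {e}. j * (\<integral>x. (x \<bullet> e) ^ (j - 1) * (x \<bullet> f)\<^sup>2 \<partial>?\<sigma>)) = (\<Sum>f\<in>B - {e}. m (Suc j))"
  proof (rule sum.cong)
    fix f assume f: "f \<in> B - {e}"
    then have "norm f = 1" "e \<bullet> f = 0" using B by (auto simp: pairwise_def orthogonal_def)
    then show "j * (\<integral>x. (x \<bullet> e) ^ (j - 1) * (x \<bullet> f)\<^sup>2 \<partial>?\<sigma>) = m (Suc j)"
      unfolding m_def using sphere_moment_pair[OF e] by simp
  qed simp
  also have "\<dots> = (real CARD('n) - 1) * m (Suc j)"
    using B fin by (simp add: card_Diff_singleton of_nat_diff card_gt_0_iff Suc_leI)
  also have "(\<Sum>f\<in>B - {e}. j * (\<integral>x. (x \<bullet> e) ^ (j - 1) * (x \<bullet> f)\<^sup>2 \<partial>?\<sigma>))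
      = j * (\<integral>x. (\<Sum>f\<in>B - {e}. (x \<bullet> e) ^ (j - 1) * (x \<bullet> f)\<^sup>2) \<partial>?\<sigma>)"
  proof -
    have "(\<integral>x. (\<Sum>f\<in>B - {e}. (x \<bullet> e) ^ (j - 1) * (x \<bullet> f)\<^sup>2) \<partial>?\<sigma>)
        = (\<Sum>f\<in>B - {e}. (\<integral>x. (x \<bullet> e) ^ (j - 1) * (x \<bullet> f)\<^sup>2 \<partial>?\<sigma>))"
      by (rule Bochner_Integration.integral_sum) (intro cont continuous_intros)
    then show ?thesis by (simp only: sum_distrib_left)
  qed
  also have "(\<integral>x. (\<Sum>f\<in>B - {e}. (x \<bullet> e) ^ (j - 1) * (x \<bullet> f)\<^sup>2) \<partial>?\<sigma>)
      = (\<integral>x. (x \<bullet> e) ^ (j - 1) - (x \<bullet> e) ^ (j - 1) * (x \<bullet> e)\<^sup>2 \<partial>?\<sigma>)"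
  proof (rule integral_cong_AE)
    show "AE x in ?\<sigma>. (\<Sum>f\<in>B - {e}. (x \<bullet> e) ^ (j - 1) * (x \<bullet> f)\<^sup>2)
        = (x \<bullet> e) ^ (j - 1) - (x \<bullet> e) ^ (j - 1) * (x \<bullet> e)\<^sup>2"
      using AE_uniform_sphere
    proof eventually_elim
      fix x :: "real^'n" assume "norm x = 1"
      then have "(\<Sum>f\<in>B - {e}. (x \<bullet> f)\<^sup>2) = 1 - (x \<bullet> e)\<^sup>2"
        using parseval[of x] fin B(1) by (simp add: sum_diff1)
      then show "(\<Sum>f\<in>B - {e}. (x \<bullet> e) ^ (j - 1) * (x \<bullet> f)\<^sup>2)
          = (x \<bullet> e) ^ (j - 1) - (x \<bullet> e) ^ (j - 1) * (x \<bullet> e)\<^sup>2"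
        by (simp only: sum_distrib_left[symmetric]) (simp add: right_diff_distrib)
    qed
  qed measurable
  also have "\<dots> = m (j - 1) - (\<integral>x. (x \<bullet> e) ^ (j - 1) * (x \<bullet> e)\<^sup>2 \<partial>?\<sigma>)"
    unfolding m_def by (rule Bochner_Integration.integral_diff) (auto intro!: cont continuous_intros)
  \<comment> \<open>The exponents \<open>j - 1\<close> and 2 add up to \<open>Suc j\<close> except
    at \<open>j = 0\<close>, where the factor \<open>j\<close> vanishes instead.\<close>
  also have "real j * \<dots> = real j * (m (j - 1) - m (Suc j))"
    by (cases j) (simp_all add: m_def power2_eq_square mult_ac)
  finally show ?thesis by (simp add: m_def algebra_simps)
qed

section \<open>Moments of the Gegenbauer weight\<close>

definition gegenbauer_integral :: "nat \<Rightarrow> real poly \<Rightarrow> real" where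
  "gegenbauer_integral n q = (LBINT t:{-1..1}. poly q t * gegenbauer_weight n t)"

lemma gegenbauer_integral_add:
  "n \<ge> 2 \<Longrightarrow> gegenbauer_integral n (p + q) = gegenbauer_integral n p + gegenbauer_integral n q"
  unfolding gegenbauer_integral_def by (simp add: distrib_right set_integral_add integrable_poly_weight)

lemma gegenbauer_integral_smult: "gegenbauer_integral n (smult c p) = c * gegenbauer_integral n p"
  unfolding gegenbauer_integral_def by (simp add: mult.assoc)

lemma gegenbauer_integral_diff:
  "n \<ge> 2 \<Longrightarrow> gegenbauer_integral n (p - q) = gegenbauer_integral n p - gegenbauer_integral n q"
  using gegenbauer_integral_add[of n p "smult (-1) q"] gegenbauer_integral_smult[of n "-1" q] by simp

lemma gegenbauer_integral_sum:
  "n \<ge> 2 \<Longrightarrow> gegenbauer_integral n (\<Sum>i\<in>I. f i) = (\<Sum>i\<in>I. gegenbauer_integral n (f i))"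
proof (induction I rule: infinite_finite_induct)
  case (infinite I)
  then show ?case by (simp add: gegenbauer_integral_def)
next
  case empty
  then show ?case by (simp add: gegenbauer_integral_def)
qed (simp add: gegenbauer_integral_add)

text \<open>The function t^j (1 - t^2)^((n - 1)/2) vanishes at both ends of [-1, 1], so its
  derivative, a polynomial times the weight, has integral 0. The recursion is the one of
  \<open>sphere_moment_recursion\<close>.\<close>

lemma gegenbauer_moment_recursion:
  assumes n: "n \<ge> 2"
  shows "(real n - 1 + j) * gegenbauer_integral n (monom 1 (Suc j)) = j * gegenbauer_integral n (monom 1 (j - 1))"
proof -
  define a where "a = (real n - 1) / 2"
  have a: "a > 0" "2 * a = real n - 1" "a - 1 = (real n - 3) / 2" using n by (simp_all add: a_def field_simps)
  define F where "F t = t ^ j * (1 - t\<^sup>2) powr a" for t :: real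
  define q where "q = smult (real j) (monom 1 (j - 1) - monom 1 (Suc j)) - smult (real n - 1) (monom 1 (Suc j))"
  \<comment> \<open>For \<open>n = 2\<close> the integrand is unbounded near the end points; hence
    the form of the fundamental theorem that asks for differentiability only inside. Continuity of
    \<open>F\<close> up to the ends comes from \<open>a > 0\<close>.\<close>
  have "((\<lambda>t. poly q t * gegenbauer_weight n t) has_integral (F 1 - F (-1))) {-1..1}"
  proof (rule fundamental_theorem_of_calculus_interior)
    show "continuous_on {-1..1} F"
      unfolding F_def by (intro continuous_intros continuous_on_powr') (auto simp: a abs_square_le_1 abs_le_iff)
    fix t :: real assume "t \<in> {-1<..<1}"
    then have t: "1 - t\<^sup>2 > 0" by (auto simp: abs_square_less_1 abs_less_iff)
    let ?W = "(1 - t\<^sup>2) powr (a - 1)"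
    have W: "(1 - t\<^sup>2) powr a = (1 - t\<^sup>2) * ?W"
      using t by (simp add: powr_diff)
    have "poly q t * gegenbauer_weight n t
        = (real j * t ^ (j - 1) - real j * t ^ Suc j - (real n - 1) * t ^ Suc j) * ?W"
      unfolding gegenbauer_weight_def a(3)[symmetric] by (simp add: q_def poly_monom algebra_simps)
    also have "real j * t ^ Suc j = real j * t ^ (j - 1) * t\<^sup>2"
      by (cases j) (simp_all add: power2_eq_square)
    also have "(real j * t ^ (j - 1) - real j * t ^ (j - 1) * t\<^sup>2 - (real n - 1) * t ^ Suc j) * ?W
        = real j * t ^ (j - 1) * (1 - t\<^sup>2) powr a + t ^ j * (a * ?W * (- 2 * t))"
      unfolding W a(2)[symmetric] by (simp add: algebra_simps)
    finally have eq: "poly q t * gegenbauer_weight n t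
        = real j * t ^ (j - 1) * (1 - t\<^sup>2) powr a + t ^ j * (a * ?W * (- 2 * t))" .
    have "(F has_real_derivative poly q t * gegenbauer_weight n t) (at t)"
      unfolding F_def[abs_def] eq
      by (rule derivative_eq_intros refl | use t in simp)+
    then show "(F has_vector_derivative poly q t * gegenbauer_weight n t) (at t)"
      by (simp add: has_real_derivative_iff_has_vector_derivative)
  qed simp
  then have "((\<lambda>t. poly q t * gegenbauer_weight n t) has_integral 0) {-1..1}"
    by (simp add: F_def)
  then have "gegenbauer_integral n q = 0"
    unfolding gegenbauer_integral_def
    by (subst set_borel_integral_eq_integral(2)) (auto intro: integrable_poly_weight n)
  then show ?thesis
    unfolding q_def using n by (simp add: gegenbauer_integral_diff gegenbauer_integral_smult algebra_simps)
qed

text \<open>Both moment sequences obey the same two-step recursion, so they are proportional with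
  the total weight as factor. In other words, x \<bullet> e has a density proportional to the
  weight.\<close>

lemma gegenbauer_integral_eq_sphere:
  fixes e :: "real^'n"
  assumes n: "CARD('n) \<ge> 2" and e: "norm e = 1"
  shows "gegenbauer_integral CARD('n) q
    = gegenbauer_integral CARD('n) 1 * (\<integral>x. poly q (x \<bullet> e) \<partial>uniform_sphere)"
proof -
  let ?\<sigma> = "uniform_sphere :: (real^'n) measure"
  interpret prob_space ?\<sigma> by (rule prob_space_uniform_sphere)
  let ?L = "gegenbauer_integral CARD('n)"
  have mono: "?L (monom 1 i) = ?L 1 * (\<integral>x. (x \<bullet> e) ^ i \<partial>?\<sigma>)" for i
  proof (induction i rule: less_induct)
    case (less i)
    show ?case
    proof (cases i)
      case 0
      then show ?thesis using prob_space by simp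
    next
      case (Suc j)
      \<comment> \<open>The step from \<open>j - 1\<close> to \<open>Suc j\<close> serves both
        parities; at \<open>j = 0\<close> it makes the first moments vanish.\<close>
      have "(real CARD('n) - 1 + j) * ?L (monom 1 i)
          = (real CARD('n) - 1 + j) * (?L 1 * (\<integral>x. (x \<bullet> e) ^ i \<partial>?\<sigma>))"
        using gegenbauer_moment_recursion[OF n, of j] sphere_moment_recursion[OF e, of j] less[of "j - 1"] Suc
          n prob_space
        by (cases j) (auto simp: mult.left_commute)
      moreover have "real CARD('n) - 1 + j \<noteq> 0" using n by linarith
      ultimately show ?thesis using mult_left_cancel by blast
    qed
  qed
  have q: "q = (\<Sum>i\<le>degree q. smult (coeff q i) (monom 1 i))"
    by (simp add: smult_monom poly_as_sum_of_monoms)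
  have "?L q = (\<Sum>i\<le>degree q. coeff q i * (?L 1 * (\<integral>x. (x \<bullet> e) ^ i \<partial>?\<sigma>)))"
    by (subst q) (simp add: gegenbauer_integral_sum[OF n] gegenbauer_integral_smult mono)
  also have "\<dots> = ?L 1 * (\<integral>x. (\<Sum>i\<le>degree q. coeff q i * (x \<bullet> e) ^ i) \<partial>?\<sigma>)"
  proof -
    have "(\<integral>x. (\<Sum>i\<le>degree q. coeff q i * (x \<bullet> e) ^ i) \<partial>?\<sigma>)
        = (\<Sum>i\<le>degree q. \<integral>x. coeff q i * (x \<bullet> e) ^ i \<partial>?\<sigma>)"
      by (rule Bochner_Integration.integral_sum) (intro integrable_uniform_sphere_continuous continuous_intros)
    then show ?thesis by (simp add: sum_distrib_left mult.left_commute)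
  qed
  also have "(\<lambda>x. (\<Sum>i\<le>degree q. coeff q i * (x \<bullet> e) ^ i)) = (\<lambda>x. poly q (x \<bullet> e))"
    by (simp add: poly_altdef)
  finally show ?thesis .
qed

lemma is_gegenbauer_iff:
  "is_gegenbauer n k p \<longleftrightarrow>
    degree p = k \<and> poly p 1 = 1 \<and> (\<forall>q. degree q < k \<longrightarrow> gegenbauer_integral n (p * q) = 0)"
  by (simp add: is_gegenbauer_def gegenbauer_integral_def)

text \<open>If the total weight vanished, then so would the functional \<^term>\<open>gegenbauer_integral n\<close>,
  and Gegenbauer polynomials would not be unique.\<close>

lemma gegenbauer_integral_1_nonzero:
  assumes n: "CARD('n::finite) \<ge> 2"
  shows "gegenbauer_integral CARD('n) 1 \<noteq> 0"
proof
  assume "gegenbauer_integral CARD('n) 1 = 0"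
  then have "gegenbauer_integral CARD('n) q = 0" for q
    using gegenbauer_integral_eq_sphere[OF n, of "axis undefined 1" q] by simp
  then have "is_gegenbauer CARD('n) 1 [:0, 1:]" "is_gegenbauer CARD('n) 1 [:1/2, 1/2:]"
    by (simp_all add: is_gegenbauer_iff)
  then have "[:0, 1:] = [:1/2, 1/2 :: real:]"
    using is_gegenbauer_ex1[OF n, of 1] by blast
  then show False by simp
qed

section \<open>Invariant kernels are polynomials in the inner product\<close>

text \<open>On the great circle through \<open>e\<close> and \<open>f\<close>, exchanging
  \<open>s\<close> and \<open>-s\<close> is the reflection in the axis \<open>e\<close>;
  \<open>a\<close> is the mean of \<open>q\<close> over two mirror points as a function of the
  height \<open>t\<close>. Unlike membership in a concrete space of polynomials, this is easy to
  carry through rotations and integrals together with the degree bound.\<close>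

definition even_poly_on_circles :: "nat \<Rightarrow> ('a::euclidean_space \<Rightarrow> real) \<Rightarrow> bool" where
  "even_poly_on_circles d q \<longleftrightarrow> (\<forall>e f. norm e = 1 \<longrightarrow> norm f = 1 \<longrightarrow> e \<bullet> f = 0 \<longrightarrow>
    (\<exists>a. degree a \<le> d \<and>
      (\<forall>t s. t\<^sup>2 + s\<^sup>2 = 1 \<longrightarrow> q (t *\<^sub>R e + s *\<^sub>R f) + q (t *\<^sub>R e - s *\<^sub>R f) = 2 * poly a t)))"

lemma even_poly_on_circlesE:
  assumes "even_poly_on_circles d q" "norm e = 1" "norm f = 1" "e \<bullet> f = 0"
  obtains a where "degree a \<le> d"
    "\<And>t s. t\<^sup>2 + s\<^sup>2 = 1 \<Longrightarrow> q (t *\<^sub>R e + s *\<^sub>R f) + q (t *\<^sub>R e - s *\<^sub>R f) = 2 * poly a t"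
  using assms unfolding even_poly_on_circles_def by metis

text \<open>On the circle, even powers of \<open>s\<close> are polynomials in \<open>t\<close>.\<close>

lemma real_polynomial_function_on_circles:
  fixes q :: "'a::euclidean_space \<Rightarrow> real"
  assumes "real_polynomial_function q"
  shows "\<exists>d. \<forall>u v. \<exists>a b. degree a \<le> d \<and> degree b \<le> d
    \<and> (\<forall>t s. t\<^sup>2 + s\<^sup>2 = 1 \<longrightarrow> q (t *\<^sub>R u + s *\<^sub>R v) = poly a t + s * poly b t)"
  using assms
proof (induction q rule: real_polynomial_function.induct)
  case (linear f)
  then have lin: "linear f" by (rule bounded_linear.linear)
  show ?case
  proof (rule exI[of _ 1], intro allI)
    fix u v
    show "\<exists>a b. degree a \<le> 1 \<and> degree b \<le> 1
      \<and> (\<forall>t s. t\<^sup>2 + s\<^sup>2 = 1 \<longrightarrow> f (t *\<^sub>R u + s *\<^sub>R v) = poly a t + s * poly b t)"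
      by (rule exI[of _ "[:0, f u:]"], rule exI[of _ "[:f v:]"])
        (use lin in \<open>auto simp: linear_add linear_cmul\<close>)
  qed
next
  case (const c)
  show ?case by (rule exI[of _ 0], intro allI, rule exI[of _ "[:c:]"], rule exI[of _ 0]) auto
next
  case (add f g)
  then obtain d d' where
    f: "\<And>u v. \<exists>a b. degree a \<le> d \<and> degree b \<le> d
      \<and> (\<forall>t s. t\<^sup>2 + s\<^sup>2 = 1 \<longrightarrow> f (t *\<^sub>R u + s *\<^sub>R v) = poly a t + s * poly b t)" and
    g: "\<And>u v. \<exists>a b. degree a \<le> d' \<and> degree b \<le> d'
      \<and> (\<forall>t s. t\<^sup>2 + s\<^sup>2 = 1 \<longrightarrow> g (t *\<^sub>R u + s *\<^sub>R v) = poly a t + s * poly b t)"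
    by metis
  show ?case
  proof (intro exI[of _ "max d d'"] allI)
    fix u v
    obtain a b where ab: "degree a \<le> d" "degree b \<le> d"
      "\<And>t s. t\<^sup>2 + s\<^sup>2 = 1 \<Longrightarrow> f (t *\<^sub>R u + s *\<^sub>R v) = poly a t + s * poly b t"
      using f[of u v] by metis
    obtain a' b' where ab': "degree a' \<le> d'" "degree b' \<le> d'"
      "\<And>t s. t\<^sup>2 + s\<^sup>2 = 1 \<Longrightarrow> g (t *\<^sub>R u + s *\<^sub>R v) = poly a' t + s * poly b' t"
      using g[of u v] by metis
    show "\<exists>a b. degree a \<le> max d d' \<and> degree b \<le> max d d'
      \<and> (\<forall>t s. t\<^sup>2 + s\<^sup>2 = 1 \<longrightarrow> f (t *\<^sub>R u + s *\<^sub>R v) + g (t *\<^sub>R u + s *\<^sub>R v) = poly a t + s * poly b t)"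
    proof (rule exI[of _ "a + a'"], rule exI[of _ "b + b'"], intro conjI allI impI)
      show "degree (a + a') \<le> max d d'" "degree (b + b') \<le> max d d'"
        using ab ab' by (auto intro!: degree_add_le simp: le_max_iff_disj)
    qed (simp add: ab ab' algebra_simps)
  qed
next
  case (mult f g)
  then obtain d d' where
    f: "\<And>u v. \<exists>a b. degree a \<le> d \<and> degree b \<le> d
      \<and> (\<forall>t s. t\<^sup>2 + s\<^sup>2 = 1 \<longrightarrow> f (t *\<^sub>R u + s *\<^sub>R v) = poly a t + s * poly b t)" and
    g: "\<And>u v. \<exists>a b. degree a \<le> d' \<and> degree b \<le> d'
      \<and> (\<forall>t s. t\<^sup>2 + s\<^sup>2 = 1 \<longrightarrow> g (t *\<^sub>R u + s *\<^sub>R v) = poly a t + s * poly b t)"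
    by metis
  \<comment> \<open>The 2 is the degree of 1 - t^2, which replaces s^2 in the product of the two odd
    parts.\<close>
  show ?case
  proof (intro exI[of _ "d + d' + 2"] allI)
    fix u v
    obtain a b where ab: "degree a \<le> d" "degree b \<le> d"
      "\<And>t s. t\<^sup>2 + s\<^sup>2 = 1 \<Longrightarrow> f (t *\<^sub>R u + s *\<^sub>R v) = poly a t + s * poly b t"
      using f[of u v] by metis
    obtain a' b' where ab': "degree a' \<le> d'" "degree b' \<le> d'"
      "\<And>t s. t\<^sup>2 + s\<^sup>2 = 1 \<Longrightarrow> g (t *\<^sub>R u + s *\<^sub>R v) = poly a' t + s * poly b' t"
      using g[of u v] by metis
    have le: "degree (p * p') \<le> d + d'" if "degree p \<le> d" "degree p' \<le> d'" for p p' :: "real poly"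
      using degree_mult_le[of p p'] that by linarith
    show "\<exists>a b. degree a \<le> d + d' + 2 \<and> degree b \<le> d + d' + 2
      \<and> (\<forall>t s. t\<^sup>2 + s\<^sup>2 = 1 \<longrightarrow> f (t *\<^sub>R u + s *\<^sub>R v) * g (t *\<^sub>R u + s *\<^sub>R v) = poly a t + s * poly b t)"
    proof (rule exI[of _ "a * a' + [:1, 0, -1:] * (b * b')"], rule exI[of _ "a * b' + a' * b"], intro conjI allI impI)
      have "degree ([:1, 0, -1:] * (b * b')) \<le> 2 + (d + d')"
      proof -
        have "degree [:1, 0, -1 :: real:] = 2" by simp
        then show ?thesis
          using le[OF ab(2) ab'(2)] degree_mult_le[of "[:1, 0, -1:]" "b * b'"] by linarith
      qed
      then show "degree (a * a' + [:1, 0, -1:] * (b * b')) \<le> d + d' + 2"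
        using le[OF ab(1) ab'(1)] by (intro degree_add_le) auto
      show "degree (a * b' + a' * b) \<le> d + d' + 2"
        using le[OF ab(1) ab'(2)] le[OF ab(2) ab'(1)] by (intro degree_add_le) (auto simp: mult.commute)
      fix t s :: real assume ts: "t\<^sup>2 + s\<^sup>2 = 1"
      then have "1 - t\<^sup>2 = s\<^sup>2" by simp
      then have "poly [:1, 0, -1:] t = s * s" by (simp add: power2_eq_square algebra_simps)
      then show "f (t *\<^sub>R u + s *\<^sub>R v) * g (t *\<^sub>R u + s *\<^sub>R v)
        = poly (a * a' + [:1, 0, -1:] * (b * b')) t + s * poly (a * b' + a' * b) t"
        unfolding ab(3)[OF ts] ab'(3)[OF ts] poly_add poly_mult by (simp only: algebra_simps)
    qed
  qed
qed

lemma ex_even_poly_on_circles: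
  assumes "real_polynomial_function q"
  shows "\<exists>d. even_poly_on_circles d q"
proof -
  obtain d where d: "\<And>u v. \<exists>a b. degree a \<le> d \<and> degree b \<le> d
    \<and> (\<forall>t s. t\<^sup>2 + s\<^sup>2 = 1 \<longrightarrow> q (t *\<^sub>R u + s *\<^sub>R v) = poly a t + s * poly b t)"
    using real_polynomial_function_on_circles[OF assms] by metis
  have "even_poly_on_circles d q"
    unfolding even_poly_on_circles_def
  proof (intro allI impI)
    fix e f
    obtain a b where ab: "degree a \<le> d"
      "\<And>t s. t\<^sup>2 + s\<^sup>2 = 1 \<Longrightarrow> q (t *\<^sub>R e + s *\<^sub>R f) = poly a t + s * poly b t"
      using d[of e f] by metis
    have "q (t *\<^sub>R e + s *\<^sub>R f) + q (t *\<^sub>R e - s *\<^sub>R f) = 2 * poly a t" if "t\<^sup>2 + s\<^sup>2 = 1" for t s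
      using ab(2)[of t s] ab(2)[of t "- s"] that by simp
    then show "\<exists>a. degree a \<le> d \<and> (\<forall>t s. t\<^sup>2 + s\<^sup>2 = 1 \<longrightarrow>
        q (t *\<^sub>R e + s *\<^sub>R f) + q (t *\<^sub>R e - s *\<^sub>R f) = 2 * poly a t)"
      using ab(1) by blast
  qed
  then show ?thesis ..
qed

text \<open>A power of a linear form admits the exact degree bound. Stating it for
  \<open>pCons 0 b\<close> says that \<open>b\<close> is zero or of degree below \<open>k\<close>,
  without subtraction on naturals.\<close>

lemma power_on_circle:
  fixes \<alpha> \<beta> :: real
  shows "\<exists>a b. degree a \<le> k \<and> degree (pCons 0 b) \<le> k
    \<and> (\<forall>t s. t\<^sup>2 + s\<^sup>2 = 1 \<longrightarrow> (t * \<alpha> + s * \<beta>) ^ k = poly a t + s * poly b t)"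
proof (induction k)
  case 0
  show ?case by (intro exI[of _ 1] exI[of _ 0]) simp
next
  case (Suc k)
  then obtain a b where ab: "degree a \<le> k" "degree (pCons 0 b) \<le> k"
    "\<And>t s. t\<^sup>2 + s\<^sup>2 = 1 \<Longrightarrow> (t * \<alpha> + s * \<beta>) ^ k = poly a t + s * poly b t"
    by metis
  let ?a = "smult \<alpha> (pCons 0 a) + smult \<beta> ([:1, 0, -1:] * b)"
  let ?b = "smult \<alpha> (pCons 0 b) + smult \<beta> a"
  have "degree ([:1, 0, -1:] * b) \<le> Suc k"
  proof (cases "b = 0")
    case False
    then show ?thesis using ab(2) degree_mult_le[of "[:1, 0, -1:]" b] by simp
  qed simp
  then have "degree ?a \<le> Suc k"
    using ab(1) degree_pCons_le[of 0 a]
    by (intro degree_add_le order.trans[OF degree_smult_le]) auto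
  moreover have "degree ?b \<le> k"
    using ab by (intro degree_add_le order.trans[OF degree_smult_le]) auto
  then have "degree (pCons 0 ?b) \<le> Suc k"
    using degree_pCons_le[of 0 ?b] by linarith
  moreover have "(t * \<alpha> + s * \<beta>) ^ Suc k = poly ?a t + s * poly ?b t" if ts: "t\<^sup>2 + s\<^sup>2 = 1" for t s
  proof -
    have "1 - t\<^sup>2 = s\<^sup>2" using ts by simp
    then have "poly [:1, 0, -1:] t = s * s" by (simp add: power2_eq_square algebra_simps)
    then have "poly ?a t + s * poly ?b t = (t * \<alpha> + s * \<beta>) * (poly a t + s * poly b t)"
      unfolding poly_add poly_smult poly_mult poly_pCons by (simp only: algebra_simps)
    then show ?thesis by (simp add: ab(3)[OF ts])
  qed
  ultimately show ?case by blast
qed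

lemma even_poly_on_circles_cmult:
  fixes q :: "'a::euclidean_space \<Rightarrow> real"
  assumes "even_poly_on_circles d q"
  shows "even_poly_on_circles d (\<lambda>x. c * q x)"
  unfolding even_poly_on_circles_def
proof (intro allI impI)
  fix e f :: 'a assume "norm e = 1" "norm f = 1" "e \<bullet> f = 0"
  with assms obtain a where a: "degree a \<le> d"
    "\<And>t s. t\<^sup>2 + s\<^sup>2 = 1 \<Longrightarrow> q (t *\<^sub>R e + s *\<^sub>R f) + q (t *\<^sub>R e - s *\<^sub>R f) = 2 * poly a t"
    by (rule even_poly_on_circlesE) blast
  show "\<exists>a. degree a \<le> d \<and> (\<forall>t s. t\<^sup>2 + s\<^sup>2 = 1 \<longrightarrow>
      c * q (t *\<^sub>R e + s *\<^sub>R f) + c * q (t *\<^sub>R e - s *\<^sub>R f) = 2 * poly a t)"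
    using order.trans[OF degree_smult_le[of c a] a(1)]
    by (intro exI[of _ "smult c a"]) (simp add: a(2) distrib_left[symmetric])
qed

lemma even_poly_on_circles_orthogonal_transformation:
  fixes q :: "'a::euclidean_space \<Rightarrow> real" and T :: "'a \<Rightarrow> 'a"
  assumes q: "even_poly_on_circles d q" and T: "orthogonal_transformation T"
  shows "even_poly_on_circles d (\<lambda>x. q (T x))"
  unfolding even_poly_on_circles_def
proof (intro allI impI)
  fix e f :: 'a assume "norm e = 1" "norm f = 1" "e \<bullet> f = 0"
  then have "norm (T e) = 1" "norm (T f) = 1" "T e \<bullet> T f = 0"
    using T by (simp_all add: orthogonal_transformation_norm orthogonal_transformation_def)
  with q obtain a where "degree a \<le> d"
    "\<And>t s. t\<^sup>2 + s\<^sup>2 = 1 \<Longrightarrow> q (t *\<^sub>R T e + s *\<^sub>R T f) + q (t *\<^sub>R T e - s *\<^sub>R T f) = 2 * poly a t"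
    by (rule even_poly_on_circlesE) blast
  then show "\<exists>a. degree a \<le> d \<and> (\<forall>t s. t\<^sup>2 + s\<^sup>2 = 1 \<longrightarrow>
      q (T (t *\<^sub>R e + s *\<^sub>R f)) + q (T (t *\<^sub>R e - s *\<^sub>R f)) = 2 * poly a t)"
    using orthogonal_transformation_linear[OF T] by (auto simp: linear_add linear_diff linear_cmul)
qed

text \<open>The terms odd in \<open>s\<close> cancel between mirror points. That the bound is
  \<open>degree g\<close> itself matters: it becomes the degree bound for convolutions.\<close>

lemma even_poly_on_circles_zonal:
  fixes u :: "'a::euclidean_space"
  shows "even_poly_on_circles (degree g) (\<lambda>x. poly g (x \<bullet> u))"
  unfolding even_poly_on_circles_def
proof (intro allI impI)
  fix e f :: 'a
  obtain a b where ab: "\<And>k. degree (a k) \<le> k"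
    "\<And>k t s. t\<^sup>2 + s\<^sup>2 = 1 \<Longrightarrow> (t * (e \<bullet> u) + s * (f \<bullet> u)) ^ k = poly (a k) t + s * poly (b k) t"
    using power_on_circle[of _ "e \<bullet> u" "f \<bullet> u"] by metis
  let ?A = "\<Sum>k\<le>degree g. smult (coeff g k) (a k)"
  have "degree ?A \<le> degree g"
    using ab(1) by (intro degree_sum_le) (auto intro!: order.trans[OF degree_smult_le] intro: order.trans)
  moreover have "poly g ((t *\<^sub>R e + s *\<^sub>R f) \<bullet> u) + poly g ((t *\<^sub>R e - s *\<^sub>R f) \<bullet> u) = 2 * poly ?A t"
    if ts: "t\<^sup>2 + s\<^sup>2 = 1" for t s
  proof -
    have "(t * (e \<bullet> u) + s * (f \<bullet> u)) ^ k + (t * (e \<bullet> u) - s * (f \<bullet> u)) ^ k = 2 * poly (a k) t" for k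
      using ab(2)[of t s k] ab(2)[of t "- s" k] ts by simp
    then have "coeff g k * (t * (e \<bullet> u) + s * (f \<bullet> u)) ^ k + coeff g k * (t * (e \<bullet> u) - s * (f \<bullet> u)) ^ k
        = 2 * (coeff g k * poly (a k) t)" for k
      by (simp add: distrib_left[symmetric])
    then show ?thesis
      by (simp add: inner_add_left inner_diff_left poly_altdef[of g] sum.distrib[symmetric] poly_sum sum_distrib_left)
  qed
  ultimately show "\<exists>a. degree a \<le> degree g \<and> (\<forall>t s. t\<^sup>2 + s\<^sup>2 = 1 \<longrightarrow>
      poly g ((t *\<^sub>R e + s *\<^sub>R f) \<bullet> u) + poly g ((t *\<^sub>R e - s *\<^sub>R f) \<bullet> u) = 2 * poly a t)"
    by blast
qed

text \<open>Lagrange interpolation. The \<open>l i\<close> depend on the nodes only, so every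
  polynomial of degree at most \<open>d\<close> is the same linear combination of its values;
  integrating a family of polynomials then means integrating values.\<close>

lemma ex_interpolation:
  fixes \<tau> :: "nat \<Rightarrow> 'a::field"
  assumes inj: "inj_on \<tau> {..d}"
  obtains l where "\<And>a t. degree a \<le> d \<Longrightarrow> poly a t = (\<Sum>i\<le>d. poly (l i) t * poly a (\<tau> i))"
    "\<And>i. degree (l i) \<le> d"
proof -
  define l where "l i = smult (inverse (\<Prod>j\<in>{..d} - {i}. \<tau> i - \<tau> j)) (\<Prod>j\<in>{..d} - {i}. [:- \<tau> j, 1:])" for i
  have deg: "degree (l i) \<le> d" if "i \<le> d" for i
  proof -
    have "degree (\<Prod>j\<in>{..d} - {i}. [:- \<tau> j, 1:]) \<le> (\<Sum>j\<in>{..d} - {i}. 1)"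
      by (intro order.trans[OF degree_prod_sum_le]) auto
    then show ?thesis using that unfolding l_def by (intro order.trans[OF degree_smult_le]) simp
  qed
  have val: "poly (l i) (\<tau> j) = (if i = j then 1 else 0)" if "i \<le> d" "j \<le> d" for i j
  proof (cases "i = j")
    case True
    have "(\<Prod>j\<in>{..d} - {i}. \<tau> i - \<tau> j) \<noteq> 0"
      using that inj by (auto simp: inj_on_def)
    then show ?thesis using True by (simp add: l_def poly_prod)
  next
    case False
    then show ?thesis using that by (auto simp: l_def poly_prod)
  qed
  have "poly a t = (\<Sum>i\<le>d. poly (l i) t * poly a (\<tau> i))" if "degree a \<le> d" for a t
  proof -
    let ?b = "\<Sum>i\<le>d. smult (poly a (\<tau> i)) (l i)"
    have "a = ?b"
    proof (rule poly_eqI_degree)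
      show "poly a x = poly ?b x" if x: "x \<in> \<tau> ` {..d}" for x
      proof -
        obtain j where j: "x = \<tau> j" "j \<le> d" using x by auto
        have "(\<Sum>i\<le>d. poly a (\<tau> i) * poly (l i) (\<tau> j)) = (\<Sum>i\<le>d. if i = j then poly a (\<tau> j) else 0)"
          using j by (intro sum.cong) (auto simp: val)
        then show ?thesis using j by (simp add: poly_sum)
      qed
      have "degree ?b \<le> d" using deg by (intro degree_sum_le order.trans[OF degree_smult_le]) auto
      then show "degree a < card (\<tau> ` {..d})" "degree ?b < card (\<tau> ` {..d})"
        using \<open>degree a \<le> d\<close> by (simp_all add: card_image[OF inj])
    qed
    then have "poly a t = poly ?b t" by simp
    then show ?thesis by (simp add: poly_sum mult.commute)
  qed
  note interp = this
  show ?thesis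
  \<comment> \<open>The degree bound is claimed for every \<open>i\<close>, so indices above
    \<open>d\<close> get the zero polynomial.\<close>
  proof (rule that[of "\<lambda>i. if i \<le> d then l i else 0"])
    fix a :: "'a poly" and t assume "degree a \<le> d"
    then have "poly a t = (\<Sum>i\<le>d. poly (l i) t * poly a (\<tau> i))" by (rule interp)
    also have "\<dots> = (\<Sum>i\<le>d. poly (if i \<le> d then l i else 0) t * poly a (\<tau> i))"
      by (intro sum.cong) auto
    finally show "poly a t = (\<Sum>i\<le>d. poly (if i \<le> d then l i else 0) t * poly a (\<tau> i))" .
  qed (use deg in auto)
qed

text \<open>The polynomial attached to \<open>q \<omega>\<close> comes without measurability in
  \<open>\<omega>\<close>. Interpolation recovers it from the values of \<open>q \<omega>\<close> at
  finitely many fixed points, and these are integrable.\<close>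

lemma even_poly_on_circles_integral:
  fixes q :: "'b \<Rightarrow> 'a::euclidean_space \<Rightarrow> real"
  assumes q: "AE \<omega> in M. even_poly_on_circles d (q \<omega>)"
    and int: "\<And>x. norm x = 1 \<Longrightarrow> integrable M (\<lambda>\<omega>. q \<omega> x)"
  shows "even_poly_on_circles d (\<lambda>x. \<integral>\<omega>. q \<omega> x \<partial>M)"
  unfolding even_poly_on_circles_def
proof (intro allI impI)
  fix e f :: 'a assume ef: "norm e = 1" "norm f = 1" "e \<bullet> f = 0"
  \<comment> \<open>Distinct nodes in [0, 1), so that \<open>\<rho> i\<close> completes
    \<open>\<tau> i\<close> to a point of the unit circle.\<close>
  define \<tau> where "\<tau> i = real i / real (Suc d)" for i
  define \<rho> where "\<rho> i = sqrt (1 - (\<tau> i)\<^sup>2)" for i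
  have "inj_on \<tau> {..d}" by (auto simp: inj_on_def \<tau>_def)
  then obtain l where l: "\<And>a t. degree a \<le> d \<Longrightarrow> poly a t = (\<Sum>i\<le>d. poly (l i) t * poly a (\<tau> i))"
    "\<And>i. degree (l i) \<le> d"
    by (rule ex_interpolation) blast
  have \<tau>\<rho>: "(\<tau> i)\<^sup>2 + (\<rho> i)\<^sup>2 = 1" if "i \<le> d" for i
    using that by (simp add: \<tau>_def \<rho>_def abs_square_le_1 abs_le_iff)
  have norm: "norm (t *\<^sub>R e + s *\<^sub>R f) = 1" "norm (t *\<^sub>R e - s *\<^sub>R f) = 1" if "t\<^sup>2 + s\<^sup>2 = 1" for t s
  proof -
    have "e \<bullet> e = 1" "f \<bullet> f = 1" "f \<bullet> e = 0" using ef by (simp_all add: norm_eq_1 inner_commute)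
    then show "norm (t *\<^sub>R e + s *\<^sub>R f) = 1" "norm (t *\<^sub>R e - s *\<^sub>R f) = 1"
      using that ef by (simp_all add: norm_eq_1 inner_add_left inner_add_right inner_diff_left inner_diff_right power2_eq_square)
  qed
  define g where "g \<omega> t s = q \<omega> (t *\<^sub>R e + s *\<^sub>R f) + q \<omega> (t *\<^sub>R e - s *\<^sub>R f)" for \<omega> t s
  have intg: "integrable M (\<lambda>\<omega>. g \<omega> t s)" if "t\<^sup>2 + s\<^sup>2 = 1" for t s
    unfolding g_def using norm[OF that] by (intro Bochner_Integration.integrable_add int)
  let ?a = "\<Sum>i\<le>d. smult ((\<integral>\<omega>. g \<omega> (\<tau> i) (\<rho> i) \<partial>M) / 2) (l i)"
  have "(\<integral>\<omega>. q \<omega> (t *\<^sub>R e + s *\<^sub>R f) \<partial>M) + (\<integral>\<omega>. q \<omega> (t *\<^sub>R e - s *\<^sub>R f) \<partial>M) = 2 * poly ?a t"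
    if ts: "t\<^sup>2 + s\<^sup>2 = 1" for t s
  proof -
    have "(\<integral>\<omega>. q \<omega> (t *\<^sub>R e + s *\<^sub>R f) \<partial>M) + (\<integral>\<omega>. q \<omega> (t *\<^sub>R e - s *\<^sub>R f) \<partial>M) = (\<integral>\<omega>. g \<omega> t s \<partial>M)"
      unfolding g_def using norm[OF ts] by (intro Bochner_Integration.integral_add[symmetric] int)
    also have "\<dots> = (\<integral>\<omega>. (\<Sum>i\<le>d. poly (l i) t * g \<omega> (\<tau> i) (\<rho> i)) \<partial>M)"
    proof (rule integral_cong_AE)
      show "AE \<omega> in M. g \<omega> t s = (\<Sum>i\<le>d. poly (l i) t * g \<omega> (\<tau> i) (\<rho> i))"
        using q
      proof eventually_elim
        fix \<omega> assume "even_poly_on_circles d (q \<omega>)"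
        then obtain a where a: "degree a \<le> d" "\<And>t s. t\<^sup>2 + s\<^sup>2 = 1 \<Longrightarrow> g \<omega> t s = 2 * poly a t"
          using even_poly_on_circlesE[OF _ ef] unfolding g_def by metis
        show "g \<omega> t s = (\<Sum>i\<le>d. poly (l i) t * g \<omega> (\<tau> i) (\<rho> i))"
          using a(2)[OF ts] a(2)[OF \<tau>\<rho>] l(1)[OF a(1), of t] by (simp add: sum_distrib_left mult.left_commute)
      qed
    qed (auto intro!: borel_measurable_sum borel_measurable_times borel_measurable_integrable[OF intg] ts \<tau>\<rho>)
    also have "\<dots> = (\<Sum>i\<le>d. poly (l i) t * (\<integral>\<omega>. g \<omega> (\<tau> i) (\<rho> i) \<partial>M))"
      by (subst Bochner_Integration.integral_sum) (auto intro!: intg \<tau>\<rho>)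
    finally show ?thesis by (simp add: poly_sum sum_distrib_left mult.commute)
  qed
  moreover have "degree ?a \<le> d"
    using l(2) by (intro degree_sum_le order.trans[OF degree_smult_le]) auto
  ultimately show "\<exists>a. degree a \<le> d \<and> (\<forall>t s. t\<^sup>2 + s\<^sup>2 = 1 \<longrightarrow>
      (\<integral>\<omega>. q \<omega> (t *\<^sub>R e + s *\<^sub>R f) \<partial>M) + (\<integral>\<omega>. q \<omega> (t *\<^sub>R e - s *\<^sub>R f) \<partial>M) = 2 * poly a t)"
    by blast
qed

text \<open>A pair of unit vectors is determined by its inner product t up to an orthogonal
  transformation, so \<open>h x y\<close> is the value of \<open>h e\<close> at both mirror points
  of height t. The two values agree, and their sum is twice a polynomial in t.\<close>

lemma invariant_kernel_poly:
  fixes h :: "'a::euclidean_space \<Rightarrow> 'a \<Rightarrow> real"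
  assumes dim: "DIM('a) \<ge> 2"
    and inv: "\<And>S x y. orthogonal_transformation S \<Longrightarrow> norm x = 1 \<Longrightarrow> norm y = 1 \<Longrightarrow> h (S x) (S y) = h x y"
    and poly: "\<And>x. norm x = 1 \<Longrightarrow> even_poly_on_circles d (h x)"
  obtains \<kappa> where "degree \<kappa> \<le> d" "\<And>x y. norm x = 1 \<Longrightarrow> norm y = 1 \<Longrightarrow> h x y = poly \<kappa> (x \<bullet> y)"
proof -
  obtain e :: 'a where e: "norm e = 1" using vector_choose_size[of 1] by auto
  obtain f where f: "norm f = 1" "e \<bullet> f = 0" using ex_orthogonal_unit_vector[OF e dim] by blast
  obtain a where a: "degree a \<le> d"
    "\<And>t s. t\<^sup>2 + s\<^sup>2 = 1 \<Longrightarrow> h e (t *\<^sub>R e + s *\<^sub>R f) + h e (t *\<^sub>R e - s *\<^sub>R f) = 2 * poly a t"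
    using even_poly_on_circlesE[OF poly[OF e] e f] by metis
  have "h x y = poly a (x \<bullet> y)" if xy: "norm x = 1" "norm y = 1" for x y
  proof -
    define t where "t = x \<bullet> y"
    have "\<exists>v s. norm v = 1 \<and> x \<bullet> v = 0 \<and> y = t *\<^sub>R x + s *\<^sub>R v"
    proof (cases "y = t *\<^sub>R x")
      case True
      then show ?thesis using ex_orthogonal_unit_vector[OF xy(1) dim] by (metis add_0_right scaleR_zero_left)
    next
      case False
      let ?u = "y - t *\<^sub>R x"
      have "x \<bullet> ?u = 0" using xy by (simp add: t_def inner_diff_right norm_eq_1)
      then show ?thesis using False
        by (intro exI[of _ "sgn ?u"] exI[of _ "norm ?u"]) (simp add: norm_sgn sgn_div_norm)
    qed
    then obtain v s where v: "norm v = 1" "x \<bullet> v = 0" "y = t *\<^sub>R x + s *\<^sub>R v" by blast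
    have ip: "x \<bullet> x = 1" "v \<bullet> v = 1" "v \<bullet> x = 0" using xy v by (simp_all add: norm_eq_1 inner_commute)
    have "y \<bullet> y = t\<^sup>2 + s\<^sup>2"
      unfolding v(3) by (simp add: inner_add_left inner_add_right ip v(2) power2_eq_square)
    then have ts: "t\<^sup>2 + s\<^sup>2 = 1" using xy by (simp add: norm_eq_1)
    \<comment> \<open>Sending \<open>v\<close> to \<open>f\<close> or to \<open>- f\<close> reaches
      both mirror points.\<close>
    have h: "h x y = h e (t *\<^sub>R e + s' *\<^sub>R f)" if s': "s' = s \<or> s' = - s" for s'
    proof -
      define f' where "f' = (if s' = s then f else - f)"
      have "norm f' = 1" "e \<bullet> f' = 0" "s *\<^sub>R f' = s' *\<^sub>R f" using f s' by (auto simp: f'_def)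
      then obtain S where S: "orthogonal_transformation S" "S x = e" "S v = f'"
        using ex_orthogonal_transformation_pair[OF xy(1) v(1,2) e] by blast
      then have "S y = t *\<^sub>R e + s' *\<^sub>R f"
        using orthogonal_transformation_linear[OF S(1)] \<open>s *\<^sub>R f' = s' *\<^sub>R f\<close>
        unfolding v(3) by (simp add: linear_add linear_cmul)
      then show ?thesis using inv[OF S(1) xy] S(2) by simp
    qed
    then show ?thesis using a(2)[OF ts] h[of s] h[of "- s"] by (simp add: t_def)
  qed
  then show ?thesis using a(1) that by blast
qed

section \<open>Positive definiteness\<close>

lemma Fubini_integral_bounded:
  fixes f :: "'a \<Rightarrow> 'b \<Rightarrow> real"
  assumes "prob_space M1" "prob_space M2"
    and [measurable]: "case_prod f \<in> borel_measurable (M1 \<Otimes>\<^sub>M M2)"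
    and bnd: "AE x in M1. AE y in M2. \<bar>f x y\<bar> \<le> B"
  shows "(\<integral>x. (\<integral>y. f x y \<partial>M2) \<partial>M1) = (\<integral>y. (\<integral>x. f x y \<partial>M1) \<partial>M2)"
proof -
  interpret M1: prob_space M1 by fact
  interpret M2: prob_space M2 by fact
  interpret pair_prob_space M1 M2 ..
  have "AE z in M1 \<Otimes>\<^sub>M M2. \<bar>case_prod f z\<bar> \<le> B"
    by (rule AE_pair_measure) (use bnd in auto)
  then have "integrable (M1 \<Otimes>\<^sub>M M2) (case_prod f)"
    by (intro integrable_const_bound[where B = B]) auto
  then show ?thesis by (rule Fubini_integral[symmetric])
qed

lemma continuous_bounded_on_sphere:
  fixes p :: "'a::euclidean_space \<Rightarrow> real"
  assumes "continuous_on UNIV p"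
  obtains B where "B \<ge> 0" "\<And>x. norm x = 1 \<Longrightarrow> \<bar>p x\<bar> \<le> B"
proof -
  have "compact (p ` sphere 0 1)"
    using assms by (intro compact_continuous_image) (auto intro: continuous_on_subset)
  then obtain B where "\<forall>x\<in>sphere 0 1. norm (p x) \<le> B"
    using compact_imp_bounded[of "p ` sphere 0 1"] by (auto simp: bounded_iff)
  then show ?thesis by (intro that[of "max B 0"]) (auto simp: le_max_iff_disj)
qed

lemma poly_bounded_on_sphere:
  fixes g :: "real poly"
  obtains B where "B \<ge> 0"
    "\<And>x y :: 'a::euclidean_space. norm x = 1 \<Longrightarrow> norm y = 1 \<Longrightarrow> \<bar>poly g (x \<bullet> y)\<bar> \<le> B"
proof -
  have "compact (poly g ` {-1..1})" by (intro compact_continuous_image continuous_intros) auto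
  then obtain B where "\<forall>t\<in>{-1..1}. norm (poly g t) \<le> B"
    using compact_imp_bounded[of "poly g ` {-1..1}"] by (auto simp: bounded_iff)
  moreover have "x \<bullet> y \<in> {-1..1}" if "norm x = 1" "norm y = 1" for x y :: 'a
    using Cauchy_Schwarz_ineq2[of x y] that by (auto simp: abs_le_iff)
  ultimately show ?thesis by (intro that[of "max B 0"]) (auto simp: le_max_iff_disj)
qed

section \<open>Convolution of zonal functions\<close>

text \<open>Rotating \<open>u\<close> shows that the integral is an invariant kernel. As a function
  of \<open>y\<close> it averages multiples of zonal polynomials of degree \<open>degree g\<close>,
  so \<open>g\<close> alone bounds the degree, whatever \<open>f\<close> is.\<close>

lemma zonal_convolution:
  fixes f g :: "real poly"
  assumes dim: "DIM('a::euclidean_space) \<ge> 2"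
  obtains \<kappa> where "degree \<kappa> \<le> degree g"
    "\<And>x y :: 'a. norm x = 1 \<Longrightarrow> norm y = 1 \<Longrightarrow>
      (\<integral>u. poly f (x \<bullet> u) * poly g (y \<bullet> u) \<partial>uniform_sphere) = poly \<kappa> (x \<bullet> y)"
proof -
  define h where "h x y = (\<integral>u. poly f (x \<bullet> u) * poly g (y \<bullet> u) \<partial>uniform_sphere)" for x y :: 'a
  have "h (S x) (S y) = h x y" if S: "orthogonal_transformation S" for S x y
  proof -
    have "S a \<bullet> S b = a \<bullet> b" for a b using S by (simp add: orthogonal_transformation_def)
    then show ?thesis
      using integral_uniform_sphere_orthogonal_transformation[OF S,
          of "\<lambda>u. poly f (S x \<bullet> u) * poly g (S y \<bullet> u)"] by (simp add: h_def)
  qed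
  moreover have "even_poly_on_circles (degree g) (h x)" for x
    unfolding h_def
    by (intro even_poly_on_circles_integral AE_I2 even_poly_on_circles_cmult even_poly_on_circles_zonal
        integrable_uniform_sphere_continuous continuous_intros)
  ultimately obtain \<kappa> where "degree \<kappa> \<le> degree g"
    "\<And>x y. norm x = 1 \<Longrightarrow> norm y = 1 \<Longrightarrow> h x y = poly \<kappa> (x \<bullet> y)"
    using invariant_kernel_poly[OF dim, of h "degree g"] by blast
  then show ?thesis using that by (simp add: h_def)
qed

lemma gegenbauer_props:
  assumes "n \<ge> 2"
  shows degree_gegenbauer: "degree (gegenbauer n k) = k"
    and poly_gegenbauer_1: "poly (gegenbauer n k) 1 = 1"
    and gegenbauer_orthogonal: "degree q < k \<Longrightarrow> gegenbauer_integral n (gegenbauer n k * q) = 0"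
  using is_gegenbauer_gegenbauer[OF assms, of k] by (auto simp: is_gegenbauer_iff)

text \<open>The difference \<open>R\<close> between \<open>r\<close> and the multiple with the same
  value at 1 vanishes at 1 and is orthogonal too. Adding a multiple of \<open>R\<close> to
  \<open>?P\<close> preserves the defining property as long as the degree stays \<open>k\<close>, so
  uniqueness forces \<open>R = 0\<close>.\<close>

lemma orthogonal_eq_smult_gegenbauer:
  assumes n: "n \<ge> 2" and deg: "degree r \<le> k"
    and orth: "\<And>q. degree q < k \<Longrightarrow> gegenbauer_integral n (r * q) = 0"
  shows "r = smult (poly r 1) (gegenbauer n k)"
proof -
  let ?P = "gegenbauer n k"
  define R where "R = r - smult (poly r 1) ?P"
  have degR: "degree R \<le> k"
    unfolding R_def using deg degree_gegenbauer[OF n, of k]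
    by (intro degree_diff_le order.trans[OF degree_smult_le]) auto
  have R1: "poly R 1 = 0" by (simp add: R_def poly_gegenbauer_1[OF n])
  have R: "gegenbauer_integral n (R * q) = 0" if "degree q < k" for q
    using that by (simp add: R_def left_diff_distrib gegenbauer_integral_diff[OF n]
        gegenbauer_integral_smult orth gegenbauer_orthogonal[OF n])
  have "coeff ?P k \<noteq> 0"
    using poly_gegenbauer_1[OF n, of k] degree_gegenbauer[OF n, of k] leading_coeff_0_iff[of ?P] by auto
  \<comment> \<open>\<open>c = 1\<close> works unless the coefficients cancel, and then
    \<open>c = -1\<close> doubles that of \<open>?P\<close>.\<close>
  then have "\<exists>c::real. c \<noteq> 0 \<and> coeff ?P k + c * coeff R k \<noteq> 0"
  proof (cases "coeff ?P k + coeff R k = 0")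
    case True
    then show ?thesis using \<open>coeff ?P k \<noteq> 0\<close> by (intro exI[of _ "-1"]) linarith
  qed (intro exI[of _ 1], simp)
  then obtain c :: real where c: "c \<noteq> 0" "coeff ?P k + c * coeff R k \<noteq> 0" by blast
  have "degree (?P + smult c R) \<le> k"
    using degR degree_gegenbauer[OF n, of k] by (intro degree_add_le order.trans[OF degree_smult_le]) auto
  moreover have "degree (?P + smult c R) \<ge> k" using c(2) by (intro le_degree) simp
  ultimately have "is_gegenbauer n k (?P + smult c R)"
    using R R1 by (simp add: is_gegenbauer_iff poly_gegenbauer_1[OF n] distrib_right
        gegenbauer_integral_add[OF n] gegenbauer_integral_smult gegenbauer_orthogonal[OF n])
  then have "?P + smult c R = ?P"
    using is_gegenbauer_ex1[OF n, of k] is_gegenbauer_gegenbauer[OF n, of k] by blast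
  then have "R = 0" using c(1) by simp
  then show ?thesis by (simp add: R_def)
qed

text \<open>Otherwise the functional would vanish on all multiples of \<open>?P\<close>. Then the
  mean of \<open>?P\<close> and \<open>?Q\<close> would have the defining property in degree
  \<open>Suc k\<close>, and uniqueness would identify \<open>?P\<close> with \<open>?Q\<close>,
  which has another degree.\<close>

lemma gegenbauer_sphere_square_pos:
  fixes e :: "real^'n"
  assumes n: "CARD('n) \<ge> 2" and e: "norm e = 1"
  shows "(\<integral>u. (poly (gegenbauer CARD('n) k) (u \<bullet> e))\<^sup>2 \<partial>uniform_sphere) > 0"
proof (rule ccontr)
  let ?\<sigma> = "uniform_sphere :: (real^'n) measure"
  let ?P = "gegenbauer CARD('n) k" and ?Q = "gegenbauer CARD('n) (Suc k)"
  let ?I = "gegenbauer_integral CARD('n)"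
  assume "\<not> ?thesis"
  moreover have "(\<integral>u. (poly ?P (u \<bullet> e))\<^sup>2 \<partial>?\<sigma>) \<ge> 0"
    by (rule Bochner_Integration.integral_nonneg) simp
  ultimately have "(\<integral>u. (poly ?P (u \<bullet> e))\<^sup>2 \<partial>?\<sigma>) = 0" by linarith
  moreover have "integrable ?\<sigma> (\<lambda>u. (poly ?P (u \<bullet> e))\<^sup>2)"
    by (intro integrable_uniform_sphere_continuous continuous_intros)
  ultimately have "AE u in ?\<sigma>. (poly ?P (u \<bullet> e))\<^sup>2 = 0"
    by (subst (asm) integral_nonneg_eq_0_iff_AE) auto
  then have "AE u in ?\<sigma>. poly (?P * q) (u \<bullet> e) = 0" for q
    by eventually_elim auto
  then have "(\<integral>u. poly (?P * q) (u \<bullet> e) \<partial>?\<sigma>) = 0" for q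
    by (rule integral_eq_zero_AE)
  then have PI: "?I (?P * q) = 0" for q
    using gegenbauer_integral_eq_sphere[OF n e, of "?P * q"] by simp
  define R where "R = smult (1/2) (?Q + ?P)"
  have deg: "degree (?Q + ?P) = Suc k"
    using degree_gegenbauer[OF n] by (subst degree_add_eq_left) auto
  have "degree R = Suc k" by (simp add: R_def deg del: smult_add_right)
  moreover have "poly R 1 = 1" by (simp add: R_def poly_gegenbauer_1[OF n])
  moreover have "?I (R * q) = 0" if "degree q < Suc k" for q
    using that by (simp add: R_def distrib_right gegenbauer_integral_add[OF n]
        gegenbauer_integral_smult gegenbauer_orthogonal[OF n] PI)
  ultimately have "is_gegenbauer CARD('n) (Suc k) R"
    by (simp add: is_gegenbauer_iff)
  then have "R = ?Q"
    using is_gegenbauer_ex1[OF n, of "Suc k"] is_gegenbauer_gegenbauer[OF n, of "Suc k"] by blast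
  then have "poly ?P t = poly ?Q t" for t
    by (auto simp: R_def dest!: arg_cong[where f = "\<lambda>r. poly r t"])
  then have "?P = ?Q" by (simp add: poly_eq_poly_eq_iff[symmetric] fun_eq_iff)
  then show False using degree_gegenbauer[OF n, of k] degree_gegenbauer[OF n, of "Suc k"] by simp
qed

text \<open>To test \<open>\<kappa>\<close> against \<open>q\<close> of lower degree, exchange the
  integrals: \<open>?P\<close> gets integrated against the convolution of \<open>?P\<close> with
  \<open>q\<close>, whose degree is at most that of \<open>q\<close>, and the result is 0. The
  factor \<open>c\<close> is the value of \<open>\<kappa>\<close> at 1, the mean square of
  \<open>?P\<close>.\<close>

lemma gegenbauer_convolution:
  assumes n: "CARD('n::finite) \<ge> 2"
  obtains c where "c > 0"
    "\<And>x y :: real^'n. norm x = 1 \<Longrightarrow> norm y = 1 \<Longrightarrow>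
      (\<integral>u. poly (gegenbauer CARD('n) k) (x \<bullet> u) * poly (gegenbauer CARD('n) k) (y \<bullet> u) \<partial>uniform_sphere)
        = c * poly (gegenbauer CARD('n) k) (x \<bullet> y)"
proof -
  let ?\<sigma> = "uniform_sphere :: (real^'n) measure"
  let ?P = "gegenbauer CARD('n) k" and ?I = "gegenbauer_integral CARD('n)"
  interpret \<sigma>: prob_space ?\<sigma> by (rule prob_space_uniform_sphere)
  obtain e :: "real^'n" where e: "norm e = 1" using vector_choose_size[of 1] by auto
  have dim: "DIM(real^'n) \<ge> 2" using n by simp
  obtain \<kappa> where deg: "degree \<kappa> \<le> degree ?P" and
    \<kappa>: "\<And>x y :: real^'n. norm x = 1 \<Longrightarrow> norm y = 1 \<Longrightarrow>
      (\<integral>u. poly ?P (x \<bullet> u) * poly ?P (y \<bullet> u) \<partial>?\<sigma>) = poly \<kappa> (x \<bullet> y)"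
    using zonal_convolution[OF dim, of ?P ?P] by metis
  have "?I (\<kappa> * q) = 0" if q: "degree q < k" for q
  proof -
    obtain l where l: "degree l \<le> degree q" and
      lq: "\<And>x y :: real^'n. norm x = 1 \<Longrightarrow> norm y = 1 \<Longrightarrow>
        (\<integral>u. poly ?P (x \<bullet> u) * poly q (y \<bullet> u) \<partial>?\<sigma>) = poly l (x \<bullet> y)"
      using zonal_convolution[OF dim, of q ?P] by metis
    obtain B C where B: "B \<ge> 0" "\<And>x y :: real^'n. norm x = 1 \<Longrightarrow> norm y = 1 \<Longrightarrow> \<bar>poly ?P (x \<bullet> y)\<bar> \<le> B"
      and C: "C \<ge> 0" "\<And>x y :: real^'n. norm x = 1 \<Longrightarrow> norm y = 1 \<Longrightarrow> \<bar>poly q (x \<bullet> y)\<bar> \<le> C"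
      using poly_bounded_on_sphere by metis
    have "(\<integral>y. poly (\<kappa> * q) (y \<bullet> e) \<partial>?\<sigma>)
        = (\<integral>y. (\<integral>u. poly ?P (e \<bullet> u) * (poly ?P (u \<bullet> y) * poly q (e \<bullet> y)) \<partial>?\<sigma>) \<partial>?\<sigma>)"
    proof (rule integral_cong_AE)
      show "AE y in ?\<sigma>. poly (\<kappa> * q) (y \<bullet> e)
          = (\<integral>u. poly ?P (e \<bullet> u) * (poly ?P (u \<bullet> y) * poly q (e \<bullet> y)) \<partial>?\<sigma>)"
        using AE_uniform_sphere
      proof eventually_elim
        fix y :: "real^'n" assume y: "norm y = 1"
        have "poly (\<kappa> * q) (y \<bullet> e) = (\<integral>u. poly ?P (e \<bullet> u) * poly ?P (y \<bullet> u) \<partial>?\<sigma>) * poly q (e \<bullet> y)"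
          by (simp only: poly_mult \<kappa>[OF e y] inner_commute[of y e])
        also have "\<dots> = (\<integral>u. poly ?P (e \<bullet> u) * (poly ?P (u \<bullet> y) * poly q (e \<bullet> y)) \<partial>?\<sigma>)"
          by (simp add: mult.assoc[symmetric] inner_commute)
        finally show "poly (\<kappa> * q) (y \<bullet> e)
          = (\<integral>u. poly ?P (e \<bullet> u) * (poly ?P (u \<bullet> y) * poly q (e \<bullet> y)) \<partial>?\<sigma>)" .
      qed
    qed measurable
    also have "\<dots> = (\<integral>u. (\<integral>y. poly ?P (e \<bullet> u) * (poly ?P (u \<bullet> y) * poly q (e \<bullet> y)) \<partial>?\<sigma>) \<partial>?\<sigma>)"
    proof (rule Fubini_integral_bounded[OF prob_space_uniform_sphere prob_space_uniform_sphere])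
      show "AE y in ?\<sigma>. AE u in ?\<sigma>. \<bar>poly ?P (e \<bullet> u) * (poly ?P (u \<bullet> y) * poly q (e \<bullet> y))\<bar> \<le> B * (B * C)"
        using AE_uniform_sphere
      proof eventually_elim
        fix y :: "real^'n" assume y: "norm y = 1"
        show "AE u in ?\<sigma>. \<bar>poly ?P (e \<bullet> u) * (poly ?P (u \<bullet> y) * poly q (e \<bullet> y))\<bar> \<le> B * (B * C)"
          using AE_uniform_sphere
          by eventually_elim (use B C e y in \<open>auto simp: abs_mult intro!: mult_mono\<close>)
      qed
    qed measurable
    also have "\<dots> = (\<integral>u. poly (?P * l) (u \<bullet> e) \<partial>?\<sigma>)"
    proof (rule integral_cong_AE)
      show "AE u in ?\<sigma>. (\<integral>y. poly ?P (e \<bullet> u) * (poly ?P (u \<bullet> y) * poly q (e \<bullet> y)) \<partial>?\<sigma>) = poly (?P * l) (u \<bullet> e)"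
        using AE_uniform_sphere
      proof eventually_elim
        fix u :: "real^'n" assume "norm u = 1"
        then show "(\<integral>y. poly ?P (e \<bullet> u) * (poly ?P (u \<bullet> y) * poly q (e \<bullet> y)) \<partial>?\<sigma>) = poly (?P * l) (u \<bullet> e)"
          by (simp add: lq e inner_commute[of u e])
      qed
    qed measurable
    also have "?I 1 * \<dots> = ?I (?P * l)" by (rule gegenbauer_integral_eq_sphere[OF n e, symmetric])
    also have "\<dots> = 0" using l q by (intro gegenbauer_orthogonal[OF n]) simp
    finally show ?thesis using gegenbauer_integral_eq_sphere[OF n e, of "\<kappa> * q"] by simp
  qed
  then have eq: "\<kappa> = smult (poly \<kappa> 1) ?P"
    using deg degree_gegenbauer[OF n, of k] by (intro orthogonal_eq_smult_gegenbauer[OF n]) auto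
  have "poly \<kappa> 1 = (\<integral>u. (poly ?P (u \<bullet> e))\<^sup>2 \<partial>?\<sigma>)"
    using \<kappa>[OF e e] e by (simp add: norm_eq_1 inner_commute power2_eq_square)
  then have "poly \<kappa> 1 > 0" using gegenbauer_sphere_square_pos[OF n e] by simp
  moreover have "poly \<kappa> (x \<bullet> y) = poly \<kappa> 1 * poly ?P (x \<bullet> y)" for x y :: "real^'n"
    by (subst eq) simp
  ultimately show ?thesis using that[of "poly \<kappa> 1"] \<kappa> by simp
qed

lemma gegenbauer_expansion:
  assumes n: "n \<ge> 2"
  shows "degree g \<le> d \<Longrightarrow> \<exists>a. g = (\<Sum>k\<le>d. smult (a k) (gegenbauer n k))"
proof (induction d arbitrary: g)
  case 0
  have "gegenbauer n 0 = 1"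
    using degree_gegenbauer[OF n, of 0] poly_gegenbauer_1[OF n, of 0]
    by (auto elim!: degree_eq_zeroE)
  moreover obtain c where "g = [:c:]" using 0 by (auto elim!: degree_eq_zeroE)
  ultimately show ?case by (intro exI[of _ "\<lambda>_. c"]) simp
next
  case (Suc d)
  let ?P = "gegenbauer n (Suc d)"
  define c where "c = coeff g (Suc d) / coeff ?P (Suc d)"
  have "?P \<noteq> 0" using poly_gegenbauer_1[OF n, of "Suc d"] by auto
  then have "coeff ?P (Suc d) \<noteq> 0"
    using degree_gegenbauer[OF n, of "Suc d"] leading_coeff_0_iff[of ?P] by auto
  then have "coeff (g - smult c ?P) (Suc d) = 0" by (simp add: c_def)
  moreover have "coeff (g - smult c ?P) i = 0" if "i > Suc d" for i
    using that Suc.prems degree_gegenbauer[OF n, of "Suc d"] by (simp add: coeff_eq_0)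
  ultimately have "degree (g - smult c ?P) \<le> d"
    by (intro degree_le) (metis Suc_lessI)
  from Suc.IH[OF this] obtain a where a: "g - smult c ?P = (\<Sum>k\<le>d. smult (a k) (gegenbauer n k))"
    by blast
  have "g = (\<Sum>k\<le>d. smult (a k) (gegenbauer n k)) + smult c ?P"
    using a by (simp add: diff_eq_eq)
  also have "\<dots> = (\<Sum>k\<le>Suc d. smult ((a(Suc d := c)) k) (gegenbauer n k))"
    by (simp add: sum.atMost_Suc)
  finally show ?case by blast
qed

lemma gegenbauer_coefficient:
  assumes n: "n \<ge> 2" and g: "g = (\<Sum>k\<le>d. smult (a k) (gegenbauer n k))" and k: "k \<le> d"
  shows "gegenbauer_integral n (g * gegenbauer n k)
    = a k * gegenbauer_integral n (gegenbauer n k * gegenbauer n k)"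
proof -
  have orth: "gegenbauer_integral n (gegenbauer n j * gegenbauer n k) = 0" if "j \<noteq> k" for j
  proof (cases j k rule: linorder_cases)
    case less
    then show ?thesis
      using gegenbauer_orthogonal[OF n, of "gegenbauer n j" k] degree_gegenbauer[OF n, of j]
      by (simp add: mult.commute)
  next
    case greater
    then show ?thesis
      using gegenbauer_orthogonal[OF n, of "gegenbauer n k" j] degree_gegenbauer[OF n, of k] by simp
  qed (use that in simp)
  have "gegenbauer_integral n (g * gegenbauer n k)
      = (\<Sum>j\<le>d. a j * gegenbauer_integral n (gegenbauer n j * gegenbauer n k))"
    unfolding g by (simp add: sum_distrib_right gegenbauer_integral_sum[OF n] gegenbauer_integral_smult)
  also have "\<dots> = (\<Sum>j\<le>d. if j = k then a k * gegenbauer_integral n (gegenbauer n k * gegenbauer n k) else 0)"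
    by (intro sum.cong) (auto simp: orth)
  finally show ?thesis using k by simp
qed

text \<open>Reversing the argument keeps orthogonality, by symmetry of the sphere, so it yields a
  multiple of the polynomial; comparing leading coefficients in odd degree gives the factor
  -1.\<close>

lemma poly_gegenbauer_uminus_odd:
  assumes n: "CARD('n::finite) \<ge> 2" and k: "odd k"
  shows "poly (gegenbauer CARD('n) k) (- t) = - poly (gegenbauer CARD('n) k) t"
proof -
  let ?\<sigma> = "uniform_sphere :: (real^'n) measure"
  let ?P = "gegenbauer CARD('n) k" and ?I = "gegenbauer_integral CARD('n)"
  obtain e :: "real^'n" where e: "norm e = 1" using vector_choose_size[of 1] by auto
  define r where "r = ?P \<circ>\<^sub>p [:0, -1:]"
  have "degree r = k" using degree_gegenbauer[OF n, of k] by (simp add: r_def degree_pcompose)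
  have "?I (r * q) = 0" if "degree q < k" for q
  proof -
    let ?q = "q \<circ>\<^sub>p [:0, -1:]"
    have u: "orthogonal_transformation (uminus :: real^'n \<Rightarrow> real^'n)"
    by (simp add: orthogonal_transformation_def linear_iff)
    have "(\<integral>x. poly (r * q) (x \<bullet> e) \<partial>?\<sigma>) = (\<integral>x. poly (r * q) (- x \<bullet> e) \<partial>?\<sigma>)"
      by (rule integral_uniform_sphere_orthogonal_transformation[OF u, symmetric]) measurable
    also have "\<dots> = (\<integral>x. poly (?P * ?q) (x \<bullet> e) \<partial>?\<sigma>)" by (simp add: r_def poly_pcompose)
    finally have "?I (r * q) = ?I (?P * ?q)"
      using gegenbauer_integral_eq_sphere[OF n e, of "r * q"]
        gegenbauer_integral_eq_sphere[OF n e, of "?P * ?q"] by simp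
    also have "\<dots> = 0" using that by (intro gegenbauer_orthogonal[OF n]) (simp add: degree_pcompose)
    finally show ?thesis .
  qed
  then have r: "r = smult (poly r 1) ?P"
    using \<open>degree r = k\<close> by (intro orthogonal_eq_smult_gegenbauer[OF n]) auto
  have "?P \<noteq> 0" using poly_gegenbauer_1[OF n, of k] by auto
  then have lc: "lead_coeff ?P \<noteq> 0" by (simp only: leading_coeff_0_iff not_False_eq_True)
  have "lead_coeff r = lead_coeff ?P * (-1) ^ degree ?P"
    unfolding r_def by (subst lead_coeff_comp) auto
  also have "\<dots> = - lead_coeff ?P" using degree_gegenbauer[OF n, of k] k by simp
  finally have "coeff r k = - coeff ?P k"
    using \<open>degree r = k\<close> degree_gegenbauer[OF n, of k] by simp
  moreover have "coeff r k = poly r 1 * coeff ?P k"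
    using arg_cong[OF r, of "\<lambda>q. coeff q k"] by simp
  moreover have "coeff ?P k \<noteq> 0" using lc degree_gegenbauer[OF n, of k] by simp
  ultimately have "poly r 1 = -1" by (metis mult_cancel_right mult_minus1)
  then have "poly r t = - poly ?P t"
    using arg_cong[OF r, of "\<lambda>q. poly q t"] by simp
  then show ?thesis by (simp add: r_def poly_pcompose)
qed

lemma (in prob_space) abs_integral_le:
  fixes f :: "'a \<Rightarrow> real"
  assumes "integrable M f" "AE x in M. \<bar>f x\<bar> \<le> B"
  shows "\<bar>\<integral>x. f x \<partial>M\<bar> \<le> B"
proof -
  have "AE x in M. f x \<le> B" "AE x in M. - B \<le> f x" using assms(2) by (auto elim!: eventually_mono)
  then show ?thesis
    using integral_le_const[OF assms(1), of B] integral_ge_const[OF assms(1), of "- B"]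
    by (simp add: abs_le_iff)
qed

text \<open>Up to the factor \<open>c\<close>, the kernel is the convolution of the Gegenbauer
  polynomial with itself. Inserting this and exchanging integrals twice turns the form into the
  integral of the square of \<open>A\<close>, the zonal transform of \<open>p\<close>.\<close>

lemma zonal_form_nonneg:
  fixes p :: "real^'n \<Rightarrow> real"
  assumes n: "CARD('n) \<ge> 2" and p: "continuous_on UNIV p"
  shows "(\<integral>z. p z * (\<integral>y. p y * poly (gegenbauer CARD('n) k) (z \<bullet> y) \<partial>uniform_sphere) \<partial>uniform_sphere) \<ge> 0"
proof -
  let ?\<sigma> = "uniform_sphere :: (real^'n) measure"
  let ?P = "gegenbauer CARD('n) k"
  interpret \<sigma>: prob_space ?\<sigma> by (rule prob_space_uniform_sphere)
  have [measurable]: "p \<in> borel_measurable borel" using p by (rule borel_measurable_continuous_onI)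
  obtain c where c: "c > 0" and conv: "\<And>x y :: real^'n. norm x = 1 \<Longrightarrow> norm y = 1 \<Longrightarrow>
      (\<integral>u. poly ?P (x \<bullet> u) * poly ?P (y \<bullet> u) \<partial>?\<sigma>) = c * poly ?P (x \<bullet> y)"
    by (rule gegenbauer_convolution[OF n, of k]) blast
  obtain B where B: "B \<ge> 0" "\<And>x y :: real^'n. norm x = 1 \<Longrightarrow> norm y = 1 \<Longrightarrow> \<bar>poly ?P (x \<bullet> y)\<bar> \<le> B"
    by (rule poly_bounded_on_sphere) blast
  obtain K where K: "K \<ge> 0" "\<And>x. norm x = 1 \<Longrightarrow> \<bar>p x\<bar> \<le> K"
    by (rule continuous_bounded_on_sphere[OF p]) blast
  define H where "H z = (\<integral>y. p y * poly ?P (z \<bullet> y) \<partial>?\<sigma>)" for z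
  define A where "A u = (\<integral>y. p y * poly ?P (y \<bullet> u) \<partial>?\<sigma>)" for u
  have [measurable]: "H \<in> borel_measurable borel" "A \<in> borel_measurable borel"
    unfolding H_def[abs_def] A_def[abs_def] by measurable
  have A: "\<bar>A u\<bar> \<le> K * B" if u: "norm u = 1" for u
    unfolding A_def
  proof (rule \<sigma>.abs_integral_le)
    show "integrable ?\<sigma> (\<lambda>y. p y * poly ?P (y \<bullet> u))"
      by (intro integrable_uniform_sphere_continuous continuous_intros p)
    show "AE y in ?\<sigma>. \<bar>p y * poly ?P (y \<bullet> u)\<bar> \<le> K * B"
      using AE_uniform_sphere by eventually_elim (use K B u in \<open>auto simp: abs_mult intro!: mult_mono\<close>)
  qed
  have H: "c * H z = (\<integral>u. poly ?P (z \<bullet> u) * A u \<partial>?\<sigma>)" if z: "norm z = 1" for z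
  proof -
    have "c * H z = (\<integral>y. p y * (c * poly ?P (z \<bullet> y)) \<partial>?\<sigma>)"
      by (simp add: H_def mult.left_commute[of _ c])
    also have "\<dots> = (\<integral>y. (\<integral>u. p y * (poly ?P (z \<bullet> u) * poly ?P (y \<bullet> u)) \<partial>?\<sigma>) \<partial>?\<sigma>)"
    proof (rule integral_cong_AE)
      show "AE y in ?\<sigma>. p y * (c * poly ?P (z \<bullet> y))
          = (\<integral>u. p y * (poly ?P (z \<bullet> u) * poly ?P (y \<bullet> u)) \<partial>?\<sigma>)"
        using AE_uniform_sphere by eventually_elim (simp add: conv z)
    qed measurable
    also have "\<dots> = (\<integral>u. (\<integral>y. p y * (poly ?P (z \<bullet> u) * poly ?P (y \<bullet> u)) \<partial>?\<sigma>) \<partial>?\<sigma>)"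
    proof (rule Fubini_integral_bounded[OF prob_space_uniform_sphere prob_space_uniform_sphere])
      show "AE y in ?\<sigma>. AE u in ?\<sigma>. \<bar>p y * (poly ?P (z \<bullet> u) * poly ?P (y \<bullet> u))\<bar> \<le> K * (B * B)"
        using AE_uniform_sphere
      proof eventually_elim
        fix y :: "real^'n" assume y: "norm y = 1"
        show "AE u in ?\<sigma>. \<bar>p y * (poly ?P (z \<bullet> u) * poly ?P (y \<bullet> u))\<bar> \<le> K * (B * B)"
          using AE_uniform_sphere
          by eventually_elim (use K B z y in \<open>auto simp: abs_mult intro!: mult_mono\<close>)
      qed
    qed measurable
    also have "\<dots> = (\<integral>u. poly ?P (z \<bullet> u) * A u \<partial>?\<sigma>)"
    proof -
      have "(\<integral>y. p y * (poly ?P (z \<bullet> u) * poly ?P (y \<bullet> u)) \<partial>?\<sigma>)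
          = (\<integral>y. poly ?P (z \<bullet> u) * (p y * poly ?P (y \<bullet> u)) \<partial>?\<sigma>)" for u
        by (intro Bochner_Integration.integral_cong) (simp_all add: mult_ac)
      then show ?thesis by (simp add: A_def)
    qed
    finally show ?thesis .
  qed
  have "c * (\<integral>z. p z * H z \<partial>?\<sigma>) = (\<integral>z. p z * (c * H z) \<partial>?\<sigma>)"
    by (simp add: mult.left_commute[of _ c])
  also have "\<dots> = (\<integral>z. (\<integral>u. p z * (poly ?P (z \<bullet> u) * A u) \<partial>?\<sigma>) \<partial>?\<sigma>)"
  proof (rule integral_cong_AE)
    show "AE z in ?\<sigma>. p z * (c * H z) = (\<integral>u. p z * (poly ?P (z \<bullet> u) * A u) \<partial>?\<sigma>)"
      using AE_uniform_sphere by eventually_elim (simp add: H)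
  qed measurable
  also have "\<dots> = (\<integral>u. (\<integral>z. p z * (poly ?P (z \<bullet> u) * A u) \<partial>?\<sigma>) \<partial>?\<sigma>)"
  proof (rule Fubini_integral_bounded[OF prob_space_uniform_sphere prob_space_uniform_sphere])
    show "AE z in ?\<sigma>. AE u in ?\<sigma>. \<bar>p z * (poly ?P (z \<bullet> u) * A u)\<bar> \<le> K * (B * (K * B))"
      using AE_uniform_sphere
    proof eventually_elim
      fix z :: "real^'n" assume z: "norm z = 1"
      show "AE u in ?\<sigma>. \<bar>p z * (poly ?P (z \<bullet> u) * A u)\<bar> \<le> K * (B * (K * B))"
        using AE_uniform_sphere
        by eventually_elim (use K B A z in \<open>auto simp: abs_mult intro!: mult_mono\<close>)
    qed
  qed measurable
  also have "\<dots> = (\<integral>u. (A u)\<^sup>2 \<partial>?\<sigma>)"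
  proof -
    have "(\<integral>z. p z * (poly ?P (z \<bullet> u) * A u) \<partial>?\<sigma>) = (A u)\<^sup>2" for u
      by (simp add: mult.assoc[symmetric] A_def power2_eq_square)
    then show ?thesis by simp
  qed
  also have "\<dots> \<ge> 0" by (rule Bochner_Integration.integral_nonneg) simp
  finally show ?thesis using c by (simp add: zero_le_mult_iff H_def)
qed

text \<open>Here evenness of \<open>p\<close> enters: it removes the odd degrees, about which the
  hypothesis on the weights says nothing.\<close>

lemma zonal_transform_even_odd:
  fixes p :: "real^'n \<Rightarrow> real"
  assumes n: "CARD('n) \<ge> 2" and p: "continuous_on UNIV p" "\<And>x. p (- x) = p x" and k: "odd k"
  shows "(\<integral>y. p y * poly (gegenbauer CARD('n) k) (z \<bullet> y) \<partial>uniform_sphere) = 0"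
proof -
  let ?\<sigma> = "uniform_sphere :: (real^'n) measure"
  let ?P = "gegenbauer CARD('n) k"
  have [measurable]: "p \<in> borel_measurable borel" using p(1) by (rule borel_measurable_continuous_onI)
  have u: "orthogonal_transformation (uminus :: real^'n \<Rightarrow> real^'n)"
    by (simp add: orthogonal_transformation_def linear_iff)
  have "(\<integral>y. p y * poly ?P (z \<bullet> y) \<partial>?\<sigma>) = (\<integral>y. p (- y) * poly ?P (z \<bullet> (- y)) \<partial>?\<sigma>)"
    by (rule integral_uniform_sphere_orthogonal_transformation[OF u, symmetric]) measurable
  also have "\<dots> = - (\<integral>y. p y * poly ?P (z \<bullet> y) \<partial>?\<sigma>)"
    by (simp add: p poly_gegenbauer_uminus_odd[OF n k])
  finally show ?thesis by simp
qed

section \<open>Correlations of polynomials under a random rotation\<close>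

context random_orthogonal_matrix
begin

lemma AE_norm_mult:
  assumes "norm x = 1"
  shows "AE T in M. norm (T *v x) = 1"
  using AE_orthogonal
proof eventually_elim
  fix T :: "real^'n^'n" assume "orthogonal_matrix T"
  then have "orthogonal_transformation ((*v) T)" by (simp add: orthogonal_transformation_matrix)
  then show "norm (T *v x) = 1" using assms by (simp add: orthogonal_transformation_norm)
qed

lemma integral_mult_vector:
  fixes h :: "real^'n \<Rightarrow> real"
  assumes "norm x = 1" and [measurable]: "h \<in> borel_measurable borel"
  shows "(\<integral>T. h (T *v x) \<partial>M) = (\<integral>z. h z \<partial>uniform_sphere)"
proof -
  have "(\<integral>z. h z \<partial>uniform_sphere) = (\<integral>z. h z \<partial>distr M borel (\<lambda>T. T *v x))"
    by (simp add: distr_mult_vector[OF assms(1)])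
  also have "\<dots> = (\<integral>T. h (T *v x) \<partial>M)" by (rule integral_distr) measurable
  finally show ?thesis ..
qed

lemma integrable_correlation:
  fixes p :: "real^'n \<Rightarrow> real"
  assumes [measurable]: "p \<in> borel_measurable borel" and p: "\<And>x. norm x = 1 \<Longrightarrow> \<bar>p x\<bar> \<le> K"
    and xy: "norm x = 1" "norm y = 1"
  shows "integrable M (\<lambda>T. p (T *v x) * p (T *v y))"
proof (rule integrable_const_bound)
  show "AE T in M. norm (p (T *v x) * p (T *v y)) \<le> K * K"
    using AE_norm_mult[OF xy(1)] AE_norm_mult[OF xy(2)]
  proof eventually_elim
    fix T :: "real^'n^'n" assume "norm (T *v x) = 1" "norm (T *v y) = 1"
    then have "\<bar>p (T *v x)\<bar> \<le> K" "\<bar>p (T *v y)\<bar> \<le> K" using p by auto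
    then have "\<bar>p (T *v x)\<bar> * \<bar>p (T *v y)\<bar> \<le> K * K" by (intro mult_mono) auto
    then show "norm (p (T *v x) * p (T *v y)) \<le> K * K" by (simp add: abs_mult)
  qed
qed measurable

text \<open>Right invariance of \<open>M\<close> makes the correlation an invariant kernel. For
  fixed \<open>x\<close> it averages multiples of rotated copies of \<open>p\<close> over
  \<open>T\<close>, and all of them share the degree bound of \<open>p\<close>.\<close>

lemma correlation_poly:
  fixes p :: "real^'n \<Rightarrow> real"
  assumes n: "CARD('n) \<ge> 2" and p: "real_polynomial_function p"
  obtains g where "\<And>x y. norm x = 1 \<Longrightarrow> norm y = 1 \<Longrightarrow>
    (\<integral>T. p (T *v x) * p (T *v y) \<partial>M) = poly g (x \<bullet> y)"
proof -
  have cont: "continuous_on UNIV p"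
    using p by (simp add: continuous_on_polymonial_function real_polynomial_function_eq)
  then have [measurable]: "p \<in> borel_measurable borel" by (rule borel_measurable_continuous_onI)
  obtain K where K: "K \<ge> 0" "\<And>x. norm x = 1 \<Longrightarrow> \<bar>p x\<bar> \<le> K"
    by (rule continuous_bounded_on_sphere[OF cont]) blast
  obtain d where d: "even_poly_on_circles d p" using ex_even_poly_on_circles[OF p] by blast
  have dim: "DIM(real^'n) \<ge> 2" using n by simp
  define h where "h x y = (\<integral>T. p (T *v x) * p (T *v y) \<partial>M)" for x y
  have inv: "h (S x) (S y) = h x y" if S: "orthogonal_transformation S" for S x y
  proof -
    obtain S' where S': "orthogonal_matrix S'" "S = (\<lambda>x. S' *v x)"
      using S by (rule orthogonal_transformation_obtain_matrix)
    have "h x y = (\<integral>T. p ((T ** S') *v x) * p ((T ** S') *v y) \<partial>M)"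
      unfolding h_def by (rule integral_mult_right[OF S'(1), symmetric]) measurable
    then show ?thesis by (simp add: h_def S'(2) matrix_vector_mul_assoc)
  qed
  have poly: "even_poly_on_circles d (h x)" if x: "norm x = 1" for x
    unfolding h_def
  proof (rule even_poly_on_circles_integral)
    show "AE T in M. even_poly_on_circles d (\<lambda>y. p (T *v x) * p (T *v y))"
      using AE_orthogonal
    proof eventually_elim
      fix T :: "real^'n^'n" assume "orthogonal_matrix T"
      then have "orthogonal_transformation ((*v) T)" by (simp add: orthogonal_transformation_matrix)
      then show "even_poly_on_circles d (\<lambda>y. p (T *v x) * p (T *v y))"
        by (intro even_poly_on_circles_cmult even_poly_on_circles_orthogonal_transformation[OF d])
    qed
    show "integrable M (\<lambda>T. p (T *v x) * p (T *v y))" if "norm y = 1" for y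
      using K(2) x that by (intro integrable_correlation) auto
  qed
  obtain g where "degree g \<le> d" "\<And>x y. norm x = 1 \<Longrightarrow> norm y = 1 \<Longrightarrow> h x y = poly g (x \<bullet> y)"
    by (rule invariant_kernel_poly[OF dim, of h d]) (use inv poly in blast)+
  then show ?thesis using that[of g] by (simp add: h_def)
qed

text \<open>An orthogonal \<open>T\<close> preserves e \<bullet> y, so the integration over
  \<open>y\<close> can absorb \<open>T\<close>; what is left depends on \<open>T\<close> only
  through \<open>T *v e\<close>, which is uniform. Integrals of \<open>g\<close> thus become
  quadratic forms in \<open>p\<close>.\<close>

lemma correlation_zonal_integral:
  fixes p :: "real^'n \<Rightarrow> real" and e :: "real^'n"
  assumes p: "continuous_on UNIV p" and e: "norm e = 1"
    and g: "\<And>x y. norm x = 1 \<Longrightarrow> norm y = 1 \<Longrightarrow> (\<integral>T. p (T *v x) * p (T *v y) \<partial>M) = poly g (x \<bullet> y)"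
  shows "(\<integral>y. poly (g * r) (y \<bullet> e) \<partial>uniform_sphere)
    = (\<integral>z. p z * (\<integral>y. p y * poly r (z \<bullet> y) \<partial>uniform_sphere) \<partial>uniform_sphere)"
proof -
  let ?\<sigma> = "uniform_sphere :: (real^'n) measure"
  interpret \<sigma>: prob_space ?\<sigma> by (rule prob_space_uniform_sphere)
  have [measurable]: "p \<in> borel_measurable borel" using p by (rule borel_measurable_continuous_onI)
  obtain B where B: "B \<ge> 0" "\<And>x y :: real^'n. norm x = 1 \<Longrightarrow> norm y = 1 \<Longrightarrow> \<bar>poly r (x \<bullet> y)\<bar> \<le> B"
    by (rule poly_bounded_on_sphere) blast
  obtain K where K: "K \<ge> 0" "\<And>x. norm x = 1 \<Longrightarrow> \<bar>p x\<bar> \<le> K"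
    by (rule continuous_bounded_on_sphere[OF p]) blast
  define H where "H z = (\<integral>y. p y * poly r (z \<bullet> y) \<partial>?\<sigma>)" for z
  have [measurable]: "H \<in> borel_measurable borel" unfolding H_def[abs_def] by measurable
  have "(\<integral>y. poly (g * r) (y \<bullet> e) \<partial>?\<sigma>)
      = (\<integral>y. (\<integral>T. p (T *v e) * (p (T *v y) * poly r (e \<bullet> y)) \<partial>M) \<partial>?\<sigma>)"
  proof (rule integral_cong_AE)
    show "AE y in ?\<sigma>. poly (g * r) (y \<bullet> e) = (\<integral>T. p (T *v e) * (p (T *v y) * poly r (e \<bullet> y)) \<partial>M)"
      using AE_uniform_sphere
    proof eventually_elim
      fix y :: "real^'n" assume y: "norm y = 1"
      have "poly (g * r) (y \<bullet> e) = (\<integral>T. p (T *v e) * p (T *v y) \<partial>M) * poly r (e \<bullet> y)"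
        by (simp only: poly_mult g[OF e y] inner_commute[of y e])
      then show "poly (g * r) (y \<bullet> e) = (\<integral>T. p (T *v e) * (p (T *v y) * poly r (e \<bullet> y)) \<partial>M)"
        by (simp add: mult.assoc[symmetric])
    qed
  qed measurable
  also have "\<dots> = (\<integral>T. (\<integral>y. p (T *v e) * (p (T *v y) * poly r (e \<bullet> y)) \<partial>?\<sigma>) \<partial>M)"
  proof (rule Fubini_integral_bounded[OF prob_space_uniform_sphere prob_space_axioms])
    show "AE y in ?\<sigma>. AE T in M. \<bar>p (T *v e) * (p (T *v y) * poly r (e \<bullet> y))\<bar> \<le> K * (K * B)"
      using AE_uniform_sphere
    proof eventually_elim
      fix y :: "real^'n" assume y: "norm y = 1"
      show "AE T in M. \<bar>p (T *v e) * (p (T *v y) * poly r (e \<bullet> y))\<bar> \<le> K * (K * B)"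
        using AE_norm_mult[OF e] AE_norm_mult[OF y]
        by eventually_elim (use K B e y in \<open>auto simp: abs_mult intro!: mult_mono\<close>)
    qed
  qed measurable
  also have "\<dots> = (\<integral>T. p (T *v e) * H (T *v e) \<partial>M)"
  proof (rule integral_cong_AE)
    show "AE T in M. (\<integral>y. p (T *v e) * (p (T *v y) * poly r (e \<bullet> y)) \<partial>?\<sigma>) = p (T *v e) * H (T *v e)"
      using AE_orthogonal
    proof eventually_elim
      fix T :: "real^'n^'n" assume "orthogonal_matrix T"
      then have T: "orthogonal_transformation ((*v) T)" by (simp add: orthogonal_transformation_matrix)
      then have "e \<bullet> y = (T *v e) \<bullet> (T *v y)" for y by (simp add: orthogonal_transformation_def)
      then have "(\<integral>y. p (T *v y) * poly r (e \<bullet> y) \<partial>?\<sigma>)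
          = (\<integral>y. p (T *v y) * poly r ((T *v e) \<bullet> (T *v y)) \<partial>?\<sigma>)" by simp
      also have "\<dots> = H (T *v e)"
        unfolding H_def by (rule integral_uniform_sphere_orthogonal_transformation[OF T]) measurable
      finally show "(\<integral>y. p (T *v e) * (p (T *v y) * poly r (e \<bullet> y)) \<partial>?\<sigma>) = p (T *v e) * H (T *v e)"
        by simp
    qed
  qed measurable
  also have "\<dots> = (\<integral>z. p z * H z \<partial>?\<sigma>)" by (rule integral_mult_vector[OF e]) measurable
  finally show ?thesis by (simp add: H_def)
qed

text \<open>Integrating \<open>g\<close> against the Gegenbauer polynomial of degree
  \<open>k\<close> isolates \<open>a k\<close>: times a positive mean square it equals the form of
  \<open>zonal_form_nonneg\<close>.\<close>

lemma correlation_expansion: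
  fixes p :: "real^'n \<Rightarrow> real"
  assumes n: "CARD('n) \<ge> 2" and p: "real_polynomial_function p" "\<And>x. p (- x) = p x"
  obtains d a where "\<And>k. k \<le> d \<Longrightarrow> a k \<ge> 0" "\<And>k. k \<le> d \<Longrightarrow> odd k \<Longrightarrow> a k = 0"
    "\<And>x y. norm x = 1 \<Longrightarrow> norm y = 1 \<Longrightarrow> (\<integral>T. p (T *v x) * p (T *v y) \<partial>M)
      = (\<Sum>k\<le>d. a k * poly (gegenbauer CARD('n) k) (x \<bullet> y))"
proof -
  let ?\<sigma> = "uniform_sphere :: (real^'n) measure"
  let ?P = "gegenbauer CARD('n)" and ?I = "gegenbauer_integral CARD('n)"
  have cont: "continuous_on UNIV p"
    using p by (simp add: continuous_on_polymonial_function real_polynomial_function_eq)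
  obtain e :: "real^'n" where e: "norm e = 1" using vector_choose_size[of 1] by auto
  obtain g where g: "\<And>x y. norm x = 1 \<Longrightarrow> norm y = 1 \<Longrightarrow>
      (\<integral>T. p (T *v x) * p (T *v y) \<partial>M) = poly g (x \<bullet> y)"
    by (rule correlation_poly[OF n p(1)]) blast
  obtain a where a: "g = (\<Sum>k\<le>degree g. smult (a k) (?P k))"
    using gegenbauer_expansion[OF n order_refl, of g] by blast
  define form where "form k = (\<integral>z. p z * (\<integral>y. p y * poly (?P k) (z \<bullet> y) \<partial>?\<sigma>) \<partial>?\<sigma>)" for k
  have coeff: "form k = a k * (\<integral>u. (poly (?P k) (u \<bullet> e))\<^sup>2 \<partial>?\<sigma>)" if "k \<le> degree g" for k
  proof -
    have "form k = (\<integral>y. poly (g * ?P k) (y \<bullet> e) \<partial>?\<sigma>)"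
      unfolding form_def by (rule correlation_zonal_integral[OF cont e, symmetric]) (rule g)
    then have "?I 1 * form k = ?I (g * ?P k)"
      using gegenbauer_integral_eq_sphere[OF n e, of "g * ?P k"] by simp
    also have "\<dots> = a k * ?I (?P k * ?P k)" by (rule gegenbauer_coefficient[OF n a that])
    also have "\<dots> = ?I 1 * (a k * (\<integral>u. (poly (?P k) (u \<bullet> e))\<^sup>2 \<partial>?\<sigma>))"
      using gegenbauer_integral_eq_sphere[OF n e, of "?P k * ?P k"] by (simp add: power2_eq_square)
    finally show ?thesis using gegenbauer_integral_1_nonzero[OF n] by simp
  qed
  show ?thesis
  proof (rule that[of "degree g" a])
    fix k assume k: "k \<le> degree g"
    have "form k \<ge> 0" unfolding form_def by (rule zonal_form_nonneg[OF n cont])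
    then show "a k \<ge> 0"
      using coeff[OF k] gegenbauer_sphere_square_pos[OF n e, of k] by (simp add: zero_le_mult_iff)
    assume "odd k"
    then have "form k = 0"
      unfolding form_def by (simp add: zonal_transform_even_odd[OF n cont p(2)])
    then show "a k = 0"
      using coeff[OF k] gegenbauer_sphere_square_pos[OF n e, of k] by simp
  next
    fix x y :: "real^'n" assume "norm x = 1" "norm y = 1"
    then show "(\<integral>T. p (T *v x) * p (T *v y) \<partial>M) = (\<Sum>k\<le>degree g. a k * poly (?P k) (x \<bullet> y))"
      using g arg_cong[OF a, of "\<lambda>q. poly q (x \<bullet> y)"] by (simp add: poly_sum)
  qed
qed

text \<open>Multiply the hypothesis in degree \<open>k\<close> by the coefficient \<open>a k\<close>
  and sum; since Gegenbauer polynomials are 1 at 1, the right-hand ones add up to the correlation of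
  \<open>e\<close> with itself. The abstract index set lets the pair belonging to
  \<open>w\<^sub>0\<close> stand beside those of the configuration.\<close>

lemma correlation_inequality_poly:
  fixes p :: "real^'n \<Rightarrow> real" and w :: "'i \<Rightarrow> real"
  assumes n: "CARD('n) \<ge> 2" and p: "real_polynomial_function p" "\<And>x. p (- x) = p x"
    and uv: "\<And>j. j \<in> J \<Longrightarrow> norm (u j) = 1 \<and> norm (v j) = 1"
    and ineq: "\<And>k. even k \<Longrightarrow> (\<Sum>j\<in>J. w j * poly (gegenbauer CARD('n) k) (u j \<bullet> v j)) \<ge> 1"
    and e: "norm e = 1"
  shows "(\<integral>T. p (T *v e) * p (T *v e) \<partial>M) \<le> (\<Sum>j\<in>J. w j * (\<integral>T. p (T *v u j) * p (T *v v j) \<partial>M))"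
proof -
  let ?P = "gegenbauer CARD('n)"
  obtain d a where a: "\<And>k. k \<le> d \<Longrightarrow> a k \<ge> 0" "\<And>k. k \<le> d \<Longrightarrow> odd k \<Longrightarrow> a k = 0"
    and exp: "\<And>x y. norm x = 1 \<Longrightarrow> norm y = 1 \<Longrightarrow> (\<integral>T. p (T *v x) * p (T *v y) \<partial>M)
      = (\<Sum>k\<le>d. a k * poly (?P k) (x \<bullet> y))"
    by (rule correlation_expansion[OF n p]) blast
  have "(\<integral>T. p (T *v e) * p (T *v e) \<partial>M) = (\<Sum>k\<le>d. a k * 1)"
    using e by (simp add: exp norm_eq_1 poly_gegenbauer_1[OF n])
  also have "\<dots> \<le> (\<Sum>k\<le>d. a k * (\<Sum>j\<in>J. w j * poly (?P k) (u j \<bullet> v j)))"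
  proof (rule sum_mono)
    fix k assume k: "k \<in> {..d}"
    show "a k * 1 \<le> a k * (\<Sum>j\<in>J. w j * poly (?P k) (u j \<bullet> v j))"
    proof (cases "even k")
      case True
      then show ?thesis using a(1) k ineq by (intro mult_left_mono) auto
    qed (use a(2) k in simp)
  qed
  also have "\<dots> = (\<Sum>j\<in>J. w j * (\<Sum>k\<le>d. a k * poly (?P k) (u j \<bullet> v j)))"
    unfolding sum_distrib_left by (subst sum.swap) (simp add: mult.left_commute)
  also have "\<dots> = (\<Sum>j\<in>J. w j * (\<integral>T. p (T *v u j) * p (T *v v j) \<partial>M))"
    using uv by (intro sum.cong) (auto simp: exp)
  finally show ?thesis .
qed

end

section \<open>Approximation of the indicator function\<close>

text \<open>Regularity gives a compact set inside and an open set around \<open>A\<close>, Urysohn a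
  continuous function between them, Stone-Weierstrass a polynomial near it on the sphere. Averaging
  over x and -x costs nothing, as \<open>A\<close> is symmetric. The bound 2 is independent of
  \<open>\<epsilon>\<close>, as products will require.\<close>

lemma real_polynomial_function_even_approx:
  fixes A :: "'a::euclidean_space set"
  assumes [measurable]: "A \<in> sets borel" and sym: "\<And>x. - x \<in> A \<longleftrightarrow> x \<in> A" and \<epsilon>: "0 < \<epsilon>" "\<epsilon> \<le> 1"
  obtains p where "real_polynomial_function p" "\<And>x. p (- x) = p x" "\<And>x. norm x = 1 \<Longrightarrow> \<bar>p x\<bar> \<le> 2"
    "(\<integral>x. \<bar>indicator A x - p x\<bar> \<partial>uniform_sphere) \<le> \<epsilon>"
proof -
  let ?\<sigma> = "uniform_sphere :: 'a measure"
  interpret \<sigma>: prob_space ?\<sigma> by (rule prob_space_uniform_sphere)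
  have u: "orthogonal_transformation (uminus :: 'a \<Rightarrow> 'a)" by (simp add: orthogonal_transformation_def linear_iff)
  have fin: "emeasure ?\<sigma> (space ?\<sigma>) \<noteq> \<infinity>" by simp
  \<comment> \<open>Two thirds of \<open>\<epsilon>\<close> go to the measure of
    \<open>U - K\<close>, one third to the uniform error of the polynomial.\<close>
  define \<delta> where "\<delta> = \<epsilon> / 3"
  have \<delta>: "\<delta> > 0" using \<epsilon> by (simp add: \<delta>_def)
  \<comment> \<open>The case split keeps \<open>\<sigma>.prob A - \<delta>\<close> nonnegative where
    it becomes an \<open>ennreal\<close>; for small \<open>A\<close> the empty set serves.\<close>
  have "\<exists>K. compact K \<and> K \<subseteq> A \<and> \<sigma>.prob A < \<sigma>.prob K + \<delta>"
  proof (cases "\<sigma>.prob A < \<delta>")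
    case False
    then have "ennreal (\<sigma>.prob A - \<delta>) < emeasure ?\<sigma> A"
      using \<delta> by (auto simp: \<sigma>.emeasure_eq_measure ennreal_less_iff)
    also have "emeasure ?\<sigma> A = (SUP K\<in>{K. K \<subseteq> A \<and> compact K}. emeasure ?\<sigma> K)"
      using fin by (intro inner_regular) auto
    finally obtain K where "K \<subseteq> A" "compact K" "ennreal (\<sigma>.prob A - \<delta>) < emeasure ?\<sigma> K"
      by (auto simp: less_SUP_iff)
    then show ?thesis
      using False by (intro exI[of _ K]) (auto simp: \<sigma>.emeasure_eq_measure ennreal_less_iff)
  qed (intro exI[of _ "{}"], simp)
  then obtain K where K: "compact K" "K \<subseteq> A" "\<sigma>.prob A < \<sigma>.prob K + \<delta>" by blast
  have "(INF U\<in>{U. A \<subseteq> U \<and> open U}. emeasure ?\<sigma> U) = emeasure ?\<sigma> A"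
    using fin by (intro outer_regular[symmetric]) auto
  also have "\<dots> < ennreal (\<sigma>.prob A + \<delta>)"
    using \<delta> by (auto simp: \<sigma>.emeasure_eq_measure ennreal_less_iff)
  finally obtain U where "open U" "A \<subseteq> U" "emeasure ?\<sigma> U < ennreal (\<sigma>.prob A + \<delta>)"
    by (auto simp: INF_less_iff)
  then have U: "open U" "A \<subseteq> U" "\<sigma>.prob U < \<sigma>.prob A + \<delta>"
    by (auto simp: \<sigma>.emeasure_eq_measure ennreal_less_iff)
  have "closed K" using K(1) by (rule compact_imp_closed)
  moreover have "closed (- U)" using U(1) by (simp add: closed_def)
  moreover have "K \<inter> - U = {}" using K U by auto
  ultimately obtain f :: "'a \<Rightarrow> real" where f: "continuous_on UNIV f" "\<And>x. f x \<in> closed_segment 1 0"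
    "\<And>x. x \<in> K \<Longrightarrow> f x = 1" "\<And>x. x \<in> - U \<Longrightarrow> f x = 0"
    using Urysohn[of K "- U" 1 "0::real"] by metis
  have f01: "0 \<le> f x" "f x \<le> 1" for x using f(2)[of x] by (auto simp: closed_segment_eq_real_ivl)
  obtain g where g: "real_polynomial_function g" "\<And>x. x \<in> sphere 0 1 \<Longrightarrow> \<bar>f x - g x\<bar> < \<delta>"
    using Stone_Weierstrass_real_polynomial_function[of "sphere 0 1" f \<delta>] \<delta> continuous_on_subset[OF f(1)]
    by auto
  have contg: "continuous_on UNIV g"
    using g by (simp add: continuous_on_polymonial_function real_polynomial_function_eq)
  then have [measurable]: "g \<in> borel_measurable borel" by (rule borel_measurable_continuous_onI)
  have [measurable]: "K \<in> sets borel" "U \<in> sets borel"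
    using K(1) U(1) by (auto intro: borel_compact)
  define p where "p x = (g x + g (- x)) / 2" for x
  have pb: "\<bar>g x\<bar> \<le> 2" if "norm x = 1" for x
  proof -
    have "\<bar>f x - g x\<bar> < 1" using g(2)[of x] that \<epsilon> by (simp add: \<delta>_def)
    then show ?thesis using f01[of x] by linarith
  qed
  have "real_polynomial_function (\<lambda>x. g (- x))"
    using real_polynomial_function_compose[OF polynomial_function_bounded_linear[OF bounded_linear_minus[OF bounded_linear_ident]] g(1)]
    by (simp add: o_def)
  then have "real_polynomial_function p"
    unfolding p_def[abs_def] using g(1) by (intro real_polynomial_function_divide real_polynomial_function.intros(3))
  moreover have "p (- x) = p x" for x by (simp add: p_def add.commute)
  moreover have "\<bar>p x\<bar> \<le> 2" if "norm x = 1" for x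
    using pb[of x] pb[of "- x"] that by (simp add: p_def)
  moreover have "(\<integral>x. \<bar>indicator A x - p x\<bar> \<partial>?\<sigma>) \<le> \<epsilon>"
  proof -
    have ind: "integrable ?\<sigma> (indicator C :: 'a \<Rightarrow> real)" if "C \<in> sets borel" for C
      using that by (intro \<sigma>.integrable_const_bound[where B = 1]) auto
    have int: "integrable ?\<sigma> (\<lambda>x. \<bar>indicator A x - h x\<bar>)" if "continuous_on UNIV h" for h :: "'a \<Rightarrow> real"
      using integrable_uniform_sphere_continuous[OF that]
      by (intro Bochner_Integration.integrable_abs Bochner_Integration.integrable_diff ind) auto
    have contg': "continuous_on UNIV (\<lambda>x. g (- x))"
      using contg by (intro continuous_on_compose2[OF contg]) (auto intro: continuous_intros)
    have g\<epsilon>: "(\<integral>x. \<bar>indicator A x - g x\<bar> \<partial>?\<sigma>) \<le> \<epsilon>"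
    proof -
      have "(\<integral>x. \<bar>indicator A x - g x\<bar> \<partial>?\<sigma>) \<le> (\<integral>x. indicator (U - K) x + \<delta> \<partial>?\<sigma>)"
      proof (rule integral_mono_AE[OF int[OF contg]])
        show "integrable ?\<sigma> (\<lambda>x. indicator (U - K) x + \<delta>)"
          by (intro Bochner_Integration.integrable_add ind) auto
        show "AE x in ?\<sigma>. \<bar>indicator A x - g x\<bar> \<le> indicator (U - K) x + \<delta>"
          using AE_uniform_sphere
        proof eventually_elim
          fix x :: 'a assume "norm x = 1"
          then have "\<bar>f x - g x\<bar> < \<delta>" using g(2) by simp
          moreover have "\<bar>indicator A x - f x\<bar> \<le> indicator (U - K) x"
            using f01[of x] f(3,4)[of x] K(2) U(2) by (auto simp: indicator_def)
          ultimately show "\<bar>indicator A x - g x\<bar> \<le> indicator (U - K) x + \<delta>" by linarith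
        qed
      qed
      also have "\<dots> = \<sigma>.prob (U - K) + \<delta>"
        by (subst Bochner_Integration.integral_add)
          (auto intro!: ind simp: \<sigma>.prob_space[simplified])
      also have "\<sigma>.prob (U - K) = \<sigma>.prob U - \<sigma>.prob K"
        using K U by (intro \<sigma>.finite_measure_Diff) auto
      finally show ?thesis using K(3) U(3) by (simp add: \<delta>_def)
    qed
    have "(\<integral>x. \<bar>indicator A x - p x\<bar> \<partial>?\<sigma>)
        \<le> (\<integral>x. (\<bar>indicator A x - g x\<bar> + \<bar>indicator A x - g (- x)\<bar>) / 2 \<partial>?\<sigma>)"
    proof (rule integral_mono)
      show "integrable ?\<sigma> (\<lambda>x. \<bar>indicator A x - p x\<bar>)"
        unfolding p_def by (intro int continuous_intros contg contg') auto
      show "integrable ?\<sigma> (\<lambda>x. (\<bar>indicator A x - g x\<bar> + \<bar>indicator A x - g (- x)\<bar>) / 2)"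
        using int[OF contg] int[OF contg'] by auto
    qed (auto simp: p_def field_simps)
    also have "\<dots> = ((\<integral>x. \<bar>indicator A x - g x\<bar> \<partial>?\<sigma>) + (\<integral>x. \<bar>indicator A x - g (- x)\<bar> \<partial>?\<sigma>)) / 2"
      using int[OF contg] int[OF contg'] by simp
    also have "(\<integral>x. \<bar>indicator A x - g (- x)\<bar> \<partial>?\<sigma>) = (\<integral>x. \<bar>indicator A (- x) - g (- x)\<bar> \<partial>?\<sigma>)"
      by (simp add: indicator_def sym)
    also have "\<dots> = (\<integral>x. \<bar>indicator A x - g x\<bar> \<partial>?\<sigma>)"
      by (rule integral_uniform_sphere_orthogonal_transformation[OF u]) measurable
    finally show ?thesis using g\<epsilon> by simp
  qed
  ultimately show ?thesis using that by blast
qed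

context random_orthogonal_matrix
begin

text \<open>ab - cd = a (b - d) + d (a - c), where a is an indicator and d is bounded by 2. As
  \<open>T *v x\<close> and \<open>T *v y\<close> are uniform, both differences have mean at most
  \<open>\<epsilon>\<close> in absolute value, whence 1 + 2 = 3.\<close>

lemma correlation_approx:
  fixes A :: "(real^'n) set" and p :: "real^'n \<Rightarrow> real"
  assumes [measurable]: "A \<in> sets borel" "p \<in> borel_measurable borel"
    and p: "\<And>x. norm x = 1 \<Longrightarrow> \<bar>p x\<bar> \<le> 2" "(\<integral>x. \<bar>indicator A x - p x\<bar> \<partial>uniform_sphere) \<le> \<epsilon>"
    and xy: "norm x = 1" "norm y = 1"
  shows "\<bar>(\<integral>T. indicator A (T *v x) * indicator A (T *v y) \<partial>M) - (\<integral>T. p (T *v x) * p (T *v y) \<partial>M)\<bar> \<le> 3 * \<epsilon>"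
proof -
  have bdd: "integrable M f" if [measurable]: "f \<in> borel_measurable M" and "AE T in M. \<bar>f T\<bar> \<le> C" for f :: "_ \<Rightarrow> real" and C
    using that by (intro integrable_const_bound[of _ C]) auto
  have pT: "AE T in M. \<bar>p (T *v z)\<bar> \<le> 2" if "norm z = 1" for z
    using AE_norm_mult[OF that] by eventually_elim (rule p)
  have i1: "integrable M (\<lambda>T. indicator A (T *v x) * indicator A (T *v y) :: real)"
    by (rule bdd[of _ 1]) (auto simp: indicator_def)
  have i2: "integrable M (\<lambda>T. p (T *v x) * p (T *v y))"
    using p xy by (intro integrable_correlation) auto
  have i3: "integrable M (\<lambda>T. \<bar>indicator A (T *v z) - p (T *v z)\<bar>)" if "norm z = 1" for z
  proof (rule bdd[of _ 3])
    show "AE T in M. \<bar>\<bar>indicator A (T *v z) - p (T *v z)\<bar>\<bar> \<le> 3"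
      using pT[OF that] by eventually_elim (auto simp: indicator_def)
  qed measurable
  have e: "(\<integral>T. \<bar>indicator A (T *v z) - p (T *v z)\<bar> \<partial>M) \<le> \<epsilon>" if "norm z = 1" for z
    using p(2) by (subst integral_mult_vector[OF that]) auto
  have "\<bar>(\<integral>T. indicator A (T *v x) * indicator A (T *v y) \<partial>M) - (\<integral>T. p (T *v x) * p (T *v y) \<partial>M)\<bar>
      = \<bar>\<integral>T. indicator A (T *v x) * indicator A (T *v y) - p (T *v x) * p (T *v y) \<partial>M\<bar>"
    by (simp add: Bochner_Integration.integral_diff[OF i1 i2])
  also have "\<dots> \<le> (\<integral>T. \<bar>indicator A (T *v x) * indicator A (T *v y) - p (T *v x) * p (T *v y)\<bar> \<partial>M)"
    by (rule integral_abs_bound)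
  also have "\<dots> \<le> (\<integral>T. \<bar>indicator A (T *v y) - p (T *v y)\<bar> + 2 * \<bar>indicator A (T *v x) - p (T *v x)\<bar> \<partial>M)"
  proof (rule integral_mono_AE)
    show "AE T in M. \<bar>indicator A (T *v x) * indicator A (T *v y) - p (T *v x) * p (T *v y)\<bar>
        \<le> \<bar>indicator A (T *v y) - p (T *v y)\<bar> + 2 * \<bar>indicator A (T *v x) - p (T *v x)\<bar>"
      using pT[OF xy(2)]
    proof eventually_elim
      fix T :: "real^'n^'n" assume py: "\<bar>p (T *v y)\<bar> \<le> 2"
      define a b c d where "a = (indicator A (T *v x) :: real)" and "b = (indicator A (T *v y) :: real)"
        and "c = p (T *v x)" and "d = p (T *v y)"
      have "\<bar>a * b - c * d\<bar> = \<bar>a * (b - d) + d * (a - c)\<bar>" by (simp add: algebra_simps)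
      also have "\<dots> \<le> \<bar>a\<bar> * \<bar>b - d\<bar> + \<bar>d\<bar> * \<bar>a - c\<bar>" by (simp add: abs_mult[symmetric] abs_triangle_ineq)
      also have "\<dots> \<le> 1 * \<bar>b - d\<bar> + 2 * \<bar>a - c\<bar>"
        using py by (intro add_mono mult_right_mono) (auto simp: a_def d_def indicator_def)
      finally show "\<bar>indicator A (T *v x) * indicator A (T *v y) - p (T *v x) * p (T *v y)\<bar>
        \<le> \<bar>indicator A (T *v y) - p (T *v y)\<bar> + 2 * \<bar>indicator A (T *v x) - p (T *v x)\<bar>"
        by (simp add: a_def b_def c_def d_def)
    qed
  qed (use i1 i2 i3 xy in auto)
  also have "\<dots> \<le> 3 * \<epsilon>" using e[OF xy(1)] e[OF xy(2)] i3 xy by simp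
  finally show ?thesis .
qed

text \<open>Each correlation moves by at most 3 \<open>\<epsilon>\<close> when a polynomial replaces
  the indicator, so the inequality for polynomials passes to \<open>A\<close>. For equal vectors the
  product of indicators is a single indicator, which gives the measure on the left.\<close>

lemma correlation_inequality:
  fixes A :: "(real^'n) set" and w :: "'i \<Rightarrow> real"
  assumes n: "CARD('n) \<ge> 2" and A[measurable]: "A \<in> sets borel" and sym: "\<And>x. - x \<in> A \<longleftrightarrow> x \<in> A"
    and uv: "\<And>j. j \<in> J \<Longrightarrow> norm (u j) = 1 \<and> norm (v j) = 1"
    and ineq: "\<And>k. even k \<Longrightarrow> (\<Sum>j\<in>J. w j * poly (gegenbauer CARD('n) k) (u j \<bullet> v j)) \<ge> 1"
  shows "measure uniform_sphere A \<le> (\<Sum>j\<in>J. w j * (\<integral>T. indicator A (T *v u j) * indicator A (T *v v j) \<partial>M))"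
proof -
  let ?F = "\<lambda>x y. \<integral>T. indicator A (T *v x) * indicator A (T *v y) \<partial>M :: real"
  obtain e :: "real^'n" where e: "norm e = 1" using vector_choose_size[of 1] by auto
  have F: "?F e e = measure uniform_sphere A"
  proof -
    have "?F e e = (\<integral>T. indicator A (T *v e) \<partial>M)"
      by (intro Bochner_Integration.integral_cong) (auto simp: indicator_def)
    also have "\<dots> = (\<integral>z. indicator A z \<partial>uniform_sphere)"
      by (rule integral_mult_vector[OF e]) measurable
    finally show ?thesis by simp
  qed
  \<comment> \<open>Error per unit of \<open>\<epsilon>\<close>: 3 from the left side and 3 times
    the absolute weight from each term on the right.\<close>
  define C where "C = 3 + 3 * (\<Sum>j\<in>J. \<bar>w j\<bar>)"
  have C: "C > 0" unfolding C_def by (intro add_pos_nonneg mult_nonneg_nonneg sum_nonneg) auto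
  have approx: "?F e e \<le> (\<Sum>j\<in>J. w j * ?F (u j) (v j)) + C * \<epsilon>" if \<epsilon>: "0 < \<epsilon>" "\<epsilon> \<le> 1" for \<epsilon>
  proof -
    obtain p where p: "real_polynomial_function p" "\<And>x. p (- x) = p x" "\<And>x. norm x = 1 \<Longrightarrow> \<bar>p x\<bar> \<le> 2"
      "(\<integral>x. \<bar>indicator A x - p x\<bar> \<partial>(uniform_sphere :: (real^'n) measure)) \<le> \<epsilon>"
      by (rule real_polynomial_function_even_approx[OF A sym \<epsilon>]) blast
    have "p \<in> borel_measurable borel"
      using p(1) by (intro borel_measurable_continuous_onI)
        (simp add: continuous_on_polymonial_function real_polynomial_function_eq)
    note pmeas = this
    let ?G = "\<lambda>x y. \<integral>T. p (T *v x) * p (T *v y) \<partial>M"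
    have ap: "\<bar>?F x y - ?G x y\<bar> \<le> 3 * \<epsilon>" if "norm x = 1" "norm y = 1" for x y
      by (rule correlation_approx[OF A pmeas p(3) p(4) that])
    have "?F e e \<le> ?G e e + 3 * \<epsilon>" using ap[OF e e] by linarith
    also have "?G e e \<le> (\<Sum>j\<in>J. w j * ?G (u j) (v j))"
      by (rule correlation_inequality_poly[OF n p(1,2) uv ineq e])
    also have "\<dots> \<le> (\<Sum>j\<in>J. w j * ?F (u j) (v j) + \<bar>w j\<bar> * (3 * \<epsilon>))"
    proof (rule sum_mono)
      fix j assume "j \<in> J"
      then have "\<bar>?F (u j) (v j) - ?G (u j) (v j)\<bar> \<le> 3 * \<epsilon>" using uv ap by blast
      then have "\<bar>w j * (?G (u j) (v j) - ?F (u j) (v j))\<bar> \<le> \<bar>w j\<bar> * (3 * \<epsilon>)"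
        unfolding abs_mult by (intro mult_left_mono) (auto simp: abs_minus_commute)
      then show "w j * ?G (u j) (v j) \<le> w j * ?F (u j) (v j) + \<bar>w j\<bar> * (3 * \<epsilon>)"
        by (simp add: right_diff_distrib)
    qed
    also have "\<dots> = (\<Sum>j\<in>J. w j * ?F (u j) (v j)) + (\<Sum>j\<in>J. \<bar>w j\<bar>) * (3 * \<epsilon>)"
      by (simp add: sum.distrib sum_distrib_right)
    finally show ?thesis by (simp add: C_def algebra_simps)
  qed
  have "?F e e \<le> (\<Sum>j\<in>J. w j * ?F (u j) (v j))"
  proof (rule field_le_epsilon)
    fix \<delta> :: real assume "\<delta> > 0"
    have "?F e e \<le> (\<Sum>j\<in>J. w j * ?F (u j) (v j)) + C * min 1 (\<delta> / C)"
      using C \<open>\<delta> > 0\<close> by (intro approx) auto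
    also have "C * min 1 (\<delta> / C) \<le> \<delta>" using C by (simp add: min_def field_simps)
    finally show "?F e e \<le> (\<Sum>j\<in>J. w j * ?F (u j) (v j)) + \<delta>" by simp
  qed
  then show ?thesis by (simp only: F)
qed

end

section \<open>The bound\<close>

lemma integrable_prod_indicator:
  fixes A :: "(real^'n) set"
  assumes "random_orthogonal_matrix M" and [measurable]: "A \<in> sets borel" and "finite Y"
  shows "integrable M (\<lambda>T. \<Prod>y\<in>Y. indicator A (T *v y) :: real)"
proof -
  interpret random_orthogonal_matrix M by fact
  show ?thesis
  proof (rule integrable_const_bound[where B = 1])
    show "AE T in M. norm (\<Prod>y\<in>Y. indicator A (T *v y) :: real) \<le> 1"
      by (intro AE_I2) (auto simp: abs_prod indicator_def intro!: prod_le_1)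
  qed measurable
qed

text \<open>Right invariance absorbs \<open>S\<close> into \<open>T\<close>, so a finite
  configuration and its congruent copy land in \<open>A\<close> with the same probability.\<close>

lemma (in random_orthogonal_matrix) integral_prod_indicator_image:
  fixes A :: "(real^'n) set"
  assumes [measurable]: "A \<in> sets borel" and S: "orthogonal_transformation S"
  shows "(\<integral>T. (\<Prod>z\<in>S ` Y. indicator A (T *v z) :: real) \<partial>M) = (\<integral>T. (\<Prod>y\<in>Y. indicator A (T *v y)) \<partial>M)"
proof -
  obtain S' where S': "orthogonal_matrix S'" "S = (\<lambda>x. S' *v x)"
    using S by (rule orthogonal_transformation_obtain_matrix)
  have "inj_on S Y" using orthogonal_transformation_inj[OF S] by (rule inj_on_subset) simp
  then have "(\<Prod>z\<in>S ` Y. indicator A (T *v z) :: real) = (\<Prod>y\<in>Y. indicator A ((T ** S') *v y))" for T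
    by (simp add: prod.reindex S'(2) matrix_vector_mul_assoc)
  then have "(\<integral>T. (\<Prod>z\<in>S ` Y. indicator A (T *v z) :: real) \<partial>M)
      = (\<integral>T. (\<Prod>y\<in>Y. indicator A ((T ** S') *v y)) \<partial>M)" by simp
  also have "\<dots> = (\<integral>T. (\<Prod>y\<in>Y. indicator A (T *v y)) \<partial>M)"
    by (rule integral_mult_right[OF S'(1)]) measurable
  finally show ?thesis .
qed

lemma (in random_orthogonal_matrix) measure_le_if_avoids_orthogonality:
  fixes x :: "nat \<Rightarrow> real^'n" and w :: "nat \<Rightarrow> nat \<Rightarrow> real" and A :: "(real^'n) set"
  assumes n: "CARD('n) \<ge> 2"
    and x: "\<And>i. i \<in> {1..N} \<Longrightarrow> x i \<in> sphere 0 1"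
    and ineq: "\<And>k. even k \<Longrightarrow>
           w\<^sub>0 * poly (gegenbauer CARD('n) k) 0
           + (\<Sum>(i, j) | 1 \<le> i \<and> i \<le> j \<and> j \<le> N.
                w i j * poly (gegenbauer CARD('n) k) (x i \<bullet> x j)) \<ge> 1"
    and ind: "\<And>I. orth_graph_independent N x I \<Longrightarrow>
           q\<^sub>1
           - (\<Sum>(i, j) | 1 \<le> i \<and> i \<le> j \<and> j \<le> N \<and>
                antipodal_pair (x i) \<in> I \<and> antipodal_pair (x j) \<in> I. w i j)
           + (\<Sum>(Y, Z) | (Y, Z) \<in> congruent_pairs N x \<and> Y \<subseteq> I. s Y Z)
           - (\<Sum>(Y, Z) | (Y, Z) \<in> congruent_pairs N x \<and> Z \<subseteq> I. s Y Z) \<ge> 0"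
    and A[measurable]: "A \<in> sets borel" and sym: "\<And>x. - x \<in> A \<longleftrightarrow> x \<in> A"
    and avoid: "avoids_orthogonality A"
  shows "measure uniform_sphere A \<le> q\<^sub>1"
proof -
  let ?P = "gegenbauer CARD('n)"
  define D where "D = {(i, j). 1 \<le> i \<and> i \<le> j \<and> j \<le> N}"
  have finD: "finite D" by (rule finite_subset[of _ "{1..N} \<times> {1..N}"]) (auto simp: D_def)
  have xD: "norm (x i) = 1" "norm (x j) = 1" if "(i, j) \<in> D" for i j
    using that x[of i] x[of j] by (auto simp: D_def)
  define F :: "real^'n \<Rightarrow> real^'n \<Rightarrow> real" where
    "F y z = (\<integral>T. indicator A (T *v y) * indicator A (T *v z) \<partial>M)" for y z
  have notboth: "\<not> (T *v y \<in> A \<and> T *v z \<in> A)" if "orthogonal_matrix T" "y \<bullet> z = 0" for T :: "real^'n^'n" and y z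
  proof -
    have "orthogonal_transformation ((*v) T)" using that by (simp add: orthogonal_transformation_matrix)
    then have "(T *v y) \<bullet> (T *v z) = 0" using that by (simp add: orthogonal_transformation_def)
    then show ?thesis using avoid by (auto simp: avoids_orthogonality_def)
  qed
  obtain e :: "real^'n" where e: "norm e = 1" using vector_choose_size[of 1] by auto
  have dim: "DIM(real^'n) \<ge> 2" using n by simp
  obtain f where f: "norm f = 1" "e \<bullet> f = 0" using ex_orthogonal_unit_vector[OF e dim] by blast
  \<comment> \<open>\<open>T\<close> keeps the pair orthogonal almost surely, and \<open>A\<close>
    contains no orthogonal pair.\<close>
  have "F e f = 0"
    unfolding F_def
  proof (rule integral_eq_zero_AE)
    show "AE T in M. indicator A (T *v e) * indicator A (T *v f) = (0::real)"
      using AE_orthogonal by eventually_elim (use notboth f in \<open>auto simp: indicator_def\<close>)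
  qed
  have le: "measure uniform_sphere A \<le> (\<Sum>(i, j)\<in>D. w i j * F (x i) (x j))"
  proof -
    \<comment> \<open>\<open>None\<close> carries the pair \<open>e\<close>, \<open>f\<close> with
      weight \<open>w\<^sub>0\<close>; \<open>Some\<close> carries the pairs of the
      configuration.\<close>
    define J where "J = insert None (Some ` D)"
    define u where "u = case_option e (\<lambda>(i :: nat, j :: nat). x i)"
    define v where "v = case_option f (\<lambda>(i :: nat, j :: nat). x j)"
    define w' where "w' = case_option w\<^sub>0 (\<lambda>(i, j). w i j)"
    have sumJ: "(\<Sum>j\<in>J. h j) = h None + (\<Sum>ij\<in>D. h (Some ij))" for h :: "_ \<Rightarrow> real"
      using finD by (simp add: J_def sum.reindex)
    have "measure uniform_sphere A
        \<le> (\<Sum>j\<in>J. w' j * (\<integral>T. indicator A (T *v u j) * indicator A (T *v v j) \<partial>M))"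
    proof (rule correlation_inequality[OF n A sym])
      show "norm (u j) = 1 \<and> norm (v j) = 1" if "j \<in> J" for j
        using that e f xD by (auto simp: J_def u_def v_def)
      show "(\<Sum>j\<in>J. w' j * poly (?P k) (u j \<bullet> v j)) \<ge> 1" if "even k" for k
        using ineq[OF that] f
        by (simp add: sumJ w'_def u_def v_def D_def case_prod_unfold)
    qed
    also have "\<dots> = (\<Sum>(i, j)\<in>D. w i j * F (x i) (x j))"
      using \<open>F e f = 0\<close> by (simp add: sumJ w'_def u_def v_def F_def case_prod_unfold)
    finally show ?thesis .
  qed
  define CP where "CP = congruent_pairs N x"
  have finCP: "finite CP" by (simp add: CP_def finite_congruent_pairs)
  have verts: "fst YZ \<subseteq> orth_graph_verts N x" "snd YZ \<subseteq> orth_graph_verts N x" if "YZ \<in> CP" for YZ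
    using that by (auto simp: CP_def congruent_pairs_def)
  \<comment> \<open>The indicator of \<open>Y \<subseteq> I T\<close>, written over the points of
    the union so that a congruence acts by reindexing.\<close>
  define \<psi> :: "(real^'n) set set \<Rightarrow> real^'n^'n \<Rightarrow> real" where
    "\<psi> Y T = (\<Prod>y\<in>\<Union>Y. indicator A (T *v y))" for Y T
  have fin: "finite (\<Union>Y)" if "Y \<subseteq> orth_graph_verts N x" for Y
  proof (rule finite_Union)
    show "finite Y" using that by (rule finite_subset) (simp add: orth_graph_verts_def)
    show "finite v" if "v \<in> Y" for v
      using that \<open>Y \<subseteq> orth_graph_verts N x\<close> by (auto simp: orth_graph_verts_def antipodal_pair_def)
  qed
  have int\<psi>: "integrable M (\<psi> Y)" if "Y \<subseteq> orth_graph_verts N x" for Y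
    unfolding \<psi>_def by (rule integrable_prod_indicator[OF random_orthogonal_matrix_axioms A fin[OF that]])
  have E\<psi>: "(\<integral>T. \<psi> Y T \<partial>M) = (\<integral>T. \<psi> Z T \<partial>M)" if YZ: "(Y, Z) \<in> CP" for Y Z
  proof -
    obtain S where S: "orthogonal_transformation S" "(\<lambda>v. S ` v) ` Y = Z"
      using YZ by (auto simp: CP_def congruent_pairs_def geom_congruent_def)
    then have "\<Union>Z = S ` \<Union>Y" by auto
    then show ?thesis unfolding \<psi>_def using integral_prod_indicator_image[OF A S(1)] by metis
  qed
  \<comment> \<open>The random independent set. Since \<open>A\<close> is symmetric, one of two
    antipodal points decides, see \<open>memI\<close>.\<close>
  define I where "I T = {v \<in> orth_graph_verts N x. \<forall>y\<in>v. T *v y \<in> A}" for T :: "real^'n^'n"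
  have \<psi>: "\<psi> Y T = (if Y \<subseteq> I T then 1 else 0)" if Y: "Y \<subseteq> orth_graph_verts N x" for Y T
  proof (cases "Y \<subseteq> I T")
    case True
    then have "T *v y \<in> A" if "y \<in> \<Union>Y" for y using that by (auto simp: I_def)
    then show ?thesis using True by (simp add: \<psi>_def)
  next
    case False
    then obtain y where y: "y \<in> \<Union>Y" "T *v y \<notin> A" using Y by (auto simp: I_def)
    have "\<psi> Y T = 0"
      unfolding \<psi>_def by (rule prod_zero[OF fin[OF Y]]) (rule bexI[OF _ y(1)], simp add: y(2))
    then show ?thesis using False by simp
  qed
  have memI: "antipodal_pair (x i) \<in> I T \<longleftrightarrow> T *v x i \<in> A" if "i \<in> {1..N}" for i T
  proof -
    have "T *v (- x i) = - (T *v x i)" by (simp add: matrix_vector_mult_def vec_eq_iff sum_negf)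
    then show ?thesis using that by (auto simp: I_def orth_graph_verts_def antipodal_pair_def sym)
  qed
  \<comment> \<open>The left side of the second hypothesis at \<open>I T\<close>, with restricted
    sums turned into full sums against indicators so that the expectation can be taken term by
    term.\<close>
  define \<Phi> where "\<Phi> T = q\<^sub>1 - (\<Sum>(i, j)\<in>D. w i j * (indicator A (T *v x i) * indicator A (T *v x j)))
      + (\<Sum>(Y, Z)\<in>CP. s Y Z * (\<psi> Y T - \<psi> Z T))" for T
  have "AE T in M. \<Phi> T \<ge> 0"
    using AE_orthogonal
  proof eventually_elim
    fix T :: "real^'n^'n" assume T: "orthogonal_matrix T"
    have indep: "orth_graph_independent N x (I T)"
      unfolding orth_graph_independent_def
    proof (intro conjI ballI notI)
      fix a b assume a: "a \<in> I T" and b: "b \<in> I T" and "{a, b} \<in> orth_graph_edges N x"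
      then obtain i j where ij: "{a, b} = {antipodal_pair (x i), antipodal_pair (x j)}"
        "i \<in> {1..N}" "j \<in> {1..N}" "x i \<bullet> x j = 0"
        by (auto simp: orth_graph_edges_def)
      then have "antipodal_pair (x i) \<in> I T" "antipodal_pair (x j) \<in> I T" using a b by auto
      then show False using memI ij notboth[OF T] by auto
    qed (auto simp: I_def)
    have 1: "(\<Sum>(i, j) | 1 \<le> i \<and> i \<le> j \<and> j \<le> N \<and>
          antipodal_pair (x i) \<in> I T \<and> antipodal_pair (x j) \<in> I T. w i j)
        = (\<Sum>(i, j)\<in>D. w i j * (indicator A (T *v x i) * indicator A (T *v x j)))"
    proof -
      have "{(i, j). 1 \<le> i \<and> i \<le> j \<and> j \<le> N \<and> antipodal_pair (x i) \<in> I T \<and> antipodal_pair (x j) \<in> I T}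
          = {ij \<in> D. antipodal_pair (x (fst ij)) \<in> I T \<and> antipodal_pair (x (snd ij)) \<in> I T}"
        by (auto simp: D_def)
      then have "(\<Sum>(i, j) | 1 \<le> i \<and> i \<le> j \<and> j \<le> N \<and>
            antipodal_pair (x i) \<in> I T \<and> antipodal_pair (x j) \<in> I T. w i j)
          = (\<Sum>ij\<in>D. if antipodal_pair (x (fst ij)) \<in> I T \<and> antipodal_pair (x (snd ij)) \<in> I T
              then w (fst ij) (snd ij) else 0)"
        by (simp only: sum.inter_filter[OF finD] case_prod_unfold)
      also have "\<dots> = (\<Sum>ij\<in>D. w (fst ij) (snd ij)
          * (indicator A (T *v x (fst ij)) * indicator A (T *v x (snd ij))))"
      proof (rule sum.cong[OF refl])
        fix ij assume "ij \<in> D"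
        then have "fst ij \<in> {1..N}" "snd ij \<in> {1..N}" by (auto simp: D_def)
        then show "(if antipodal_pair (x (fst ij)) \<in> I T \<and> antipodal_pair (x (snd ij)) \<in> I T
            then w (fst ij) (snd ij) else 0)
          = w (fst ij) (snd ij) * (indicator A (T *v x (fst ij)) * indicator A (T *v x (snd ij)))"
          using memI by (simp add: indicator_def)
      qed
      finally show ?thesis by (simp only: case_prod_unfold)
    qed
    have 2: "(\<Sum>(Y, Z) | (Y, Z) \<in> congruent_pairs N x \<and> Y \<subseteq> I T. s Y Z) = (\<Sum>(Y, Z)\<in>CP. s Y Z * \<psi> Y T)"
    proof -
      have "{(Y, Z). (Y, Z) \<in> congruent_pairs N x \<and> Y \<subseteq> I T} = {YZ \<in> CP. fst YZ \<subseteq> I T}"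
        by (auto simp: CP_def)
      then have "(\<Sum>(Y, Z) | (Y, Z) \<in> congruent_pairs N x \<and> Y \<subseteq> I T. s Y Z)
          = (\<Sum>YZ\<in>CP. if fst YZ \<subseteq> I T then s (fst YZ) (snd YZ) else 0)"
        by (simp only: sum.inter_filter[OF finCP] case_prod_unfold)
      also have "\<dots> = (\<Sum>YZ\<in>CP. s (fst YZ) (snd YZ) * \<psi> (fst YZ) T)"
        using verts by (intro sum.cong refl) (simp add: \<psi>)
      finally show ?thesis by (simp only: case_prod_unfold)
    qed
    have 3: "(\<Sum>(Y, Z) | (Y, Z) \<in> congruent_pairs N x \<and> Z \<subseteq> I T. s Y Z) = (\<Sum>(Y, Z)\<in>CP. s Y Z * \<psi> Z T)"
    proof -
      have "{(Y, Z). (Y, Z) \<in> congruent_pairs N x \<and> Z \<subseteq> I T} = {YZ \<in> CP. snd YZ \<subseteq> I T}"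
        by (auto simp: CP_def)
      then have "(\<Sum>(Y, Z) | (Y, Z) \<in> congruent_pairs N x \<and> Z \<subseteq> I T. s Y Z)
          = (\<Sum>YZ\<in>CP. if snd YZ \<subseteq> I T then s (fst YZ) (snd YZ) else 0)"
        by (simp only: sum.inter_filter[OF finCP] case_prod_unfold)
      also have "\<dots> = (\<Sum>YZ\<in>CP. s (fst YZ) (snd YZ) * \<psi> (snd YZ) T)"
        using verts by (intro sum.cong refl) (simp add: \<psi>)
      finally show ?thesis by (simp only: case_prod_unfold)
    qed
    show "\<Phi> T \<ge> 0"
      using ind[OF indep] unfolding 1 2 3 \<Phi>_def
      by (simp add: case_prod_unfold right_diff_distrib sum_subtractf)
  qed
  then have "(\<integral>T. \<Phi> T \<partial>M) \<ge> 0" by (rule integral_nonneg_AE)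
  moreover have "(\<integral>T. \<Phi> T \<partial>M) = q\<^sub>1 - (\<Sum>(i, j)\<in>D. w i j * F (x i) (x j))"
  proof -
    have i1: "integrable M (\<lambda>T. indicator A (T *v y) * indicator A (T *v z) :: real)" for y z
      by (rule integrable_const_bound[where B = 1]) (auto simp: indicator_def)
    define a where "a T = (\<Sum>(i, j)\<in>D. w i j * (indicator A (T *v x i) * indicator A (T *v x j)))" for T
    define b where "b T = (\<Sum>(Y, Z)\<in>CP. s Y Z * (\<psi> Y T - \<psi> Z T))" for T
    have ia: "integrable M a"
      unfolding a_def[abs_def] case_prod_unfold
      by (intro Bochner_Integration.integrable_sum integrable_mult_right i1)
    have ib: "integrable M b"
      unfolding b_def[abs_def] case_prod_unfold
      by (intro Bochner_Integration.integrable_sum integrable_mult_right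
          Bochner_Integration.integrable_diff int\<psi> verts)
    have "(\<integral>T. a T \<partial>M) = (\<Sum>(i, j)\<in>D. w i j * F (x i) (x j))"
      unfolding a_def case_prod_unfold
      by (subst Bochner_Integration.integral_sum) (auto simp: F_def intro!: i1)
    moreover have "(\<integral>T. b T \<partial>M) = 0"
    proof -
      have "(\<integral>T. b T \<partial>M) = (\<Sum>YZ\<in>CP. (\<integral>T. s (fst YZ) (snd YZ) * (\<psi> (fst YZ) T - \<psi> (snd YZ) T) \<partial>M))"
        unfolding b_def case_prod_unfold using verts int\<psi>
        by (intro Bochner_Integration.integral_sum) auto
      also have "\<dots> = (\<Sum>YZ\<in>CP. s (fst YZ) (snd YZ) * ((\<integral>T. \<psi> (fst YZ) T \<partial>M) - (\<integral>T. \<psi> (snd YZ) T \<partial>M)))"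
        using verts int\<psi> by (intro sum.cong) auto
      also have "\<dots> = 0" using E\<psi> by (intro sum.neutral) auto
      finally show ?thesis .
    qed
    moreover have "(\<integral>T. \<Phi> T \<partial>M) = q\<^sub>1 - (\<integral>T. a T \<partial>M) + (\<integral>T. b T \<partial>M)"
    proof -
      have "\<Phi> = (\<lambda>T. q\<^sub>1 - a T + b T)" by (simp add: \<Phi>_def a_def b_def fun_eq_iff)
      then show ?thesis using ia ib prob_space by simp
    qed
    ultimately show ?thesis by simp
  qed
  ultimately show ?thesis using le by linarith
qed

section \<open>Reduction to symmetric Borel sets\<close>

text \<open>A set measurable for the completion has a Borel part \<open>C\<close> of the same
  measure, and adjoining \<open>- C\<close> changes inner products only by a sign, so none becomes
  0. The result contains \<open>A\<close> up to a null set.\<close>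

lemma ex_borel_symmetric_superset:
  fixes A :: "(real^'n) set"
  assumes A: "A \<in> sets sphere_measure" "avoids_orthogonality A"
  obtains B :: "(real^'n) set" where "B \<in> sets borel" "\<And>x. - x \<in> B \<longleftrightarrow> x \<in> B" "avoids_orthogonality B"
    "measure sphere_measure A / measure sphere_measure (sphere 0 1 :: (real^'n) set) \<le> measure uniform_sphere B"
proof -
  define N where "N = scale_measure (of_nat CARD('n))
    (distr (restrict_space lborel (cball 0 1 - {0})) (restrict_space borel (sphere 0 1))
      (\<lambda>y::real^'n. y /\<^sub>R norm y))"
  have sm: "sphere_measure = completion N" by (simp add: sphere_measure_def N_def)
  define C where "C = main_part N A"
  have CN: "C \<in> sets N" using A(1) by (simp add: C_def sm)
  then have C: "C \<in> sets borel" "C \<subseteq> sphere 0 1"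
    by (auto simp: N_def sets_restrict_space_iff)
  have "C \<subseteq> A" using A(1) unfolding C_def sm by (subst (2) main_part_null_part_Un[symmetric]) auto
  have "emeasure sphere_measure A = emeasure N C"
    using A(1) by (simp add: sm C_def emeasure_completion)
  also have "\<dots> = emeasure sphere_measure C" unfolding sm using CN by simp
  finally have mAC: "measure sphere_measure A = measure sphere_measure C" by (simp add: measure_def)
  define B where "B = C \<union> uminus ` C"
  have "(uminus :: real^'n \<Rightarrow> real^'n) ` C = uminus -` C" by (auto simp: image_iff) (metis minus_minus)
  then have B: "B = C \<union> uminus -` C" by (simp add: B_def)
  have "uminus -` C \<in> sets borel"
    using measurable_sets[of "uminus :: real^'n \<Rightarrow> real^'n" borel borel C] C by simp
  then have Bb: "B \<in> sets borel" using C by (simp add: B)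
  show ?thesis
  proof (rule that[OF Bb])
    show "- y \<in> B \<longleftrightarrow> y \<in> B" for y by (auto simp: B)
    show "avoids_orthogonality B"
      using A(2) \<open>C \<subseteq> A\<close> unfolding avoids_orthogonality_def B
      by (auto simp: subset_iff) (metis inner_minus_left inner_minus_right minus_equation_iff neg_equal_0_iff_equal)+
    interpret \<sigma>: prob_space "uniform_sphere :: (real^'n) measure" by (rule prob_space_uniform_sphere)
    have "\<sigma>.prob C \<le> \<sigma>.prob B" using Bb by (intro \<sigma>.finite_measure_mono) (auto simp: B)
    then show "measure sphere_measure A / measure sphere_measure (sphere 0 1 :: (real^'n) set) \<le> \<sigma>.prob B"
      by (simp add: mAC measure_sphere_measure_eq[OF C])
  qed
qed

theorem theorem3p1:
  fixes x :: "nat \<Rightarrow> real ^ 'n"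
    and N :: nat
    and q\<^sub>1 w\<^sub>0 :: real
    and w :: "nat \<Rightarrow> nat \<Rightarrow> real"
    and s :: "(real ^ 'n) set set \<Rightarrow> (real ^ 'n) set set \<Rightarrow> real"
  assumes "CARD('n) \<ge> 2"
    and "\<And>i. i \<in> {1..N} \<Longrightarrow> x i \<in> sphere 0 1"
    and "\<And>i j. i \<in> {1..N} \<Longrightarrow> j \<in> {1..N} \<Longrightarrow> i \<noteq> j \<Longrightarrow> x i \<noteq> x j \<and> x i \<noteq> - x j"
    and "\<And>k. even k \<Longrightarrow>
           w\<^sub>0 * poly (gegenbauer CARD('n) k) 0
           + (\<Sum>(i, j) | 1 \<le> i \<and> i \<le> j \<and> j \<le> N.
                w i j * poly (gegenbauer CARD('n) k) (x i \<bullet> x j)) \<ge> 1"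
    and "\<And>I. orth_graph_independent N x I \<Longrightarrow>
           q\<^sub>1
           - (\<Sum>(i, j) | 1 \<le> i \<and> i \<le> j \<and> j \<le> N \<and>
                antipodal_pair (x i) \<in> I \<and> antipodal_pair (x j) \<in> I. w i j)
           + (\<Sum>(Y, Z) | (Y, Z) \<in> congruent_pairs N x \<and> Y \<subseteq> I. s Y Z)
           - (\<Sum>(Y, Z) | (Y, Z) \<in> congruent_pairs N x \<and> Z \<subseteq> I. s Y Z) \<ge> 0"
  shows "alpha TYPE('n) \<le> q\<^sub>1"
proof -
  obtain M :: "(real^'n^'n) measure" where "prob_space M" "sets M = sets borel"
    "AE T in M. orthogonal_matrix T" "\<And>S. orthogonal_matrix S \<Longrightarrow> distr M borel (\<lambda>T. T ** S) = M"
    using ex_invariant_measure_orthogonal_matrix by blast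
  then interpret random_orthogonal_matrix M
    by (intro random_orthogonal_matrix.intro random_orthogonal_matrix_axioms.intro)
  show ?thesis
    unfolding alpha_def
  proof (rule cSUP_least)
    have "({} :: (real^'n) set) \<in> {A. A \<in> sets sphere_measure \<and> avoids_orthogonality A}"
      by (simp add: avoids_orthogonality_def)
    then show "{A :: (real^'n) set. A \<in> sets sphere_measure \<and> avoids_orthogonality A} \<noteq> {}" by blast
  next
    fix A :: "(real^'n) set" assume "A \<in> {A. A \<in> sets sphere_measure \<and> avoids_orthogonality A}"
    then obtain B :: "(real^'n) set" where B: "B \<in> sets borel" "\<And>x. - x \<in> B \<longleftrightarrow> x \<in> B" "avoids_orthogonality B"
      "measure sphere_measure A / measure sphere_measure (sphere 0 1 :: (real^'n) set) \<le> measure uniform_sphere B"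
      using ex_borel_symmetric_superset[of A] by blast
    have "measure uniform_sphere B \<le> q\<^sub>1"
      by (rule measure_le_if_avoids_orthogonality[where N = N and x = x and w = w and s = s and w\<^sub>0 = w\<^sub>0])
        (fact assms B)+
    then show "measure sphere_measure A / measure sphere_measure (sphere 0 1 :: (real^'n) set) \<le> q\<^sub>1"
      using B(4) by linarith
  qed
qed

end
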